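(* Let $H\in C(\mathbb T^d\times\mathbb R^d)$ be such that $p\mapsto H(x,p)$ is convex for every $x\in\mathbb T^d$, and for $\lambda\ge0$ consider $$\lambda u-\mathcal Iu+H(x,Du)=0\quad\text{in }\mathbb T^d.\qquad(HJ^\lambda)$$ Assume (EX): $(HJ^\lambda)$ admits a continuous solution for every $\lambda\in[0,1)$; and (LB): there is $\kappa>0$ such that any continuous solution $u$ of $(HJ^\lambda)$ with $\lambda\in[0,1)$ satisfies $|Du(x)|\le\kappa$ for a.e. $x\in\mathbb T^d$. For $\lambda\in(0,1)$ let $u_\lambda$ be the unique continuous solution of $(HJ^\lambda)$. Let $L$, $Q$, $K=\mathbb T^d\times Q$, and the set $\mathfrak M(L)$ of Mather measures be as defined in the context. Let $\mathfrak S_-$ be the set of continuous solutions $u$ of $(HJ^0)$ such that $\int_K u(x)\,\mu(dx\,d\xi)\le0$ for every $\mu\in\mathfrak M(L)$, and let $$u_0(x):=\sup_{u\in\mathfrak S_-}u(x),\qquad x\in\mathbb T^d.$$ Then the functions $u_\lambda$ converge to $u_0$ uniformly on $\mathbb T^d$ as $\lambda\to0^+$. Furthermore, $u_0\in\mathfrak S_-$ and $$\max_{\mu\in\mathfrak M(L)}\int_K u_0(x)\,\mu(dx\,d\xi)=0.$$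
   Context: $\mathbb T^d=\mathbb R^d/\mathbb Z^d$; functions on $\mathbb T^d$ are identified with $\mathbb Z^d$-periodic functions on $\mathbb R^d$. $B_R$ is the open ball of radius $R$ centered at $0$, $B=B_1$, $\mathbf 1_B$ its characteristic function. Standing assumptions: $\nu$ is a positive Borel measure on $\mathbb R^d$ and $j:\mathbb T^d\times\mathbb R^d\to\mathbb R^d$ is Borel measurable, with: (N) $\int_{\mathbb R^d}1\wedge|z|^2\,\nu(dz)\le C_\nu$ for some $C_\nu>0$; (J1) there is $C_j>0$ with $|j(x,z)|\le C_j|z|$ and $|j(x,z)-j(y,z)|\le C_j|x-y||z|$ for all $x,y\in\mathbb T^d$, $z\in\mathbb R^d$; (J2) for every $R>0$ there is $C_R>0$ with $\int_{\mathbb R^d\setminus B_R}|j(x,z)-j(y,z)|\,\nu(dz)\le C_R|x-y|$ for all $x,y\in\mathbb T^d$. For $\varphi\in C^2(\mathbb T^d)$, $\mathcal I\varphi(x)=\int_{\mathbb R^d}\big(\varphi(x+j(x,z))-\varphi(x)-\mathbf 1_B(z)\langle j(x,z),D\varphi(x)\rangle\big)\nu(dz)$. Viscosity solutions: for $G\in C(\mathbb T^d\times\mathbb R^d)$, $u\in C(\mathbb T^d)$ is a subsolution (resp. supersolution) of $\lambda u-\mathcal Iu+G(x,Du)=0$ in $\mathbb T^d$ if, whenever $\varphi\in C^2(\mathbb T^d)$ and $u-\varphi$ attains its maximum (resp. minimum) over $\mathbb T^d$ at $\hat x$, one has $\lambda u(\hat x)-\mathcal I\varphi(\hat x)+G(\hat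 x,D\varphi(\hat x))\le0$ (resp. $\ge0$). A solution is both. Under the assumptions of the theorem, $(HJ^\lambda)$ has exactly one continuous solution for each $\lambda\in(0,1)$. Definition of $Q$ and $L$: $Q\subset\mathbb R^d$ is a compact set such that the subdifferential $\partial_pH(x,p)\subset Q$ for all $(x,p)\in\mathbb T^d\times\overline B_\kappa$, and $K:=\mathbb T^d\times Q$. Set $\widetilde H(x,p):=\max\{H(x,p),|p|^2-k\}$ with $k\in\mathbb N$ large enough that $\widetilde H=H$ on $\mathbb T^d\times\overline B_\kappa$, and $L(x,\xi):=\sup_{p\in\mathbb R^d}[\langle p,\xi\rangle-\widetilde H(x,p)]$, a continuous function on $\mathbb T^d\times\mathbb R^d$. Mather measures: for $\phi\in C(K)$ put $H_\phi(x,p):=\max_{\xi\in Q}[\langle p,\xi\rangle-\phi(x,\xi)]$. Let $\mathcal G_K(0)$ be the set of $\phi\in C(K)$ for which there is $u\in C(\mathbb T^d)$ that is a subsolution of $-\mathcal Iu+H_\phi(x,Du)=0$ in $\mathbb T^d$. Let $\mathcal G'_K(0)$ be the set of Borel probability measures $\mu$ on $K$ with $\int_Kf\,d\mu\ge0$ for all $f\in\mathcal G_K(0)$. Then $\min_{\mu\in\mathcal G'_K(0)}\int_KL\,d\mu=0$, and $\mathfrak M(L)$ is the (nonempty) set of $\mu\in\mathcal G'_K(0)$ with $\int_KL(x,\xi)\,\mu(dx\,d\xi)=0$. *)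

theory Defs
  imports "HOL-Probability.Probability"
begin

section \<open>The torus\<close>

definition lattice_equiv :: "real^'d \<Rightarrow> real^'d \<Rightarrow> bool" where
  "lattice_equiv x y \<longleftrightarrow> (\<forall>i. x $ i - y $ i \<in> \<int>)"

lemma equivp_lattice_equiv: "equivp lattice_equiv"
proof (rule equivpI)
  show "reflp (lattice_equiv :: real^'d \<Rightarrow> _)"
    by (auto simp: reflp_def lattice_equiv_def)
  show "symp (lattice_equiv :: real^'d \<Rightarrow> _)"
    unfolding symp_def lattice_equiv_def by (metis Ints_minus minus_diff_eq)
  show "transp (lattice_equiv :: real^'d \<Rightarrow> _)"
  proof (rule transpI)
    fix x y z :: "real^'d"
    assume "lattice_equiv x y" "lattice_equiv y z"
    then have "(x $ i - y $ i) + (y $ i - z $ i) \<in> \<int>" for i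
      by (intro Ints_add) (auto simp: lattice_equiv_def)
    then show "lattice_equiv x z"
      by (simp add: lattice_equiv_def)
  qed
qed

quotient_type 'd torus = "real^('d::finite)" / lattice_equiv
  by (rule equivp_lattice_equiv)

instantiation torus :: (finite) topological_space
begin

definition open_torus :: "'a torus set \<Rightarrow> bool" where
  "open_torus U \<longleftrightarrow> open (abs_torus -` U)"

instance
proof
  show "open (UNIV :: 'a torus set)"
    by (simp add: open_torus_def)
  show "open (S \<inter> T)" if "open S" "open T" for S T :: "'a torus set"
    using that by (auto simp: open_torus_def)
  show "open (\<Union> \<U>)" if "\<forall>S\<in>\<U>. open S" for \<U> :: "'a torus set set"
    using that by (auto simp: open_torus_def vimage_Union)
qed

end

text \<open>
  Functions on the torus are represented by lattice-periodic functions on \<open>real^'d\<close>; only measures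
  live on the quotient type itself. A periodic \<open>f\<close> is the function \<open>\<lambda>a. f (rep_torus a)\<close> on the
  torus, by the following lemma.
\<close>

definition periodic :: "(real^'d \<Rightarrow> 'b) \<Rightarrow> bool" where
  "periodic f \<longleftrightarrow> (\<forall>x y. lattice_equiv x y \<longrightarrow> f x = f y)"

lemma periodic_rep_abs: "periodic f \<Longrightarrow> f (rep_torus (abs_torus x)) = f x"
proof -
  assume "periodic f"
  moreover have "abs_torus (rep_torus (abs_torus x)) = abs_torus x"
    by (rule Quotient3_abs_rep[OF Quotient3_torus])
  then have "lattice_equiv (rep_torus (abs_torus x)) x"
    by (simp add: torus.abs_eq_iff)
  ultimately show "f (rep_torus (abs_torus x)) = f x"
    by (simp add: periodic_def)
qed

definition C_torus :: "(real^'d \<Rightarrow> real) set" where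
  "C_torus = {u. periodic u \<and> continuous_on UNIV u}"

definition C2_torus :: "(real^'d \<Rightarrow> real) set" where
  "C2_torus = {\<phi>. periodic \<phi> \<and>
     (\<exists>g A. (\<forall>x. GDERIV \<phi> x :> g x) \<and>
            (\<forall>x. (g has_derivative (\<lambda>h. A x *v h)) (at x)) \<and>
            continuous_on UNIV A)}"

definition grad :: "(real^'d \<Rightarrow> real) \<Rightarrow> real^'d \<Rightarrow> real^'d" where
  "grad \<phi> x = (THE D. GDERIV \<phi> x :> D)"


section \<open>The nonlocal operator\<close>

text \<open>
  For functions of \<open>x\<close> that are periodic, the bounds (J1), (J2) for all \<open>x\<close>, \<open>y\<close> in
  \<open>real^'d\<close> with the Euclidean distance are the same as those with the quotient distance on the torus,
  which is the least Euclidean distance between representatives.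
\<close>

definition levy_condition :: "(real^'d) measure \<Rightarrow> bool" where
  "levy_condition \<nu> \<longleftrightarrow>
     (\<exists>C>0. (\<integral>\<^sup>+z. ennreal (min 1 ((norm z)\<^sup>2)) \<partial>\<nu>) \<le> ennreal C)"

definition jump_condition1 :: "(real^'d \<Rightarrow> real^'d \<Rightarrow> real^'d) \<Rightarrow> bool" where
  "jump_condition1 j \<longleftrightarrow>
     (\<exists>C>0. (\<forall>x z. norm (j x z) \<le> C * norm z) \<and>
            (\<forall>x y z. norm (j x z - j y z) \<le> C * norm (x - y) * norm z))"

definition jump_condition2 ::
    "(real^'d) measure \<Rightarrow> (real^'d \<Rightarrow> real^'d \<Rightarrow> real^'d) \<Rightarrow> bool" where
  "jump_condition2 \<nu> j \<longleftrightarrow>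
     (\<forall>R>0. \<exists>C>0. \<forall>x y.
        (\<integral>\<^sup>+z \<in> - ball 0 R. ennreal (norm (j x z - j y z)) \<partial>\<nu>) \<le> ennreal (C * norm (x - y)))"

definition standing_assumptions ::
    "(real^'d) measure \<Rightarrow> (real^'d \<Rightarrow> real^'d \<Rightarrow> real^'d) \<Rightarrow> bool" where
  "standing_assumptions \<nu> j \<longleftrightarrow>
     sets \<nu> = sets borel \<and>
     periodic j \<and> (\<lambda>(x, z). j x z) \<in> borel_measurable borel \<and>
     levy_condition \<nu> \<and> jump_condition1 j \<and> jump_condition2 \<nu> j"

definition nonlocal_op ::
    "(real^'d) measure \<Rightarrow> (real^'d \<Rightarrow> real^'d \<Rightarrow> real^'d) \<Rightarrow> (real^'d \<Rightarrow> real) \<Rightarrow> real^'d \<Rightarrow> real" where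
  "nonlocal_op \<nu> j \<phi> x =
     (\<integral>z. \<phi> (x + j x z) - \<phi> x - indicator (ball 0 1) z * (j x z \<bullet> grad \<phi> x) \<partial>\<nu>)"


section \<open>Viscosity solutions of \<open>\<delta> u - I u + G(x, Du) = 0\<close>\<close>

definition visc_subsolution ::
    "(real^'d) measure \<Rightarrow> (real^'d \<Rightarrow> real^'d \<Rightarrow> real^'d) \<Rightarrow> real \<Rightarrow> (real^'d \<Rightarrow> real^'d \<Rightarrow> real) \<Rightarrow>
     (real^'d \<Rightarrow> real) \<Rightarrow> bool" where
  "visc_subsolution \<nu> j \<delta> G u \<longleftrightarrow> u \<in> C_torus \<and>
     (\<forall>\<phi>\<in>C2_torus. \<forall>x. (\<forall>y. u y - \<phi> y \<le> u x - \<phi> x) \<longrightarrow>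
        \<delta> * u x - nonlocal_op \<nu> j \<phi> x + G x (grad \<phi> x) \<le> 0)"

definition visc_supersolution ::
    "(real^'d) measure \<Rightarrow> (real^'d \<Rightarrow> real^'d \<Rightarrow> real^'d) \<Rightarrow> real \<Rightarrow> (real^'d \<Rightarrow> real^'d \<Rightarrow> real) \<Rightarrow>
     (real^'d \<Rightarrow> real) \<Rightarrow> bool" where
  "visc_supersolution \<nu> j \<delta> G u \<longleftrightarrow> u \<in> C_torus \<and>
     (\<forall>\<phi>\<in>C2_torus. \<forall>x. (\<forall>y. u x - \<phi> x \<le> u y - \<phi> y) \<longrightarrow>
        \<delta> * u x - nonlocal_op \<nu> j \<phi> x + G x (grad \<phi> x) \<ge> 0)"

definition visc_solution ::
    "(real^'d) measure \<Rightarrow> (real^'d \<Rightarrow> real^'d \<Rightarrow> real^'d) \<Rightarrow> real \<Rightarrow> (real^'d \<Rightarrow> real^'d \<Rightarrow> real) \<Rightarrow>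
     (real^'d \<Rightarrow> real) \<Rightarrow> bool" where
  "visc_solution \<nu> j \<delta> G u \<longleftrightarrow> visc_subsolution \<nu> j \<delta> G u \<and> visc_supersolution \<nu> j \<delta> G u"

text \<open>
  The bound \<open>|Du| \<le> \<kappa>\<close> almost everywhere is the usual one for functions with bounded weak gradient, that is
  for Lipschitz functions, which by Rademacher's theorem are differentiable almost everywhere.
  Without the Lipschitz clause the bound would also admit Cantor-type functions, whose pointwise
  derivative vanishes almost everywhere.
\<close>

definition gradient_bound :: "real \<Rightarrow> (real^'d \<Rightarrow> real) \<Rightarrow> bool" where
  "gradient_bound \<kappa> u \<longleftrightarrow> (\<exists>C. C-lipschitz_on UNIV u) \<and>
     (AE x in lborel. \<exists>D. (GDERIV u x :> D) \<and> norm D \<le> \<kappa>)"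


section \<open>Lagrangian and Mather measures\<close>

definition subdiff :: "(real^'d \<Rightarrow> real) \<Rightarrow> real^'d \<Rightarrow> (real^'d) set" where
  "subdiff f p = {\<xi>. \<forall>q. f q \<ge> f p + \<xi> \<bullet> (q - p)}"

definition H_tilde ::
    "(real^'d \<Rightarrow> real^'d \<Rightarrow> real) \<Rightarrow> nat \<Rightarrow> real^'d \<Rightarrow> real^'d \<Rightarrow> real" where
  "H_tilde H k x p = max (H x p) ((norm p)\<^sup>2 - real k)"

definition lagrangian ::
    "(real^'d \<Rightarrow> real^'d \<Rightarrow> real) \<Rightarrow> nat \<Rightarrow> real^'d \<Rightarrow> real^'d \<Rightarrow> real" where
  "lagrangian H k x \<xi> = (SUP p. p \<bullet> \<xi> - H_tilde H k x p)"

text \<open>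
  A function on \<open>K = T \<times> Q\<close> is represented by any \<open>\<phi>\<close> defined for all \<open>\<xi>\<close>; only the values
  for \<open>\<xi> \<in> Q\<close> are used.
\<close>

definition C_K :: "(real^'d) set \<Rightarrow> (real^'d \<Rightarrow> real^'d \<Rightarrow> real) set" where
  "C_K Q = {\<phi>. (\<forall>\<xi>\<in>Q. periodic (\<lambda>x. \<phi> x \<xi>)) \<and> continuous_on (UNIV \<times> Q) (\<lambda>(x, \<xi>). \<phi> x \<xi>)}"

definition H_of ::
    "(real^'d) set \<Rightarrow> (real^'d \<Rightarrow> real^'d \<Rightarrow> real) \<Rightarrow> real^'d \<Rightarrow> real^'d \<Rightarrow> real" where
  "H_of Q \<phi> x p = (SUP \<xi>\<in>Q. p \<bullet> \<xi> - \<phi> x \<xi>)"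

definition G_K ::
    "(real^'d) measure \<Rightarrow> (real^'d \<Rightarrow> real^'d \<Rightarrow> real^'d) \<Rightarrow> (real^'d) set \<Rightarrow>
     (real^'d \<Rightarrow> real^'d \<Rightarrow> real) set" where
  "G_K \<nu> j Q = {\<phi> \<in> C_K Q. \<exists>u. visc_subsolution \<nu> j 0 (H_of Q \<phi>) u}"

definition integral_K ::
    "('d::finite torus \<times> (real^'d)) measure \<Rightarrow> (real^'d \<Rightarrow> real^'d \<Rightarrow> real) \<Rightarrow> real" where
  "integral_K \<mu> f = (\<integral>(a, \<xi>). f (rep_torus a) \<xi> \<partial>\<mu>)"

definition G_K_dual ::
    "(real^'d) measure \<Rightarrow> (real^'d \<Rightarrow> real^'d \<Rightarrow> real^'d) \<Rightarrow> (real^'d) set \<Rightarrow>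
     ('d torus \<times> (real^'d)) measure set" where
  "G_K_dual \<nu> j Q = {\<mu>. prob_space \<mu> \<and> sets \<mu> = sets (restrict_space borel (UNIV \<times> Q)) \<and>
     (\<forall>f \<in> G_K \<nu> j Q. integral_K \<mu> f \<ge> 0)}"

definition mather_measures ::
    "(real^'d) measure \<Rightarrow> (real^'d \<Rightarrow> real^'d \<Rightarrow> real^'d) \<Rightarrow> (real^'d) set \<Rightarrow>
     (real^'d \<Rightarrow> real^'d \<Rightarrow> real) \<Rightarrow> ('d torus \<times> (real^'d)) measure set" where
  "mather_measures \<nu> j Q L = {\<mu> \<in> G_K_dual \<nu> j Q. integral_K \<mu> L = 0}"

definition S_minus ::
    "(real^'d) measure \<Rightarrow> (real^'d \<Rightarrow> real^'d \<Rightarrow> real^'d) \<Rightarrow> (real^'d \<Rightarrow> real^'d \<Rightarrow> real) \<Rightarrow>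
     ('d::finite torus \<times> (real^'d)) measure set \<Rightarrow> (real^'d \<Rightarrow> real) set" where
  "S_minus \<nu> j H M = {u. visc_solution \<nu> j 0 H u \<and> (\<forall>\<mu>\<in>M. integral_K \<mu> (\<lambda>x \<xi>. u x) \<le> 0)}"

end

theory Submission
  imports Defs "HOL-Complex_Analysis.Great_Picard"
begin

text \<open>
  Viscosity subsolutions of the discounted equation for Hamiltonians \<open>H_of Q \<phi>\<close> form a convex cone
  (doubling of variables), and comparison with \<open>u \<delta>\<close> evaluates at \<open>L\<close> the dual cone of functionals.
  For every point \<open>z\<close>, a Hahn-Banach argument thus gives a positive normalised functional
  \<open>\<Lambda>\<close> on \<open>C(K)\<close> with \<open>\<Lambda> L \<le> \<delta> * u \<delta> z\<close> and \<open>\<Lambda> \<phi> \<ge> \<delta> * \<psi> z\<close> for all such \<open>\<phi>\<close> and subsolutions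
  \<open>\<psi>\<close>. As \<open>\<delta> \<rightarrow> 0\<close> these functionals accumulate at Mather measures \<open>\<mu>\<close>, and the choice
  \<open>\<phi> = L + \<delta> v\<close>, \<open>\<psi> = v\<close> with a solution \<open>v\<close> of the limit equation yields
  \<open>v z - \<integral> v d\<mu> \<le> lim u \<delta> z\<close>. Conversely \<open>L - \<delta> u \<delta>\<close> belongs to \<open>G_K\<close>, so that \<open>\<integral> u \<delta> d\<mu> \<le> 0\<close> for all
  Mather measures \<open>\<mu>\<close>. Hence every accumulation point of \<open>u \<delta>\<close> is the largest element of \<open>S\<close>.
\<close>

section \<open>Twice continuously differentiable functions\<close>

text \<open>The momenta produced by doubling have the size of \<open>n\<close> times a distance and
  need not stay bounded. Hamiltonians \<open>H_of Q \<phi>\<close> with compact \<open>Q\<close> are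
  immune to this: a maximising \<open>\<xi>\<close> lies in \<open>Q\<close>, so only the sum of the
  two momenta and the modulus of continuity of \<open>\<phi>\<close> enter. The gradient bound
  allows working with such Hamiltonians, since solutions only see momenta of norm at most
  \<open>\<kappa>\<close>, where \<open>H\<close> and \<open>H_of Q L\<close> agree. The second
  obstacle is the nonlocal term, which is given for test functions, whereas doubling has to add the
  increments of the subsolutions themselves. Exchanging one for the other requires test functions
  squeezed between a subsolution and a given test function. In the limit, first order information in
  \<open>\<delta>\<close> must survive: \<open>\<Lambda> L\<close> and the discount terms are of the
  same order, so the inequality is divided by \<open>\<delta>\<close> before passing to the limit.
  Linear minorants of a limit superior take the place of weak compactness, and the measure is found
  on the Euclidean compact set \<open>cube 0 \<times> Q\<close> and then pushed to the
  torus.\<close>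

definition C2_grad :: "(real^'d \<Rightarrow> real) \<Rightarrow> (real^'d \<Rightarrow> real^'d) \<Rightarrow> bool" where
  "C2_grad f g \<longleftrightarrow> (\<forall>x. GDERIV f x :> g x) \<and>
     (\<exists>A. (\<forall>x. (g has_derivative (\<lambda>h. A x *v h)) (at x)) \<and> continuous_on UNIV A)"

lemma C2_torus_iff: "\<phi> \<in> C2_torus \<longleftrightarrow> periodic \<phi> \<and> (\<exists>g. C2_grad \<phi> g)"
  by (auto simp: C2_torus_def C2_grad_def)

lemma GDERIV_grad: "GDERIV f x :> D \<Longrightarrow> grad f x = D"
proof -
  assume D: "GDERIV f x :> D"
  have "D' = D" if "GDERIV f x :> D'" for D'
  proof -
    have "(\<lambda>h. h \<bullet> D') = (\<lambda>h. h \<bullet> D)"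
      using that D has_derivative_unique unfolding gderiv_def by blast
    then have "\<forall>h. h \<bullet> D' = h \<bullet> D"
      by (simp add: fun_eq_iff)
    then show ?thesis
      by (simp add: vector_eq_ldot)
  qed
  then show ?thesis
    unfolding grad_def using D by (intro the_equality) blast+
qed

text \<open>\<open>grad\<close> is a definite description, so gradients are carried as an argument
  of \<open>C2_grad\<close>, computed there by calculus rules, and identified with
  \<open>grad\<close> only here.\<close>

lemma C2_grad_eq: "C2_grad f g \<Longrightarrow> grad f = g"
  by (auto simp: C2_grad_def intro!: ext GDERIV_grad)

lemma C2_grad_imp_GDERIV: "C2_grad f g \<Longrightarrow> GDERIV f x :> g x"
  by (auto simp: C2_grad_def)

lemma C2_grad_cong: "C2_grad f g \<Longrightarrow> (\<And>x. f x = f' x) \<Longrightarrow> (\<And>x. g x = g' x) \<Longrightarrow> C2_grad f' g'"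
proof -
  assume "C2_grad f g" "\<And>x. f x = f' x" "\<And>x. g x = g' x"
  then have "f = f'" "g = g'"
    by (auto intro: ext)
  then show ?thesis using \<open>C2_grad f g\<close> by simp
qed

lemma C2_grad_const: "C2_grad (\<lambda>x. c) (\<lambda>x. 0)"
  unfolding C2_grad_def
  by (auto intro!: GDERIV_const exI[of _ "\<lambda>x. 0"] continuous_intros has_derivative_eq_rhs[OF has_derivative_const])

lemma C2_grad_add:
  assumes "C2_grad f g" "C2_grad f' g'"
  shows "C2_grad (\<lambda>x. f x + f' x) (\<lambda>x. g x + g' x)"
proof -
  obtain A A' where "\<And>x. (g has_derivative (\<lambda>h. A x *v h)) (at x)" "continuous_on UNIV A"
    "\<And>x. (g' has_derivative (\<lambda>h. A' x *v h)) (at x)" "continuous_on UNIV A'"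
    using assms unfolding C2_grad_def by blast
  then have "(\<forall>x. ((\<lambda>x. g x + g' x) has_derivative (\<lambda>h. (A x + A' x) *v h)) (at x)) \<and>
      continuous_on UNIV (\<lambda>x. A x + A' x)"
    by (auto intro!: continuous_intros has_derivative_add simp: matrix_vector_mult_add_rdistrib)
  then show ?thesis
    using assms unfolding C2_grad_def by (auto intro!: GDERIV_add)
qed

lemma C2_grad_sum:
  assumes "finite I" "\<And>i. i \<in> I \<Longrightarrow> C2_grad (f i) (g i)"
  shows "C2_grad (\<lambda>x. \<Sum>i\<in>I. f i x) (\<lambda>x. \<Sum>i\<in>I. g i x)"
  using assms by (induction I) (auto intro: C2_grad_const C2_grad_add)

lemma C2_grad_nth: "C2_grad (\<lambda>x::real^'d. x $ i) (\<lambda>x. axis i 1)"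
proof -
  have "GDERIV (\<lambda>x. x $ i) x :> axis i 1" for x :: "real^'d"
    unfolding gderiv_def by (simp add: inner_axis bounded_linear_imp_has_derivative bounded_linear_vec_nth)
  moreover have "((\<lambda>x::real^'d. axis i (1::real)) has_derivative (\<lambda>h. (0::real^'d^'d) *v h)) (at x)" for x
    by (rule has_derivative_eq_rhs[OF has_derivative_const]) auto
  ultimately show ?thesis
    unfolding C2_grad_def by (metis continuous_on_const)
qed

lemma C2_grad_compose:
  assumes fg: "C2_grad f g"
    and h: "\<And>t. (h has_real_derivative h' t) (at t)" "\<And>t. (h' has_real_derivative h'' t) (at t)"
      "continuous_on UNIV h''"
  shows "C2_grad (\<lambda>x. h (f x)) (\<lambda>x. h' (f x) *\<^sub>R g x)"
proof -
  obtain A where A: "\<And>x. (g has_derivative (\<lambda>h. A x *v h)) (at x)" "continuous_on UNIV A"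
    using fg unfolding C2_grad_def by blast
  have f: "(f has_derivative (\<lambda>h. h \<bullet> g x)) (at x)" for x
    using fg unfolding C2_grad_def gderiv_def by blast
  \<comment> \<open>The Hessian of the composition: \<open>h'\<close> times the Hessian of
    \<open>f\<close>, plus \<open>h''\<close> times the outer square of its gradient.\<close>
  define B where "B x = h' (f x) *\<^sub>R A x + h'' (f x) *\<^sub>R (\<chi> i k. g x $ i * g x $ k)" for x
  have "((\<lambda>x. h' (f x)) has_derivative (\<lambda>k. h'' (f x) * (k \<bullet> g x))) (at x)" for x
    by (rule has_derivative_compose[OF f h(2)[unfolded has_field_derivative_def]])
  from has_derivative_scaleR[OF this A(1)]
  have D: "((\<lambda>x. h' (f x) *\<^sub>R g x) has_derivative (\<lambda>k. h' (f x) *\<^sub>R (A x *v k) + (h'' (f x) * (k \<bullet> g x)) *\<^sub>R g x)) (at x)" for x .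
  have "h' (f x) *\<^sub>R (A x *v k) + (h'' (f x) * (k \<bullet> g x)) *\<^sub>R g x = B x *v k" for x k
    unfolding B_def
    by (simp add: vec_eq_iff matrix_vector_mult_def inner_vec_def sum.distrib sum_distrib_left sum_distrib_right algebra_simps)
  then have D': "((\<lambda>x. h' (f x) *\<^sub>R g x) has_derivative (\<lambda>k. B x *v k)) (at x)" for x
    using D[of x] by simp
  have cf: "continuous_on UNIV f"
    by (rule has_derivative_continuous_on[OF f])
  have cg: "continuous_on UNIV g"
    by (rule has_derivative_continuous_on[OF A(1)])
  have ch: "continuous_on UNIV h'"
    by (rule DERIV_continuous_on[OF h(2)])
  have "continuous_on UNIV B"
    unfolding B_def
    by (intro continuous_on_add continuous_on_scaleR A(2) continuous_on_vec_lambda continuous_on_mult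
        continuous_on_component cg
        continuous_on_compose2[OF ch cf] continuous_on_compose2[OF h(3) cf]) auto
  moreover have "GDERIV (\<lambda>x. h (f x)) x :> h' (f x) *\<^sub>R g x" for x
    using GDERIV_DERIV_compose[OF C2_grad_imp_GDERIV[OF fg] h(1)] .
  ultimately show ?thesis
    unfolding C2_grad_def using D' by blast
qed

lemma C2_grad_cmult: "C2_grad f g \<Longrightarrow> C2_grad (\<lambda>x. c * f x) (\<lambda>x. c *\<^sub>R g x)"
  by (rule C2_grad_compose[where h = "\<lambda>t. c * t" and h' = "\<lambda>t. c" and h'' = "\<lambda>t. 0"])
     (auto intro!: derivative_eq_intros continuous_intros)

lemma C2_grad_minus: "C2_grad f g \<Longrightarrow> C2_grad (\<lambda>x. - f x) (\<lambda>x. - g x)"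
  using C2_grad_cmult[of f g "-1"] by simp

lemma C2_grad_diff: "C2_grad f g \<Longrightarrow> C2_grad f' g' \<Longrightarrow> C2_grad (\<lambda>x. f x - f' x) (\<lambda>x. g x - g' x)"
  using C2_grad_add[OF _ C2_grad_minus, of f g f' g'] by simp

text \<open>By polarisation a product is half of a difference of squares, and squares are covered by
  the chain rule.\<close>

lemma C2_grad_mult:
  assumes "C2_grad f g" "C2_grad f' g'"
  shows "\<exists>G. C2_grad (\<lambda>x. f x * f' x) G"
proof -
  have sq: "C2_grad (\<lambda>x. (f x)^2) (\<lambda>x. (2 * f x) *\<^sub>R g x)" if "C2_grad f g" for f g
    by (rule C2_grad_compose[OF that, where h = "\<lambda>t. t^2" and h' = "\<lambda>t. 2 * t" and h'' = "\<lambda>t. 2"])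
       (auto intro!: derivative_eq_intros continuous_intros)
  note C2_grad_cmult[OF C2_grad_diff[OF C2_grad_diff[OF sq[OF C2_grad_add[OF assms]] sq[OF assms(1)]] sq[OF assms(2)]], of "1/2"]
  moreover have "(1/2) * ((f x + f' x)^2 - (f x)^2 - (f' x)^2) = f x * f' x" for x
    by (simp add: power2_eq_square algebra_simps)
  ultimately show ?thesis
    by auto
qed

lemma C2_grad_shift:
  fixes a :: "real^'d"
  assumes "C2_grad f g"
  shows "C2_grad (\<lambda>x. f (x + a)) (\<lambda>x. g (x + a))"
proof -
  obtain A where A: "\<And>x. (g has_derivative (\<lambda>h. A x *v h)) (at x)" "continuous_on UNIV A"
    using assms unfolding C2_grad_def by blast
  have f: "(f has_derivative (\<lambda>h. h \<bullet> g x)) (at x)" for x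
    using assms unfolding C2_grad_def gderiv_def by blast
  have s: "((\<lambda>x. x + a) has_derivative (\<lambda>h. h)) (at x)" for x :: "real^'d"
    by (auto intro!: derivative_eq_intros)
  have "GDERIV (\<lambda>x. f (x + a)) x :> g (x + a)" for x
    unfolding gderiv_def using has_derivative_compose[OF s f] by simp
  moreover have "((\<lambda>x. g (x + a)) has_derivative (\<lambda>h. A (x + a) *v h)) (at x)" for x
    using has_derivative_compose[OF s A(1)] by simp
  moreover have "continuous_on UNIV (\<lambda>x. A (x + a))"
    by (intro continuous_on_compose2[OF A(2)] continuous_intros) auto
  ultimately show ?thesis
    unfolding C2_grad_def by (intro conjI allI exI[of _ "\<lambda>x. A (x + a)"]) auto
qed

lemma GDERIV_zero_at_min:
  assumes "GDERIV f x :> D" "\<And>y. f x \<le> f y"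
  shows "D = 0"
proof -
  have "(\<lambda>h. h \<bullet> D) = (\<lambda>h. 0)"
    using assms differential_zero_maxmin[of x UNIV f "\<lambda>h. h \<bullet> D"] by (auto simp: gderiv_def)
  then have "D \<bullet> D = 0"
    by (rule fun_cong)
  then show ?thesis by simp
qed

lemma GDERIV_eq_at_touching:
  assumes "GDERIV f x :> D" "GDERIV g x :> E" "f x = g x" "\<And>y. f y \<le> g y"
  shows "D = E"
  using GDERIV_zero_at_min[OF GDERIV_diff[OF assms(2,1)]] assms(3,4) by simp

section \<open>Periodic functions\<close>

lemma lattice_equiv_refl [simp]: "lattice_equiv x x"
  by (simp add: lattice_equiv_def)

lemma lattice_equiv_add_right: "lattice_equiv x y \<Longrightarrow> lattice_equiv (x + a) (y + a)"
  by (simp add: lattice_equiv_def)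

lemma lattice_equiv_diff:
  "lattice_equiv x y \<Longrightarrow> lattice_equiv x' y' \<Longrightarrow> lattice_equiv (x - x') (y - y')"
proof -
  assume a: "lattice_equiv x y" "lattice_equiv x' y'"
  have "(x$i - y$i) - (x'$i - y'$i) \<in> \<int>" for i
    using a Ints_diff[of "x$i - y$i" "x'$i - y'$i"] by (simp add: lattice_equiv_def)
  then show ?thesis
    by (simp add: lattice_equiv_def algebra_simps)
qed

text \<open>A compact fundamental domain centred at an arbitrary point. Opposite faces are
  equivalent, so representatives in it are not unique.\<close>

definition cube :: "real^'d \<Rightarrow> (real^'d) set" where
  "cube x = cbox (x - (\<chi> i. 1/2)) (x + (\<chi> i. 1/2))"

lemma mem_cube: "y \<in> cube x \<longleftrightarrow> (\<forall>i. \<bar>y $ i - x $ i\<bar> \<le> 1/2)"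
proof -
  have "(x $ i - 1/2 \<le> y $ i \<and> y $ i \<le> x $ i + 1/2) \<longleftrightarrow> \<bar>y $ i - x $ i\<bar> \<le> 1/2" for i
    by linarith
  then show ?thesis
    by (simp add: cube_def mem_box_cart)
qed

lemma compact_cube: "compact (cube x)"
  by (simp add: cube_def)

lemma cube_self [simp]: "x \<in> cube x"
  by (simp add: mem_cube)

lemma lattice_equiv_cube_ex: "\<exists>y\<in>cube a. lattice_equiv x y"
proof -
  define y where "y = (\<chi> i. x $ i - of_int (round (x $ i - a $ i)))"
  have "y \<in> cube a"
    unfolding mem_cube y_def
  proof
    fix i
    show "\<bar>(\<chi> i. x $ i - of_int (round (x $ i - a $ i))) $ i - a $ i\<bar> \<le> 1/2"
      using of_int_round_abs_le[of "x $ i - a $ i"] unfolding vec_lambda_beta by linarith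
  qed
  moreover have "lattice_equiv x y"
    by (auto simp: lattice_equiv_def y_def)
  ultimately show ?thesis by blast
qed

text \<open>An integer of modulus at most 1/2 is zero. Hence a maximum that is strict modulo the
  lattice is a strict maximum on the compact set \<open>cube x\<close>.\<close>

lemma cube_lattice_equiv_eq:
  assumes "lattice_equiv x y" "x \<in> cube y"
  shows "x = y"
proof -
  have "x $ i - y $ i = 0" for i
  proof -
    obtain k :: int where k: "x $ i - y $ i = of_int k"
      using assms(1) by (auto simp: lattice_equiv_def elim: Ints_cases)
    moreover have "\<bar>x $ i - y $ i\<bar> < 1"
      using assms(2) order.strict_trans1[of "\<bar>x $ i - y $ i\<bar>" "1/2" 1] unfolding mem_cube by simp
    ultimately show ?thesis by simp
  qed
  then show ?thesis by (simp add: vec_eq_iff)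
qed

lemma periodicD: "periodic f \<Longrightarrow> lattice_equiv x y \<Longrightarrow> f x = f y"
  by (auto simp: periodic_def)

lemma periodic_cube: 
  assumes "periodic f" obtains y where "y \<in> cube a" "lattice_equiv x y" "f x = f y"
  using assms lattice_equiv_cube_ex[of a x] by (auto simp: periodic_def)

lemma periodic_cube_all: "periodic f \<Longrightarrow> (\<And>y. y \<in> cube a \<Longrightarrow> P (f y)) \<Longrightarrow> P (f x)"
  by (metis periodic_cube)

lemma C_torusD: "u \<in> C_torus \<Longrightarrow> periodic u" "u \<in> C_torus \<Longrightarrow> continuous_on A u"
  by (auto simp: C_torus_def intro: continuous_on_subset)

lemma C_torus_const: "(\<lambda>x. c) \<in> C_torus"
  by (auto simp: C_torus_def periodic_def)

lemma C_torus_add: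
  assumes "u \<in> C_torus" "v \<in> C_torus"
  shows "(\<lambda>x. u x + v x) \<in> C_torus"
proof -
  have "u x + v x = u y + v y" if "lattice_equiv x y" for x y
    using assms that by (metis C_torusD(1) periodicD)
  then show ?thesis
    using assms unfolding C_torus_def periodic_def by (auto intro!: continuous_intros)
qed

lemma C_torus_cmult:
  assumes "u \<in> C_torus"
  shows "(\<lambda>x. c * u x) \<in> C_torus"
proof -
  have "c * u x = c * u y" if "lattice_equiv x y" for x y
    using assms that by (metis C_torusD(1) periodicD)
  then show ?thesis
    using assms unfolding C_torus_def periodic_def by (auto intro!: continuous_intros)
qed

lemma C_torus_minus: "u \<in> C_torus \<Longrightarrow> (\<lambda>x. - u x) \<in> C_torus"
  using C_torus_cmult[of u "-1"] by simp

lemma C_torus_diff: "u \<in> C_torus \<Longrightarrow> v \<in> C_torus \<Longrightarrow> (\<lambda>x. u x - v x) \<in> C_torus"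
  using C_torus_add[OF _ C_torus_minus, of u v] by simp

lemma C_torus_bounded: 
  assumes "u \<in> C_torus"
  obtains M where "M > 0" "\<And>x. \<bar>u x\<bar> \<le> M"
proof -
  have "compact (u ` cube 0)"
    using C_torusD(2)[OF assms] compact_cube compact_continuous_image by blast
  then obtain M where M: "M > 0" "\<forall>y\<in>u ` cube 0. norm y \<le> M"
    using compact_imp_bounded bounded_pos by metis
  have "\<bar>u x\<bar> \<le> M" for x
    using periodic_cube_all[OF C_torusD(1)[OF assms], of 0 "\<lambda>y. \<bar>y\<bar> \<le> M" x] M by auto
  then show ?thesis using M that by blast
qed

lemma C_torus_attains_max:
  assumes "u \<in> C_torus"
  obtains x where "x \<in> cube a" "\<And>y. u y \<le> u x"
proof -
  obtain x where x: "x \<in> cube a" "\<forall>y\<in>cube a. u y \<le> u x"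
    using continuous_attains_sup[OF compact_cube, of a u] C_torusD(2)[OF assms] cube_self by blast
  then have "u y \<le> u x" for y
    using periodic_cube_all[OF C_torusD(1)[OF assms], of a "\<lambda>y. y \<le> u x" y] by auto
  then show ?thesis using x that by blast
qed

lemma C_torus_uniformly_continuous:
  assumes "u \<in> C_torus"
  shows "uniformly_continuous_on UNIV u"
proof -
  \<comment> \<open>Room for a representative in the unit cube together with every point at distance
    less than 1 from it.\<close>
  have uc: "uniformly_continuous_on (cbox (- (\<chi> i. 2)) (\<chi> i. 2)) u"
    by (rule compact_uniformly_continuous[OF C_torusD(2)[OF assms] compact_cbox])
  show ?thesis
    unfolding uniformly_continuous_on_def
  proof safe
    fix e :: real assume "e > 0"
    then obtain d where d: "d > 0" "\<And>x y. x \<in> cbox (- (\<chi> i. 2)) (\<chi> i. 2) \<Longrightarrow> y \<in> cbox (- (\<chi> i. 2)) (\<chi> i. 2) \<Longrightarrow> dist y x < d \<Longrightarrow> dist (u y) (u x) < e"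
      using uc unfolding uniformly_continuous_on_def by meson
    have "dist (u y) (u x) < e" if "dist y x < min d 1" for x y
    proof -
      obtain x' where x': "x' \<in> cube 0" "lattice_equiv x x'"
        using lattice_equiv_cube_ex by blast
      define y' where "y' = y + (x' - x)"
      have "lattice_equiv y y'"
        using x'(2) by (auto simp: lattice_equiv_def y'_def)
      have "dist y' x' < min d 1"
        using that by (simp add: y'_def dist_norm algebra_simps)
      then have "\<bar>y' $ i - x' $ i\<bar> < 1" for i
        using component_le_norm_cart[of "y' - x'" i] unfolding dist_norm vector_minus_component by linarith
      moreover have "\<bar>x' $ i\<bar> \<le> 1/2" for i
        using x'(1) by (simp add: mem_cube)
      ultimately have b: "- 2 \<le> y' $ i \<and> y' $ i \<le> 2 \<and> - 2 \<le> x' $ i \<and> x' $ i \<le> 2" for i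
        by (smt (verit) field_sum_of_halves)
      then have "x' \<in> cbox (- (\<chi> i. 2)) (\<chi> i. 2)" "y' \<in> cbox (- (\<chi> i. 2)) (\<chi> i. 2)"
        by (simp_all add: mem_box_cart)
      then have "dist (u y') (u x') < e"
        using d \<open>dist y' x' < min d 1\<close> by auto
      then show ?thesis
        using C_torusD(1)[OF assms] x'(2) \<open>lattice_equiv y y'\<close> by (metis periodicD)
    qed
    then show "\<exists>d>0. \<forall>x\<in>UNIV. \<forall>x'\<in>UNIV. dist x' x < d \<longrightarrow> dist (u x') (u x) < e"
      using d(1) by (intro exI[of _ "min d 1"]) auto
  qed
qed

lemma C2_grad_continuous:
  assumes "C2_grad f g"
  shows "continuous_on A f" "continuous_on A g"
proof -
  obtain B where B: "\<And>x. (g has_derivative (\<lambda>h. B x *v h)) (at x)"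
    using assms unfolding C2_grad_def by blast
  have f: "\<And>x. (f has_derivative (\<lambda>h. h \<bullet> g x)) (at x)"
    using assms unfolding C2_grad_def gderiv_def by blast
  show "continuous_on A f"
    by (rule has_derivative_continuous_on[OF has_derivative_at_withinI[OF f]])
  show "continuous_on A g"
    by (rule has_derivative_continuous_on[OF has_derivative_at_withinI[OF B]])
qed

lemma C2_grad_unique: "C2_grad f g \<Longrightarrow> C2_grad f g' \<Longrightarrow> g = g'"
  using C2_grad_eq by metis

lemma C2_torus_imp_C_torus: "\<phi> \<in> C2_torus \<Longrightarrow> \<phi> \<in> C_torus"
  unfolding C2_torus_iff C_torus_def using C2_grad_continuous(1) by auto

text \<open>A lattice translation leaves \<open>\<phi>\<close> unchanged and translates its
  gradient, and gradients are unique.\<close>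

lemma C2_grad_periodic:
  assumes "C2_grad \<phi> g" "periodic \<phi>"
  shows "periodic g"
  unfolding periodic_def
proof safe
  fix x y :: "real^'a" assume "lattice_equiv x y"
  then have "lattice_equiv z (z + (y - x))" for z
    by (simp add: lattice_equiv_def)
  then have "\<phi> z = \<phi> (z + (y - x))" for z
    using assms(2) periodicD by blast
  then have "(\<lambda>z. \<phi> (z + (y - x))) = \<phi>"
    by (intro ext) simp
  then have "C2_grad \<phi> (\<lambda>z. g (z + (y - x)))"
    using C2_grad_shift[OF assms(1), of "y - x"] by simp
  then have "(\<lambda>z. g (z + (y - x))) = g"
    using assms(1) C2_grad_unique by blast
  from fun_cong[OF this, of x] show "g x = g y" by simp
qed

lemma C2_torus_gradD:
  assumes "\<phi> \<in> C2_torus"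
  shows "C2_grad \<phi> (grad \<phi>)" "periodic (grad \<phi>)" "continuous_on A (grad \<phi>)" "periodic \<phi>" "continuous_on A \<phi>"
    "GDERIV \<phi> x :> grad \<phi> x"
proof -
  obtain g where g: "C2_grad \<phi> g" and p: "periodic \<phi>"
    using assms C2_torus_iff by blast
  show "C2_grad \<phi> (grad \<phi>)" "periodic (grad \<phi>)" "continuous_on A (grad \<phi>)" "periodic \<phi>" "continuous_on A \<phi>"
    "GDERIV \<phi> x :> grad \<phi> x"
    using g p C2_grad_eq[OF g] C2_grad_periodic[OF g p] C2_grad_continuous[OF g] C2_grad_imp_GDERIV[OF g] by auto
qed

text \<open>The matrix of second derivatives is continuous and, by uniqueness of derivatives,
  periodic, so a bound on one cube holds everywhere.\<close>

lemma C2_torus_grad_Lipschitz: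
  assumes "\<phi> \<in> C2_torus"
  obtains M where "M > 0" "\<And>x y. norm (grad \<phi> x - grad \<phi> y) \<le> M * norm (x - y)"
proof -
  define g where "g = grad \<phi>"
  have C: "C2_grad \<phi> g" and pg: "periodic g"
    using C2_torus_gradD[OF assms] by (auto simp: g_def)
  obtain A where A: "\<And>x. (g has_derivative (\<lambda>h. A x *v h)) (at x)" "continuous_on UNIV A"
    using C unfolding C2_grad_def by blast
  have pA: "A x = A y" if "lattice_equiv x y" for x y
  proof -
    have "lattice_equiv (z + (y - x)) z" for z
      using that by (simp add: lattice_equiv_def) (metis Ints_minus minus_diff_eq)
    then have eq: "(\<lambda>z. g (z + (y - x))) = g"
      using periodicD[OF pg] by (intro ext) blast
    have s: "((\<lambda>z. z + (y - x)) has_derivative (\<lambda>h. h)) (at x)"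
      by (auto intro!: derivative_eq_intros)
    have "(g has_derivative (\<lambda>h. A y *v h)) (at (x + (y - x)))"
      using A(1)[of y] by simp
    from has_derivative_compose[OF s this] have "(g has_derivative (\<lambda>h. A y *v h)) (at x)"
      by (simp only: eq)
    then have "(\<lambda>h. A y *v h) = (\<lambda>h. A x *v h)"
      by (rule has_derivative_unique[OF _ A(1)])
    then have "\<forall>h. A y *v h = A x *v h"
      by (simp add: fun_eq_iff)
    then show ?thesis
      unfolding matrix_eq by simp
  qed
  have "compact (A ` cube 0)"
    by (rule compact_continuous_image[OF continuous_on_subset[OF A(2)] compact_cube]) auto
  then obtain B where B: "B > 0" "\<And>x. x \<in> cube 0 \<Longrightarrow> norm (A x) \<le> B"
    using compact_imp_bounded bounded_pos by (metis imageI)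
  have B': "norm (A x) \<le> B" for x
  proof -
    obtain y where "y \<in> cube 0" "lattice_equiv x y"
      using lattice_equiv_cube_ex by blast
    then show ?thesis
      using B(2) pA by metis
  qed
  have c: "\<bar>A x $ i $ j\<bar> \<le> B" for x i j
    using component_le_norm_cart[of "A x $ i" j] Finite_Cartesian_Product.norm_nth_le[of "A x" i] B'[of x] by linarith
  \<comment> \<open>Entrywise bounds control the operator norm at the cost of one factor
    \<open>CARD('a)\<close> for each index.\<close>
  have on: "onorm (\<lambda>h. A x *v h) \<le> real CARD('a) * real CARD('a) * B" for x
    by (rule onorm_le_matrix_component) (rule c)
  have "norm (g x - g y) \<le> real CARD('a) * real CARD('a) * B * norm (x - y)" for x y
    by (rule differentiable_bound[of UNIV g "\<lambda>x h. A x *v h"]) (use A(1) on in auto)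
  moreover have "real CARD('a) * real CARD('a) * B > 0"
    using B(1) by simp
  ultimately show thesis
    using that unfolding g_def by blast
qed

text \<open>The quadratic remainder makes small jumps integrable against the Levy measure. The mean
  value theorem is used only once, so the constant is the Lipschitz constant of the gradient,
  without the factor 1/2.\<close>

lemma C2_torus_Taylor:
  assumes "\<phi> \<in> C2_torus"
  obtains M where "M > 0" "\<And>x h. \<bar>\<phi> (x + h) - \<phi> x - h \<bullet> grad \<phi> x\<bar> \<le> M * (norm h)\<^sup>2"
proof -
  obtain M where M: "M > 0" "\<And>x y. norm (grad \<phi> x - grad \<phi> y) \<le> M * norm (x - y)"
    using C2_torus_grad_Lipschitz[OF assms] by blast
  have "\<bar>\<phi> (x + h) - \<phi> x - h \<bullet> grad \<phi> x\<bar> \<le> M * (norm h)\<^sup>2" for x h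
  proof -
    have d: "((\<lambda>t. \<phi> (x + t *\<^sub>R h)) has_derivative (\<lambda>s. (s *\<^sub>R h) \<bullet> grad \<phi> (x + t *\<^sub>R h))) (at t within {0..1})" for t :: real
    proof -
      have "((\<lambda>t. x + t *\<^sub>R h) has_derivative (\<lambda>s. s *\<^sub>R h)) (at t within {0..1})"
        by (auto intro!: derivative_eq_intros)
      from has_derivative_compose[OF this C2_torus_gradD(6)[OF assms, unfolded gderiv_def]] show ?thesis .
    qed
    obtain t where t: "t \<in> {0..1}" "\<phi> (x + 1 *\<^sub>R h) - \<phi> (x + 0 *\<^sub>R h) = ((1 - 0) *\<^sub>R h) \<bullet> grad \<phi> (x + t *\<^sub>R h)"
      using mvt_very_simple[of 0 1 "\<lambda>t. \<phi> (x + t *\<^sub>R h)", OF _ d] by auto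
    have "\<bar>\<phi> (x + h) - \<phi> x - h \<bullet> grad \<phi> x\<bar> = \<bar>h \<bullet> (grad \<phi> (x + t *\<^sub>R h) - grad \<phi> x)\<bar>"
      using t(2) by (simp add: inner_diff_right)
    also have "\<dots> \<le> norm h * norm (grad \<phi> (x + t *\<^sub>R h) - grad \<phi> x)"
      by (rule Cauchy_Schwarz_ineq2)
    also have "\<dots> \<le> norm h * (M * norm (t *\<^sub>R h))"
      using M(2)[of "x + t *\<^sub>R h" x] by (intro mult_left_mono) auto
    also have "\<dots> \<le> norm h * (M * norm h)"
      using t(1) M(1) by (intro mult_left_mono) (auto intro!: mult_left_le_one_le)
    finally show ?thesis
      by (simp add: power2_eq_square algebra_simps)
  qed
  then show thesis
    using M(1) that by blast
qed

lemma C2_torusI: "C2_grad f g \<Longrightarrow> periodic f \<Longrightarrow> f \<in> C2_torus"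
  by (auto simp: C2_torus_iff)

lemma C2_torus_add:
  assumes "\<phi> \<in> C2_torus" "\<psi> \<in> C2_torus"
  shows "(\<lambda>x. \<phi> x + \<psi> x) \<in> C2_torus" "grad (\<lambda>x. \<phi> x + \<psi> x) = (\<lambda>x. grad \<phi> x + grad \<psi> x)"
proof -
  note C = C2_grad_add[OF C2_torus_gradD(1)[OF assms(1)] C2_torus_gradD(1)[OF assms(2)]]
  have "periodic (\<lambda>x. \<phi> x + \<psi> x)"
    using C_torusD(1)[OF C_torus_add[OF assms[THEN C2_torus_imp_C_torus]]] .
  with C show "(\<lambda>x. \<phi> x + \<psi> x) \<in> C2_torus" by (rule C2_torusI)
  show "grad (\<lambda>x. \<phi> x + \<psi> x) = (\<lambda>x. grad \<phi> x + grad \<psi> x)"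
    by (rule C2_grad_eq[OF C])
qed

lemma C2_torus_cmult:
  assumes "\<phi> \<in> C2_torus"
  shows "(\<lambda>x. c * \<phi> x) \<in> C2_torus" "grad (\<lambda>x. c * \<phi> x) = (\<lambda>x. c *\<^sub>R grad \<phi> x)"
proof -
  note C = C2_grad_cmult[OF C2_torus_gradD(1)[OF assms(1)], of c]
  have "periodic (\<lambda>x. c * \<phi> x)"
    using C_torusD(1)[OF C_torus_cmult[OF assms[THEN C2_torus_imp_C_torus]]] .
  with C show "(\<lambda>x. c * \<phi> x) \<in> C2_torus" by (rule C2_torusI)
  show "grad (\<lambda>x. c * \<phi> x) = (\<lambda>x. c *\<^sub>R grad \<phi> x)"
    by (rule C2_grad_eq[OF C])
qed

lemma C2_torus_minus:
  assumes "\<phi> \<in> C2_torus"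
  shows "(\<lambda>x. - \<phi> x) \<in> C2_torus" "grad (\<lambda>x. - \<phi> x) = (\<lambda>x. - grad \<phi> x)"
  using C2_torus_cmult[OF assms, of "-1"] by simp_all

lemma C2_torus_const: "(\<lambda>x. c) \<in> C2_torus" "grad (\<lambda>x. c) = (\<lambda>x. 0)"
  using C2_torusI[OF C2_grad_const] C2_grad_eq[OF C2_grad_const] by (auto simp: periodic_def)

text \<open>A smooth periodic substitute for the squared distance: it vanishes exactly on the
  lattice and dominates half the squared norm on the centred cube. It serves as the doubling penalty
  and as the perturbation that makes maxima strict.\<close>

definition sper :: "real^'d \<Rightarrow> real" where
  "sper h = (\<Sum>i\<in>UNIV. 1 - cos (2 * pi * h $ i))"

definition dsper :: "real^'d \<Rightarrow> real^'d" where
  "dsper h = (\<Sum>i\<in>UNIV. (2 * pi * sin (2 * pi * h $ i)) *\<^sub>R axis i 1)"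

lemma C2_grad_trig:
  "C2_grad (\<lambda>x. cos (2 * pi * x $ i)) (\<lambda>x. (- 2 * pi * sin (2 * pi * x $ i)) *\<^sub>R axis i 1)"
  "C2_grad (\<lambda>x. sin (2 * pi * x $ i)) (\<lambda>x. (2 * pi * cos (2 * pi * x $ i)) *\<^sub>R axis i 1)"
  by (rule C2_grad_compose[OF C2_grad_nth, where h = "\<lambda>t. cos (2 * pi * t)" and h' = "\<lambda>t. - 2 * pi * sin (2 * pi * t)"
        and h'' = "\<lambda>t. - (2 * pi) * (2 * pi) * cos (2 * pi * t)"];
      auto intro!: derivative_eq_intros continuous_intros)
     (rule C2_grad_compose[OF C2_grad_nth, where h = "\<lambda>t. sin (2 * pi * t)" and h' = "\<lambda>t. 2 * pi * cos (2 * pi * t)"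
        and h'' = "\<lambda>t. - (2 * pi) * (2 * pi) * sin (2 * pi * t)"];
      auto intro!: derivative_eq_intros continuous_intros)

lemma C2_grad_sper: "C2_grad sper dsper"
proof -
  have "C2_grad (\<lambda>x::real^'d. 1 - cos (2 * pi * x $ i)) (\<lambda>x. (2 * pi * sin (2 * pi * x $ i)) *\<^sub>R axis i 1)" for i
    using C2_grad_diff[OF C2_grad_const[of 1] C2_grad_trig(1)[of i]] by simp
  from C2_grad_sum[OF _ this, of UNIV] show ?thesis
    by (rule C2_grad_cong) (auto simp: sper_def dsper_def)
qed

lemma trig_lattice_equiv:
  assumes "lattice_equiv x y"
  shows "cos (2 * pi * x $ i) = cos (2 * pi * y $ i)" "sin (2 * pi * x $ i) = sin (2 * pi * y $ i)"
proof -
  obtain k :: int where "x $ i - y $ i = of_int k"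
    using assms by (auto simp: lattice_equiv_def elim: Ints_cases)
  then have e: "2 * pi * x $ i = 2 * pi * y $ i + 2 * pi * of_int k"
    by (simp add: algebra_simps flip: right_diff_distrib)
  show "cos (2 * pi * x $ i) = cos (2 * pi * y $ i)" "sin (2 * pi * x $ i) = sin (2 * pi * y $ i)"
    unfolding e sin_add cos_add by (simp_all add: sin_int_2pin cos_int_2pin)
qed

lemma periodic_sper: "periodic sper"
  unfolding periodic_def sper_def using trig_lattice_equiv(1) by (intro allI impI sum.cong) auto

lemma sper_C2_torus: "sper \<in> C2_torus"
  by (rule C2_torusI[OF C2_grad_sper periodic_sper])

lemma grad_sper: "grad sper = dsper"
  by (rule C2_grad_eq[OF C2_grad_sper])

lemma sper_shift:
  shows "(\<lambda>x. sper (x - a)) \<in> C2_torus" "grad (\<lambda>x. sper (x - a)) = (\<lambda>x. dsper (x - a))"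
proof -
  have C: "C2_grad (\<lambda>x. sper (x - a)) (\<lambda>x. dsper (x - a))"
    using C2_grad_shift[OF C2_grad_sper, of "- a"] by simp
  have "periodic (\<lambda>x. sper (x - a))"
    unfolding periodic_def using lattice_equiv_diff[OF _ lattice_equiv_refl] periodicD[OF periodic_sper] by blast
  with C show "(\<lambda>x. sper (x - a)) \<in> C2_torus" by (rule C2_torusI)
  show "grad (\<lambda>x. sper (x - a)) = (\<lambda>x. dsper (x - a))"
    by (rule C2_grad_eq[OF C])
qed

lemma sper_0 [simp]: "sper 0 = 0" "dsper 0 = 0"
  by (simp_all add: sper_def dsper_def)

lemma sper_minus [simp]: "sper (- h) = sper h" "dsper (- h) = - dsper h"
  by (simp_all add: sper_def dsper_def sum_negf)

lemma sper_nonneg: "0 \<le> sper h"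
  unfolding sper_def by (intro sum_nonneg) auto

lemma sper_ge:
  assumes "h \<in> cube 0"
  shows "(norm h)\<^sup>2 / 2 \<le> sper h"
proof -
  \<comment> \<open>One coordinate at a time, with
    \<open>1 - cos (2 * pi * t) = 2 * (sin (pi * t))^2\<close> and
    \<open>\<bar>sin y\<bar> \<ge> \<bar>y\<bar> / 3\<close> for
    \<open>\<bar>y\<bar> \<le> 2\<close>; the latter follows from the cubic error of the
    sine.\<close>
  have key: "t\<^sup>2 / 2 \<le> 1 - cos (2 * pi * t)" if t: "\<bar>t\<bar> \<le> 1/2" for t :: real
  proof -
    define y where "y = pi * t"
    have y2: "\<bar>y\<bar> \<le> 2"
      using t pi_less_4 mult_mono[of pi 4 "\<bar>t\<bar>" "1/2"] by (simp add: y_def abs_mult)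
    have "\<bar>sin y - y\<bar> \<le> \<bar>y\<bar> ^ 3 / 6"
      using Maclaurin_sin_bound[of y 3] by (simp add: sin_coeff_def numeral_eq_Suc lessThan_Suc field_simps)
    also have "\<bar>y\<bar> ^ 3 = \<bar>y\<bar>\<^sup>2 * \<bar>y\<bar>"
      by (simp add: power3_eq_cube power2_eq_square)
    also have "\<bar>y\<bar>\<^sup>2 * \<bar>y\<bar> \<le> 2\<^sup>2 * \<bar>y\<bar>"
      using y2 by (intro mult_right_mono power_mono) auto
    finally have "\<bar>sin y - y\<bar> \<le> 2 / 3 * \<bar>y\<bar>"
      by simp
    moreover have "\<bar>y\<bar> \<le> \<bar>sin y - y\<bar> + \<bar>sin y\<bar>"
      by arith
    ultimately have "\<bar>y\<bar> / 3 \<le> \<bar>sin y\<bar>"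
      by linarith
    then have "(\<bar>y\<bar> / 3)\<^sup>2 \<le> \<bar>sin y\<bar>\<^sup>2"
      by (intro power_mono) auto
    then have a: "y\<^sup>2 / 9 \<le> (sin y)\<^sup>2"
      by (simp add: power_divide)
    have "2\<^sup>2 * t\<^sup>2 \<le> pi\<^sup>2 * t\<^sup>2"
      using pi_ge_two by (intro mult_right_mono power_mono) auto
    then have "4 * t\<^sup>2 \<le> y\<^sup>2"
      by (simp add: y_def power_mult_distrib)
    moreover have "1 - cos (2 * pi * t) = 2 * (sin y)\<^sup>2"
      using cos_double_sin[of y] by (simp add: y_def algebra_simps)
    moreover have "t\<^sup>2 \<ge> 0" by simp
    ultimately show ?thesis
      using a by linarith
  qed
  have "(norm h)\<^sup>2 / 2 = (\<Sum>i\<in>UNIV. (h $ i)\<^sup>2 / 2)"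
    by (simp add: norm_vec_def L2_set_def sum_nonneg sum_divide_distrib)
  also have "\<dots> \<le> sper h"
    unfolding sper_def using assms by (intro sum_mono key) (simp add: mem_cube)
  finally show ?thesis .
qed

lemma sper_pos: "\<not> lattice_equiv x y \<Longrightarrow> sper (x - y) > 0"
proof -
  assume n: "\<not> lattice_equiv x y"
  obtain h where h: "h \<in> cube 0" "lattice_equiv (x - y) h"
    using lattice_equiv_cube_ex by blast
  have "h \<noteq> 0"
    using n h(2) by (auto simp: lattice_equiv_def)
  then have "0 < (norm h)\<^sup>2 / 2" by simp
  also have "\<dots> \<le> sper h" using sper_ge h(1) by blast
  also have "\<dots> = sper (x - y)" using periodicD[OF periodic_sper h(2)] by simp
  finally show ?thesis .
qed

section \<open>Smooth approximation\<close>

text \<open>The torus as a compact subset of Euclidean space, one circle for each coordinate.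
  Stone-Weierstrass is applied on this image.\<close>

definition trig_embed :: "real^'d \<Rightarrow> (real^'d) \<times> (real^'d)" where
  "trig_embed x = (\<chi> i. cos (2 * pi * x $ i), \<chi> i. sin (2 * pi * x $ i))"

lemma continuous_trig_embed: "continuous_on A trig_embed"
  unfolding trig_embed_def by (intro continuous_intros continuous_on_vec_lambda)

lemma trig_embed_eq_iff: "trig_embed x = trig_embed y \<longleftrightarrow> lattice_equiv x y"
proof
  assume e: "trig_embed x = trig_embed y"
  show "lattice_equiv x y"
    unfolding lattice_equiv_def
  proof
    fix i
    have "cos (2 * pi * x $ i) = cos (2 * pi * y $ i)" "sin (2 * pi * x $ i) = sin (2 * pi * y $ i)"
      using e by (auto simp: trig_embed_def vec_eq_iff)
    then have "sin (2 * pi * x $ i) = sin (2 * pi * y $ i) \<and> cos (2 * pi * x $ i) = cos (2 * pi * y $ i)"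
      by simp
    then obtain n :: int where "2 * pi * x $ i = 2 * pi * y $ i + 2 * pi * of_int n"
      unfolding sin_cos_eq_iff by blast
    then have "2 * pi * (x $ i - y $ i) = 2 * pi * of_int n"
      by (simp add: algebra_simps)
    then have "x $ i - y $ i = of_int n" by simp
    then show "x $ i - y $ i \<in> \<int>" by simp
  qed
next
  assume "lattice_equiv x y"
  from trig_lattice_equiv[OF this] show "trig_embed x = trig_embed y"
    by (simp add: trig_embed_def)
qed

text \<open>The compact cube already maps onto the whole range, so the preimage of a closed set
  under \<open>r\<close> is the image of a compact subset of the cube.\<close>

lemma trig_embed_factor_continuous:
  fixes r :: "(real^'d) \<times> (real^'d) \<Rightarrow> real"
  assumes "(\<lambda>x. r (trig_embed x)) \<in> C_torus"
  shows "continuous_on (range trig_embed) r"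
proof -
  let ?u = "\<lambda>x. r (trig_embed x)"
  have rng: "trig_embed ` A = range trig_embed" if "cube 0 \<subseteq> A" for A :: "(real^'d) set"
  proof -
    have "trig_embed x \<in> trig_embed ` A" for x :: "real^'d"
      using lattice_equiv_cube_ex[of 0 x] trig_embed_eq_iff that by blast
    then show ?thesis by blast
  qed
  have "compact (range trig_embed :: ((real^'d) \<times> (real^'d)) set)"
    using compact_continuous_image[OF continuous_trig_embed compact_cube[of "0::real^'d"]] rng[of "cube 0"] by simp
  then have cl: "closed (range trig_embed :: ((real^'d) \<times> (real^'d)) set)"
    by (rule compact_imp_closed)
  have "closed (r -` B \<inter> range trig_embed)" if "closed B" for B
  proof -
    have "closed (?u -` B \<inter> cube 0)"
      using C_torusD(2)[OF assms] compact_imp_closed[OF compact_cube] that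
      by (intro continuous_on_closed_vimage[THEN iffD1, rule_format]) auto
    then have "compact (?u -` B \<inter> cube 0)"
      using compact_Int_closed[OF compact_cube, of "?u -` B \<inter> cube 0" 0] by (simp add: Int_commute Int_left_commute)
    then have "compact (trig_embed ` (?u -` B \<inter> cube 0))"
      by (rule compact_continuous_image[OF continuous_trig_embed])
    moreover have "trig_embed ` (?u -` B \<inter> cube 0) = r -` B \<inter> range trig_embed"
    proof (intro equalityI subsetI)
      fix z :: "(real^'d) \<times> (real^'d)" assume z: "z \<in> r -` B \<inter> range trig_embed"
      then have "z \<in> trig_embed ` cube 0"
        using rng[of "cube 0"] by simp
      then show "z \<in> trig_embed ` (?u -` B \<inter> cube 0)"
        using z by blast
    qed auto
    ultimately show ?thesis
      by (simp add: compact_imp_closed)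
  qed
  then show ?thesis
    using continuous_on_closed_vimage[OF cl] by blast
qed

text \<open>The functions on the embedded torus whose pullback is twice continuously differentiable
  form an algebra, and the coordinate functions in it separate points.\<close>

lemma C2_torus_dense:
  fixes u :: "real^'d \<Rightarrow> real"
  assumes u: "u \<in> C_torus" and e: "e > 0"
  shows "\<exists>\<psi>\<in>C2_torus. \<forall>x. \<bar>u x - \<psi> x\<bar> < e"
proof -
  define R where "R = {r. (\<lambda>x. r (trig_embed x)) \<in> (C2_torus :: (real^'d \<Rightarrow> real) set)}"
  define S where "S = range (trig_embed :: real^'d \<Rightarrow> _)"
  interpret function_ring_on R S
  proof
    have "trig_embed x \<in> trig_embed ` cube 0" for x :: "real^'d"
      using lattice_equiv_cube_ex[of 0 x] trig_embed_eq_iff by blast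
    then have "trig_embed ` cube (0::real^'d) = S"
      unfolding S_def by blast
    then show "compact S"
      using compact_continuous_image[OF continuous_trig_embed compact_cube] by metis
    show "continuous_on S f" if "f \<in> R" for f
      using trig_embed_factor_continuous that C2_torus_imp_C_torus unfolding R_def S_def by blast
    show "(\<lambda>x. f x + g x) \<in> R" if "f \<in> R" "g \<in> R" for f g
      using that C2_torus_add(1) unfolding R_def by auto
    show "(\<lambda>_. c) \<in> R" for c
      using C2_torus_const unfolding R_def by auto
    show "(\<lambda>x. f x * g x) \<in> R" if "f \<in> R" "g \<in> R" for f g
    proof -
      have fg: "(\<lambda>x::real^'d. f (trig_embed x)) \<in> C2_torus" "(\<lambda>x::real^'d. g (trig_embed x)) \<in> C2_torus"
        using that unfolding R_def by auto
      obtain G where "C2_grad (\<lambda>x::real^'d. f (trig_embed x) * g (trig_embed x)) G"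
        using C2_grad_mult[OF C2_torus_gradD(1)[OF fg(1)] C2_torus_gradD(1)[OF fg(2)]] by blast
      moreover have "periodic (\<lambda>x::real^'d. f (trig_embed x) * g (trig_embed x))"
        unfolding periodic_def using trig_embed_eq_iff by metis
      ultimately show ?thesis
        unfolding R_def by (auto intro: C2_torusI)
    qed
    show "\<exists>f\<in>R. f x \<noteq> f y" if "x \<in> S" "y \<in> S" "x \<noteq> y" for x y
    proof -
      have "(\<lambda>z. fst z $ i) \<in> R" "(\<lambda>z. snd z $ i) \<in> R" for i
        unfolding R_def by (auto simp: trig_embed_def periodic_def trig_lattice_equiv intro!: C2_torusI C2_grad_trig)
      moreover have "(\<exists>i. fst x $ i \<noteq> fst y $ i) \<or> (\<exists>i. snd x $ i \<noteq> snd y $ i)"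
        using that(3) by (auto simp: prod_eq_iff vec_eq_iff)
      ultimately show ?thesis
        by (elim disjE exE) (rule bexI; assumption)+
    qed
  qed
  define r where "r z = u (SOME x. trig_embed x = z)" for z
  have ru: "r (trig_embed x) = u x" for x
  proof -
    have "trig_embed (SOME y. trig_embed y = trig_embed x) = trig_embed x"
      by (rule someI[of "\<lambda>y. trig_embed y = trig_embed x"]) simp
    then show ?thesis
      unfolding r_def trig_embed_eq_iff using C_torusD(1)[OF u] periodicD by blast
  qed
  have "continuous_on S r"
    unfolding S_def by (rule trig_embed_factor_continuous) (use u ru in simp)
  then obtain g where "g \<in> R" "\<forall>x\<in>S. \<bar>r x - g x\<bar> < e"
    using Stone_Weierstrass_basic e by blast
  then show ?thesis
    using ru unfolding R_def S_def by (intro bexI[of _ "\<lambda>x. g (trig_embed x)"]) auto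
qed

text \<open>At the origin the difference quotient is bounded by the power of exponent
  \<open>n + 1\<close>, which tends to zero. The cases \<open>n = 1\<close> and \<open>n = 0\<close>
  give the two derivatives of the cube of the positive part.\<close>

lemma max0_power_deriv:
  "((\<lambda>t. (max 0 t) ^ (n + 2)) has_real_derivative (real (n + 2) * (max 0 t) ^ (n + 1))) (at t)"
proof -
  consider "t > 0" | "t < 0" | "t = 0" by linarith
  then show ?thesis
  proof cases
    case 1
    have "((\<lambda>t. t ^ (n + 2)) has_real_derivative (real (n + 2) * t ^ (n + 1))) (at t)"
      by (rule DERIV_cong[OF DERIV_pow]) simp
    then have "((\<lambda>t. (max 0 t) ^ (n + 2)) has_real_derivative (real (n + 2) * t ^ (n + 1))) (at t)"
      by (rule has_field_derivative_transform_within_open[of _ _ _ "{0<..}"]) (use 1 in \<open>auto simp: max_def\<close>)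
    then show ?thesis using 1 by (simp add: max_def)
  next
    case 2
    have "((\<lambda>t. 0) has_real_derivative 0) (at t)" by simp
    then have "((\<lambda>t. (max 0 t) ^ (n + 2)) has_real_derivative 0) (at t)"
      by (rule has_field_derivative_transform_within_open[of _ _ _ "{..<0}"]) (use 2 in \<open>auto simp: max_def\<close>)
    then show ?thesis using 2 by (simp add: max_def)
  next
    case 3
    have c: "((\<lambda>h. (max 0 h) ^ (n + 1)) \<longlongrightarrow> (max 0 (0::real)) ^ (n + 1)) (at 0)"
      by (intro tendsto_intros)
    have "((\<lambda>h. ((max 0 (0 + h)) ^ (n + 2) - (max 0 0) ^ (n + 2)) / h) \<longlongrightarrow> (0::real)) (at 0)"
    proof (rule Lim_null_comparison[of _ "\<lambda>h. (max 0 h) ^ (n + 1)"])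
      show "\<forall>\<^sub>F h in at 0. norm (((max 0 (0 + h)) ^ (n + 2) - (max 0 0) ^ (n + 2)) / h) \<le> (max 0 h) ^ (n + 1)"
        by (intro always_eventually allI) (auto simp: max_def field_simps)
      show "((\<lambda>h. (max 0 h) ^ (n + 1)) \<longlongrightarrow> (0::real)) (at 0)"
        using c by simp
    qed
    then show ?thesis
      using 3 by (simp add: DERIV_def)
  qed
qed

text \<open>
  The approximation is \<open>\<phi> - \<sigma>(\<phi> - g)\<close> with \<open>g \<ge> u\<close> smooth and close to \<open>u\<close>, where
  \<open>\<sigma>(t) = t\<^sub>+\<^sup>3 / (t\<^sup>2 + e\<^sup>2)\<close> is a smooth lower approximation of the positive part \<open>t\<^sub>+\<close>.
\<close>

lemma C2_torus_between:
  assumes u: "u \<in> C_torus" and \<phi>: "\<phi> \<in> C2_torus" and le: "\<And>x. u x \<le> \<phi> x" and e: "e > 0"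
  shows "\<exists>\<psi>\<in>C2_torus. \<forall>x. u x \<le> \<psi> x \<and> \<psi> x \<le> \<phi> x \<and> \<psi> x \<le> u x + 2 * e"
proof -
  obtain g0 where g0: "g0 \<in> C2_torus" "\<And>x. \<bar>u x - g0 x\<bar> < e / 2"
    using C2_torus_dense[OF u, of "e / 2"] e by auto
  \<comment> \<open>Shifting by half the tolerance turns an approximation into one from above:
    \<open>u \<le> g \<le> u + e\<close>.\<close>
  define g where "g x = g0 x + e / 2" for x
  have g: "g \<in> C2_torus"
    unfolding g_def by (rule C2_torus_add(1)[OF g0(1) C2_torus_const(1)])
  have gu: "u x \<le> g x" "g x \<le> u x + e" for x
    using g0(2)[of x] by (auto simp: g_def abs_if split: if_splits)
  define f where "f x = \<phi> x - g x" for x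
  have C: "\<exists>G. C2_grad f G"
    unfolding f_def using C2_grad_diff[OF C2_torus_gradD(1)[OF \<phi>] C2_torus_gradD(1)[OF g]] by blast
  then obtain G where G: "C2_grad f G" by blast
  define \<psi> where "\<psi> x = \<phi> x - (max 0 (f x)) ^ 3 * inverse ((f x)\<^sup>2 + e\<^sup>2)" for x
  have e2: "t\<^sup>2 + e\<^sup>2 > 0" for t
    using e by (simp add: add_nonneg_pos)
  have C1: "C2_grad (\<lambda>x. (max 0 (f x)) ^ 3) (\<lambda>x. (3 * (max 0 (f x))\<^sup>2) *\<^sub>R G x)"
  proof (rule C2_grad_compose[OF G, where h = "\<lambda>t. (max 0 t) ^ 3" and h' = "\<lambda>t. 3 * (max 0 t)\<^sup>2" and h'' = "\<lambda>t. 3 * (2 * max 0 t)"])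
    show "((\<lambda>t. max 0 t ^ 3) has_real_derivative 3 * (max 0 t)\<^sup>2) (at t)" for t
      using max0_power_deriv[of 1 t] by (simp add: numeral_eq_Suc)
    show "((\<lambda>t. 3 * (max 0 t)\<^sup>2) has_real_derivative 3 * (2 * max 0 t)) (at t)" for t
      using DERIV_cmult[OF max0_power_deriv[of 0 t], of 3] by (simp add: numeral_eq_Suc)
    show "continuous_on UNIV (\<lambda>t::real. 3 * (2 * max 0 t))"
      by (intro continuous_intros)
  qed
  have C2: "C2_grad (\<lambda>x. inverse ((f x)\<^sup>2 + e\<^sup>2)) (\<lambda>x. (- (2 * f x) * (inverse ((f x)\<^sup>2 + e\<^sup>2))\<^sup>2) *\<^sub>R G x)"
  proof (rule C2_grad_compose[OF G, where h = "\<lambda>t. inverse (t\<^sup>2 + e\<^sup>2)" and h' = "\<lambda>t. - (2 * t) * (inverse (t\<^sup>2 + e\<^sup>2))\<^sup>2"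
        and h'' = "\<lambda>t. - 2 * (inverse (t\<^sup>2 + e\<^sup>2))\<^sup>2 + (- (2 * t)) * (2 * inverse (t\<^sup>2 + e\<^sup>2) * (- (2 * t) * (inverse (t\<^sup>2 + e\<^sup>2))\<^sup>2))"])
    show 1: "((\<lambda>t. inverse (t\<^sup>2 + e\<^sup>2)) has_real_derivative - (2 * t) * (inverse (t\<^sup>2 + e\<^sup>2))\<^sup>2) (at t)" for t
    proof -
      have "((\<lambda>t. t\<^sup>2 + e\<^sup>2) has_real_derivative 2 * t) (at t)"
        by (auto intro!: derivative_eq_intros)
      from DERIV_inverse'[OF this less_imp_neq[OF e2[of t], symmetric]] show ?thesis
        by (rule DERIV_cong) (simp add: power2_eq_square algebra_simps)
    qed
    show "((\<lambda>t. - (2 * t) * (inverse (t\<^sup>2 + e\<^sup>2))\<^sup>2) has_real_derivative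
        - 2 * (inverse (t\<^sup>2 + e\<^sup>2))\<^sup>2 + (- (2 * t)) * (2 * inverse (t\<^sup>2 + e\<^sup>2) * (- (2 * t) * (inverse (t\<^sup>2 + e\<^sup>2))\<^sup>2))) (at t)" for t
      by (rule derivative_eq_intros 1 refl)+ (simp add: algebra_simps)
    show "continuous_on UNIV (\<lambda>t. - 2 * (inverse (t\<^sup>2 + e\<^sup>2))\<^sup>2 + (- (2 * t)) * (2 * inverse (t\<^sup>2 + e\<^sup>2) * (- (2 * t) * (inverse (t\<^sup>2 + e\<^sup>2))\<^sup>2)))"
      using e2 by (intro continuous_intros) (auto simp: less_imp_neq[symmetric])
  qed
  obtain G' where G': "C2_grad (\<lambda>x. (max 0 (f x)) ^ 3 * inverse ((f x)\<^sup>2 + e\<^sup>2)) G'"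
    using C2_grad_mult[OF C1 C2] by blast
  have per: "\<psi> x = \<psi> y" if "lattice_equiv x y" for x y
    using periodicD[OF C2_torus_gradD(4)[OF \<phi>] that] periodicD[OF C2_torus_gradD(4)[OF g] that]
    by (simp add: \<psi>_def f_def)
  have "C2_grad \<psi> (\<lambda>x. grad \<phi> x - G' x)"
    using C2_grad_diff[OF C2_torus_gradD(1)[OF \<phi>] G'] unfolding \<psi>_def[abs_def] .
  then have "\<psi> \<in> C2_torus"
    by (rule C2_torusI) (use per in \<open>auto simp: periodic_def\<close>)
  moreover have "u x \<le> \<psi> x \<and> \<psi> x \<le> \<phi> x \<and> \<psi> x \<le> u x + 2 * e" for x
  proof (cases "f x \<le> 0")
    case True
    then have "\<psi> x = \<phi> x" by (simp add: \<psi>_def max_def)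
    then show ?thesis
      using True le[of x] gu[of x] e by (simp add: f_def)
  next
    case False
    define t where "t = f x"
    have t: "t > 0" using False by (simp add: t_def)
    have p: "\<psi> x = \<phi> x - t ^ 3 / (t\<^sup>2 + e\<^sup>2)"
      using t by (simp add: \<psi>_def t_def[symmetric] max_def divide_inverse)
    have "t ^ 3 / (t\<^sup>2 + e\<^sup>2) \<le> t"
      using e2[of t] t e by (simp add: field_simps power2_eq_square power3_eq_cube)
    \<comment> \<open>Together with \<open>\<sigma>(t) \<le> t\<close> this keeps
      \<open>\<psi>\<close> between \<open>g\<close> and \<open>g + e\<close> where
      \<open>\<phi>\<close> exceeds \<open>g\<close>. It amounts to
      \<open>t^2 - t * e + e^2 \<ge> 0\<close>, seen by completing the square.\<close>
    moreover have "t - e \<le> t ^ 3 / (t\<^sup>2 + e\<^sup>2)"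
    proof -
      have "(t - e) * (t\<^sup>2 + e\<^sup>2) = t ^ 3 - e * ((t - e / 2)\<^sup>2 + 3 * e\<^sup>2 / 4)"
        by (simp add: power2_eq_square power3_eq_cube algebra_simps)
      also have "\<dots> \<le> t ^ 3"
        using e by (simp add: add_nonneg_nonneg)
      finally show ?thesis
        using e2[of t] by (simp add: pos_le_divide_eq)
    qed
    moreover have "0 \<le> t ^ 3 / (t\<^sup>2 + e\<^sup>2)"
      using t e2[of t] by simp
    ultimately show ?thesis
      unfolding p using gu[of x] e by (simp add: t_def f_def)
  qed
  ultimately show ?thesis by blast
qed

section \<open>The nonlocal operator\<close>

text \<open>On the part of \<open>C\<close> outside a ball around \<open>x\<close> the maximum of
  \<open>f\<close> is strictly below \<open>f x\<close>, so values close to \<open>f x\<close> force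
  the points into the ball.\<close>

lemma strict_max_tendsto:
  fixes f :: "'a::metric_space \<Rightarrow> real"
  assumes C: "compact C" "continuous_on C f" and x: "x \<in> C" "\<And>y. y \<in> C \<Longrightarrow> y \<noteq> x \<Longrightarrow> f y < f x"
    and a: "\<And>n. a n \<in> C" "(\<lambda>n. f (a n)) \<longlonglongrightarrow> f x"
  shows "a \<longlonglongrightarrow> x"
proof (rule tendstoI)
  fix e :: real assume e: "e > 0"
  have K: "compact (C - ball x e)"
    using C(1) by (intro compact_diff) auto
  show "\<forall>\<^sub>F n in sequentially. dist (a n) x < e"
  proof (cases "C - ball x e = {}")
    case True
    then show ?thesis
      using a(1) by (intro always_eventually allI) (auto simp: dist_commute subset_eq)
  next
    case False
    then obtain y where y: "y \<in> C - ball x e" "\<And>z. z \<in> C - ball x e \<Longrightarrow> f z \<le> f y"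
      using continuous_attains_sup[OF K False] continuous_on_subset[OF C(2)] by (metis Diff_subset)
    have "f y < f x"
      using y(1) e by (intro x) auto
    then have "\<forall>\<^sub>F n in sequentially. f y < f (a n)"
      using a(2) order_tendstoD(1) by blast
    then show ?thesis
    proof eventually_elim
      case (elim n)
      then have "a n \<notin> C - ball x e" using y(2)[of "a n"] by auto
      then show ?case using a(1)[of n] by (auto simp: dist_commute)
    qed
  qed
qed

text \<open>\<open>F\<close> absorbs the zero order term as a function of \<open>x\<close>, and
  supersolutions become instances for the negated function. A single doubling lemma thus serves for
  sums of subsolutions and for comparison.\<close>

definition vsub ::
    "(real^'d) measure \<Rightarrow> (real^'d \<Rightarrow> real^'d \<Rightarrow> real^'d) \<Rightarrow> (real^'d \<Rightarrow> real^'d \<Rightarrow> real) \<Rightarrow>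
     (real^'d \<Rightarrow> real) \<Rightarrow> bool" where
  "vsub \<nu> j F u \<longleftrightarrow> (\<forall>\<phi>\<in>C2_torus. \<forall>x. (\<forall>y. u y - \<phi> y \<le> u x - \<phi> x) \<longrightarrow>
     F x (grad \<phi> x) \<le> nonlocal_op \<nu> j \<phi> x)"

section \<open>Increments, the Levy weight and the operator on test functions\<close>

locale levy_jump =
  fixes \<nu> :: "(real^'d) measure" and j :: "real^'d \<Rightarrow> real^'d \<Rightarrow> real^'d"
  assumes standing: "standing_assumptions \<nu> j"
begin

text \<open>The slope \<open>D\<close> is a separate argument because \<open>u\<close> need not be
  differentiable; it is taken from a test function touching \<open>u\<close> at
  \<open>x\<close>.\<close>

definition incr :: "(real^'d \<Rightarrow> real) \<Rightarrow> real^'d \<Rightarrow> real^'d \<Rightarrow> real^'d \<Rightarrow> real" where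
  "incr u D x z = u (x + j x z) - u x - indicator (ball 0 1) z * (j x z \<bullet> D)"

abbreviation levy_weight :: "real^'d \<Rightarrow> real" where
  "levy_weight z \<equiv> min 1 ((norm z)\<^sup>2)"

lemma nonlocal_op_eq: "nonlocal_op \<nu> j \<phi> x = (\<integral>z. incr \<phi> (grad \<phi> x) x z \<partial>\<nu>)"
  by (simp add: nonlocal_op_def incr_def)

lemma sets_nu [measurable_cong]: "sets \<nu> = sets borel"
  using standing by (simp add: standing_assumptions_def)

lemma space_nu [simp]: "space \<nu> = UNIV"
  using sets_eq_imp_space_eq[OF sets_nu] by simp

lemma j_bound: obtains C where "C > 0" "\<And>x z. norm (j x z) \<le> C * norm z"
  "\<And>x y z. norm (j x z - j y z) \<le> C * norm (x - y) * norm z"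
  using standing unfolding standing_assumptions_def jump_condition1_def by blast

lemma j_measurable: "j x \<in> borel_measurable borel"
proof -
  have "(\<lambda>(x, z). j x z) \<in> borel_measurable borel"
    using standing by (simp add: standing_assumptions_def)
  moreover have "(\<lambda>z. (x, z)) \<in> borel_measurable borel"
    by (intro borel_measurable_continuous_onI continuous_intros)
  ultimately have "(\<lambda>z. (\<lambda>(x, z). j x z) (x, z)) \<in> borel_measurable borel"
    by (rule measurable_compose[rotated])
  then show ?thesis by simp
qed

lemma incr_measurable:
  assumes "continuous_on UNIV u"
  shows "incr u D x \<in> borel_measurable \<nu>"
proof -
  have u: "u \<in> borel_measurable borel"
    by (rule borel_measurable_continuous_onI[OF assms])
  have "(\<lambda>z. x + j x z) \<in> borel_measurable borel"
    by (intro borel_measurable_add borel_measurable_const j_measurable)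
  then have "(\<lambda>z. u (x + j x z)) \<in> borel_measurable borel"
    by (rule measurable_compose[OF _ u])
  then have "incr u D x \<in> borel_measurable borel"
    unfolding incr_def[abs_def]
    by (intro borel_measurable_diff borel_measurable_times borel_measurable_indicator borel_measurable_inner
        borel_measurable_const j_measurable) auto
  then show ?thesis
    using measurable_cong_sets[OF sets_nu refl] by blast
qed

lemma w_measurable: "levy_weight \<in> borel_measurable \<nu>"
proof -
  have "levy_weight \<in> borel_measurable borel" by measurable
  then show ?thesis
    using measurable_cong_sets[OF sets_nu refl] by blast
qed

lemma integrable_w: "integrable \<nu> levy_weight"
proof (rule integrableI_bounded)
  obtain C :: real where "(\<integral>\<^sup>+z. ennreal (levy_weight z) \<partial>\<nu>) \<le> ennreal C"
    using standing unfolding standing_assumptions_def levy_condition_def by blast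
  then have "(\<integral>\<^sup>+z. ennreal (levy_weight z) \<partial>\<nu>) < \<infinity>"
    by (rule le_less_trans) simp
  then show "(\<integral>\<^sup>+z. ennreal (norm (levy_weight z)) \<partial>\<nu>) < \<infinity>"
    by simp
qed (rule w_measurable)

text \<open>Taylor's formula covers the small jumps, where the weight is the squared norm, and
  boundedness the large ones, where it is 1. The constant is uniform in \<open>x\<close>, as
  dominated convergence requires.\<close>

lemma incr_C2_bound:
  assumes \<phi>: "\<phi> \<in> C2_torus"
  obtains C where "C > 0" "\<And>x z. \<bar>incr \<phi> (grad \<phi> x) x z\<bar> \<le> C * levy_weight z"
proof -
  obtain M where M: "M > 0" "\<And>x h. \<bar>\<phi> (x + h) - \<phi> x - h \<bullet> grad \<phi> x\<bar> \<le> M * (norm h)\<^sup>2"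
    using C2_torus_Taylor[OF \<phi>] by blast
  obtain B where B: "B > 0" "\<And>x. \<bar>\<phi> x\<bar> \<le> B"
    using C_torus_bounded[OF C2_torus_imp_C_torus[OF \<phi>]] by blast
  obtain C where C: "C > 0" "\<And>x z. norm (j x z) \<le> C * norm z"
    using j_bound by metis
  have "\<bar>incr \<phi> (grad \<phi> x) x z\<bar> \<le> (M * C\<^sup>2 + 2 * B) * levy_weight z" for x z
  proof (cases "z \<in> ball 0 1")
    case True
    then have w: "levy_weight z = (norm z)\<^sup>2"
      by (simp add: power_le_one less_imp_le)
    have "\<bar>incr \<phi> (grad \<phi> x) x z\<bar> \<le> M * (norm (j x z))\<^sup>2"
      using M(2)[of x "j x z"] True by (simp add: incr_def)
    also have "\<dots> \<le> M * (C * norm z)\<^sup>2"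
      using C M(1) by (intro mult_left_mono power_mono) auto
    also have "\<dots> = M * C\<^sup>2 * (norm z)\<^sup>2"
      by (simp add: power_mult_distrib)
    also have "\<dots> \<le> (M * C\<^sup>2 + 2 * B) * (norm z)\<^sup>2"
      using B(1) by (intro mult_right_mono) auto
    finally show ?thesis unfolding w .
  next
    case False
    then have "1 \<le> norm z" by simp
    then have w: "levy_weight z = 1"
      by (simp add: one_le_power)
    have "\<bar>incr \<phi> (grad \<phi> x) x z\<bar> \<le> 2 * B"
      using B(2)[of x] B(2)[of "x + j x z"] False by (simp add: incr_def)
    also have "\<dots> \<le> M * C\<^sup>2 + 2 * B"
      using M(1) by simp
    finally show ?thesis unfolding w by simp
  qed
  moreover have "M * C\<^sup>2 + 2 * B > 0"
    using M(1) B(1) by (simp add: add_nonneg_pos)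
  ultimately show ?thesis using that by blast
qed

lemma integrable_bound_w:
  assumes "f \<in> borel_measurable \<nu>" "\<And>z. \<bar>f z\<bar> \<le> C * levy_weight z"
  shows "integrable \<nu> f"
  by (rule Bochner_Integration.integrable_bound[OF integrable_mult_right[OF integrable_w, of C]])
     (use assms order_trans[OF assms(2) abs_ge_self] in auto)

lemma integrable_incr_C2:
  assumes \<phi>: "\<phi> \<in> C2_torus"
  shows "integrable \<nu> (incr \<phi> (grad \<phi> x) x)"
proof -
  obtain C where "\<And>x z. \<bar>incr \<phi> (grad \<phi> x) x z\<bar> \<le> C * levy_weight z"
    using incr_C2_bound[OF \<phi>] by metis
  then show ?thesis
    by (intro integrable_bound_w[of _ C] incr_measurable C2_torus_gradD(5)[OF \<phi>])
qed

lemma j_tendsto: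
  assumes "X \<longlonglongrightarrow> x"
  shows "(\<lambda>n. j (X n) z) \<longlonglongrightarrow> j x z"
proof -
  obtain C where C: "\<And>x y z. norm (j x z - j y z) \<le> C * norm (x - y) * norm z"
    using j_bound by metis
  have "(\<lambda>n. C * norm (X n - x) * norm z) \<longlonglongrightarrow> C * norm (x - x) * norm z"
    by (intro tendsto_intros assms)
  then have "(\<lambda>n. C * norm (X n - x) * norm z) \<longlonglongrightarrow> 0" by simp
  then have "(\<lambda>n. j (X n) z - j x z) \<longlonglongrightarrow> 0"
    by (rule Lim_null_comparison[rotated]) (rule always_eventually, rule allI, rule C)
  then show ?thesis by (rule LIM_zero_cancel)
qed

lemma cont_tendsto: "continuous_on UNIV f \<Longrightarrow> X \<longlonglongrightarrow> x \<Longrightarrow> (\<lambda>n. f (X n)) \<longlonglongrightarrow> f x"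
  by (rule continuous_on_tendsto_compose[of UNIV f]) auto

lemma incr_tendsto:
  assumes "continuous_on UNIV u" "X \<longlonglongrightarrow> x" "D \<longlonglongrightarrow> D'"
  shows "(\<lambda>n. incr u (D n) (X n) z) \<longlonglongrightarrow> incr u D' x z"
  unfolding incr_def
  by (intro tendsto_intros cont_tendsto[OF assms(1)] assms(2,3) j_tendsto)

lemma nonlocal_op_tendsto:
  assumes \<phi>: "\<phi> \<in> C2_torus" and X: "X \<longlonglongrightarrow> x"
  shows "(\<lambda>n. nonlocal_op \<nu> j \<phi> (X n)) \<longlonglongrightarrow> nonlocal_op \<nu> j \<phi> x"
proof -
  obtain C where C: "\<And>x z. \<bar>incr \<phi> (grad \<phi> x) x z\<bar> \<le> C * levy_weight z"
    using incr_C2_bound[OF \<phi>] by metis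
  show ?thesis
    unfolding nonlocal_op_eq
  proof (rule integral_dominated_convergence[where w = "\<lambda>z. C * levy_weight z"])
    show "integrable \<nu> (\<lambda>z. C * levy_weight z)"
      by (rule integrable_mult_right[OF integrable_w])
    show "AE z in \<nu>. (\<lambda>n. incr \<phi> (grad \<phi> (X n)) (X n) z) \<longlonglongrightarrow> incr \<phi> (grad \<phi> x) x z"
      by (intro AE_I2 incr_tendsto[OF C2_torus_gradD(5)[OF \<phi>] X] cont_tendsto[OF C2_torus_gradD(3)[OF \<phi>] X])
  qed (use C incr_measurable[OF C2_torus_gradD(5)[OF \<phi>]] in auto)
qed

lemma nonlocal_op_add:
  assumes \<phi>: "\<phi> \<in> C2_torus" and \<psi>: "\<psi> \<in> C2_torus"
  shows "nonlocal_op \<nu> j (\<lambda>x. \<phi> x + \<psi> x) x = nonlocal_op \<nu> j \<phi> x + nonlocal_op \<nu> j \<psi> x"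
proof -
  have "incr (\<lambda>x. \<phi> x + \<psi> x) (grad \<phi> x + grad \<psi> x) x z = incr \<phi> (grad \<phi> x) x z + incr \<psi> (grad \<psi> x) x z" for z
    by (simp add: incr_def algebra_simps inner_add_right)
  then have eq: "incr (\<lambda>x. \<phi> x + \<psi> x) (grad \<phi> x + grad \<psi> x) x =
      (\<lambda>z. incr \<phi> (grad \<phi> x) x z + incr \<psi> (grad \<psi> x) x z)"
    by (rule ext)
  show ?thesis
    unfolding nonlocal_op_eq C2_torus_add(2)[OF \<phi> \<psi>] eq
    by (rule Bochner_Integration.integral_add[OF integrable_incr_C2[OF \<phi>] integrable_incr_C2[OF \<psi>]])
qed

lemma nonlocal_op_cmult:
  assumes \<phi>: "\<phi> \<in> C2_torus"
  shows "nonlocal_op \<nu> j (\<lambda>x. c * \<phi> x) x = c * nonlocal_op \<nu> j \<phi> x"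
proof -
  have "incr (\<lambda>x. c * \<phi> x) (c *\<^sub>R grad \<phi> x) x z = c * incr \<phi> (grad \<phi> x) x z" for z
    by (simp add: incr_def algebra_simps)
  then have eq: "incr (\<lambda>x. c * \<phi> x) (c *\<^sub>R grad \<phi> x) x = (\<lambda>z. c * incr \<phi> (grad \<phi> x) x z)"
    by (rule ext)
  show ?thesis
    unfolding nonlocal_op_eq C2_torus_cmult(2)[OF \<phi>] eq by (rule integral_mult_right_zero)
qed

lemma nonlocal_op_minus: "\<phi> \<in> C2_torus \<Longrightarrow> nonlocal_op \<nu> j (\<lambda>x. - \<phi> x) x = - nonlocal_op \<nu> j \<phi> x"
  using nonlocal_op_cmult[of \<phi> "-1"] by simp

lemma nonlocal_op_const: "nonlocal_op \<nu> j (\<lambda>x. c) x = 0"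
  unfolding nonlocal_op_eq C2_torus_const by (simp add: incr_def[abs_def])

lemma vsubD: "vsub \<nu> j F u \<Longrightarrow> \<phi> \<in> C2_torus \<Longrightarrow> (\<And>y. u y - \<phi> y \<le> u x - \<phi> x) \<Longrightarrow>
    F x (grad \<phi> x) \<le> nonlocal_op \<nu> j \<phi> x"
  unfolding vsub_def by blast

text \<open>
  The test function in the nonlocal term may be replaced by the subsolution itself: the test functions
  decreasing to it have the same gradient at the touching point, and Fatou's lemma applies.
\<close>

lemma vsub_incr:
  assumes sub: "vsub \<nu> j F u" and u: "u \<in> C_torus" and \<phi>: "\<phi> \<in> C2_torus"
    and max: "\<And>y. u y - \<phi> y \<le> u x - \<phi> x"
  shows "integrable \<nu> (incr u (grad \<phi> x) x)" "F x (grad \<phi> x) \<le> (\<integral>z. incr u (grad \<phi> x) x z \<partial>\<nu>)"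
proof -
  define D where "D = grad \<phi> x"
  \<comment> \<open>Shifted by a constant so as to touch \<open>u\<close> at \<open>x\<close> with
    equal values.\<close>
  define \<phi>' where "\<phi>' y = \<phi> y + (u x - \<phi> x)" for y
  have \<phi>': "\<phi>' \<in> C2_torus" and g\<phi>': "grad \<phi>' x = D"
    unfolding \<phi>'_def D_def using C2_torus_add[OF \<phi> C2_torus_const(1), of "u x - \<phi> x"]
    by (simp_all add: C2_torus_const(2))
  have le: "u y \<le> \<phi>' y" and eq: "\<phi>' x = u x" for y
    using max[of y] by (auto simp: \<phi>'_def)
  have "\<exists>\<psi>. \<psi> \<in> C2_torus \<and> (\<forall>y. u y \<le> \<psi> y \<and> \<psi> y \<le> \<phi>' y \<and> \<psi> y \<le> u y + 2 * (1 / real (Suc n)))" for n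
    using C2_torus_between[OF u \<phi>' le, of "1 / real (Suc n)"] by auto
  from choice[OF allI[OF this]] obtain \<psi> where
    "\<forall>n. \<psi> n \<in> C2_torus \<and> (\<forall>y. u y \<le> \<psi> n y \<and> \<psi> n y \<le> \<phi>' y \<and> \<psi> n y \<le> u y + 2 * (1 / real (Suc n)))" ..
  then have \<psi>: "\<psi> n \<in> C2_torus" and ul: "u y \<le> \<psi> n y"
    and lp: "\<psi> n y \<le> \<phi>' y" and lu: "\<psi> n y \<le> u y + 2 * (1 / real (Suc n))" for n y
    by auto
  have \<psi>x: "\<psi> n x = u x" for n
    using ul[of x n] lp[of n x] eq by simp
  \<comment> \<open>\<open>\<psi> n\<close> lies below \<open>\<phi>'\<close> and touches it at
    \<open>x\<close>, so all gradients there equal \<open>D\<close> and all increments carry the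
    same slope.\<close>
  have g\<psi>: "grad (\<psi> n) x = D" for n
    using GDERIV_eq_at_touching[OF C2_torus_gradD(6)[OF \<psi>[of n], of x] C2_torus_gradD(6)[OF \<phi>', of x]] \<psi>x[of n] eq lp g\<phi>' by auto
  have \<psi>u: "(\<lambda>n. \<psi> n y) \<longlonglongrightarrow> u y" for y
  proof (rule tendsto_sandwich[of "\<lambda>n. u y" _ _ "\<lambda>n. u y + 2 * (1 / real (Suc n))"])
    have "(\<lambda>n. u y + 2 * (1 / real (Suc n))) \<longlonglongrightarrow> u y + 2 * 0"
      by (intro tendsto_intros LIMSEQ_Suc[OF lim_1_over_n])
    then show "(\<lambda>n. u y + 2 * (1 / real (Suc n))) \<longlonglongrightarrow> u y" by simp
  qed (use ul lu in \<open>auto intro!: always_eventually\<close>)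
  define W where "W = incr \<phi>' D x"
  define f where "f n = incr (\<psi> n) D x" for n
  define g where "g = incr u D x"
  have intW: "integrable \<nu> W"
    using integrable_incr_C2[OF \<phi>', of x] by (simp add: W_def g\<phi>')
  have intf: "integrable \<nu> (f n)" for n
    using integrable_incr_C2[OF \<psi>[of n], of x] by (simp add: f_def g\<psi>)
  have gm: "g \<in> borel_measurable \<nu>"
    unfolding g_def by (rule incr_measurable[OF C_torusD(2)[OF u]])
  have Ff: "F x D \<le> integral\<^sup>L \<nu> (f n)" for n
  proof -
    have "F x (grad (\<psi> n) x) \<le> nonlocal_op \<nu> j (\<psi> n) x"
      using ul \<psi>x by (intro vsubD[OF sub \<psi>]) simp
    then show ?thesis by (simp add: nonlocal_op_eq g\<psi> f_def)
  qed
  have fW: "f n z \<le> W z" for n z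
    using lp[of n] \<psi>x[of n] eq by (simp add: f_def W_def incr_def)
  have fg: "(\<lambda>n. f n z) \<longlonglongrightarrow> g z" for z
    unfolding f_def g_def incr_def by (intro tendsto_intros \<psi>u)
  have gW: "g z \<le> W z" for z
    by (rule LIMSEQ_le_const2[OF fg]) (use fW in auto)
  \<comment> \<open>A common bound for the integrals of the nonnegative differences
    \<open>W - f n\<close>, because the subsolution property bounds the integral of each
    \<open>f n\<close> from below.\<close>
  define K where "K = integral\<^sup>L \<nu> W - F x D"
  \<comment> \<open>Fatou's lemma, applied in \<open>ennreal\<close> because integrability of
    \<open>g\<close> is not yet known; it comes out as a consequence.\<close>
  have "(\<integral>\<^sup>+z. ennreal (W z - g z) \<partial>\<nu>) = (\<integral>\<^sup>+z. liminf (\<lambda>n. ennreal (W z - f n z)) \<partial>\<nu>)"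
  proof (rule nn_integral_cong)
    fix z
    have "(\<lambda>n. ennreal (W z - f n z)) \<longlonglongrightarrow> ennreal (W z - g z)"
      by (intro tendsto_ennrealI tendsto_intros fg)
    then show "ennreal (W z - g z) = liminf (\<lambda>n. ennreal (W z - f n z))"
      by (simp add: lim_imp_Liminf)
  qed
  also have "\<dots> \<le> liminf (\<lambda>n. \<integral>\<^sup>+z. ennreal (W z - f n z) \<partial>\<nu>)"
    using intW intf by (intro nn_integral_liminf) auto
  also have "\<dots> \<le> ennreal K"
  proof (rule Liminf_le)
    have "(\<integral>\<^sup>+z. ennreal (W z - f n z) \<partial>\<nu>) \<le> ennreal K" for n
    proof -
      have "(\<integral>\<^sup>+z. ennreal (W z - f n z) \<partial>\<nu>) = ennreal (\<integral>z. W z - f n z \<partial>\<nu>)"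
        using intW intf fW by (intro nn_integral_eq_integral) auto
      also have "\<dots> \<le> ennreal K"
        using Ff[of n] intW intf by (intro ennreal_leI) (simp add: K_def)
      finally show ?thesis .
    qed
    then show "\<forall>\<^sub>F n in sequentially. (\<integral>\<^sup>+z. ennreal (W z - f n z) \<partial>\<nu>) \<le> ennreal K"
      by simp
  qed simp
  finally have nn: "(\<integral>\<^sup>+z. ennreal (W z - g z) \<partial>\<nu>) \<le> ennreal K" .
  have intWg: "integrable \<nu> (\<lambda>z. W z - g z)"
    using nn gW intW gm by (intro integrableI_nonneg) (auto intro: le_less_trans)
  then have "integrable \<nu> (\<lambda>z. W z - (W z - g z))"
    by (rule Bochner_Integration.integrable_diff[OF intW])
  then have intg: "integrable \<nu> g" by simp
  have "0 \<le> (\<integral>z. W z - f 0 z \<partial>\<nu>)"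
    using fW by (intro Bochner_Integration.integral_nonneg) auto
  then have K0: "K \<ge> 0"
    using Ff[of 0] intW intf by (simp add: K_def)
  have "ennreal (\<integral>z. W z - g z \<partial>\<nu>) \<le> ennreal K"
    using nn nn_integral_eq_integral[OF intWg] gW by simp
  then have "(\<integral>z. W z - g z \<partial>\<nu>) \<le> K"
    using K0 by simp
  then have "F x D \<le> integral\<^sup>L \<nu> g"
    using intW intg by (simp add: K_def)
  then show "integrable \<nu> (incr u (grad \<phi> x) x)" "F x (grad \<phi> x) \<le> (\<integral>z. incr u (grad \<phi> x) x z \<partial>\<nu>)"
    using intg by (simp_all add: g_def D_def)
qed

end

section \<open>Doubling of variables\<close>

text \<open>The second point is written as \<open>a + h\<close> because the penalty sees only the
  displacement, which can be taken in the centred cube, where \<open>sper\<close> controls the norm.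
  Periodicity makes the maximum over the compact product global.\<close>

lemma doubling_max:
  fixes u v :: "real^'d \<Rightarrow> real"
  assumes u: "u \<in> C_torus" and v: "v \<in> C_torus"
  shows "\<exists>a h. a \<in> cube x \<and> h \<in> cube 0 \<and> (\<forall>a' b'. u a' + v b' - c * sper (a' - b') \<le> u a + v (a + h) - c * sper h)"
proof -
  let ?f = "\<lambda>p. u (fst p) + v (fst p + snd p) - c * sper (snd p)"
  have c: "compact (cube x \<times> cube (0::real^'d))"
    by (intro compact_Times compact_cube)
  have cv: "continuous_on UNIV u" "continuous_on UNIV v" "continuous_on UNIV sper"
    by (rule C_torusD(2)[OF u] C_torusD(2)[OF v] C2_torus_gradD(5)[OF sper_C2_torus])+
  have "continuous_on (cube x \<times> cube (0::real^'d)) (\<lambda>p. u (fst p))"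
    by (rule continuous_on_compose2[OF cv(1)]) (auto intro!: continuous_intros)
  moreover have "continuous_on (cube x \<times> cube (0::real^'d)) (\<lambda>p. v (fst p + snd p))"
    by (rule continuous_on_compose2[OF cv(2)]) (auto intro!: continuous_intros)
  moreover have "continuous_on (cube x \<times> cube (0::real^'d)) (\<lambda>p. sper (snd p))"
    by (rule continuous_on_compose2[OF cv(3)]) (auto intro!: continuous_intros)
  ultimately have cont: "continuous_on (cube x \<times> cube (0::real^'d)) ?f"
    by (intro continuous_on_diff continuous_on_add continuous_on_mult_left)
  have ne: "cube x \<times> cube (0::real^'d) \<noteq> {}"
  proof
    assume "cube x \<times> cube (0::real^'d) = {}"
    moreover have "(x, 0) \<in> cube x \<times> cube (0::real^'d)" by simp
    ultimately show False by (simp only: empty_iff)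
  qed
  from continuous_attains_sup[OF c ne cont] obtain p where
    p: "p \<in> cube x \<times> cube (0::real^'d)" "\<forall>q\<in>cube x \<times> cube (0::real^'d). ?f q \<le> ?f p" by (rule bexE)
  obtain a h where ah: "p = (a, h)" by (cases p)
  have "u a' + v b' - c * sper (a' - b') \<le> u a + v (a + h) - c * sper h" for a' b'
  proof -
    obtain a1 where a1: "a1 \<in> cube x" "lattice_equiv a' a1"
      using lattice_equiv_cube_ex by blast
    obtain h1 where h1: "h1 \<in> cube 0" "lattice_equiv (b' - a1) h1"
      using lattice_equiv_cube_ex by blast
    have b: "lattice_equiv b' (a1 + h1)"
      using lattice_equiv_add_right[OF h1(2), of a1] by (simp add: add.commute)
    have "lattice_equiv (a' - b') (- h1)"
      using lattice_equiv_diff[OF a1(2) b] by simp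
    then have "sper (a' - b') = sper h1"
      using periodicD[OF periodic_sper] by (metis sper_minus(1))
    moreover have "u a' = u a1" "v b' = v (a1 + h1)"
      using periodicD[OF C_torusD(1)[OF u] a1(2)] periodicD[OF C_torusD(1)[OF v] b] by auto
    moreover have "?f (a1, h1) \<le> ?f (a, h)"
      using p(2)[rule_format, of "(a1, h1)"] a1(1) h1(1) unfolding ah by simp
    ultimately show ?thesis by simp
  qed
  then show ?thesis using p(1) unfolding ah by (intro exI[of _ a] exI[of _ h]) auto
qed

lemma squeeze_null:
  fixes f g :: "nat \<Rightarrow> real"
  assumes "\<And>n. 0 \<le> f n" "\<And>n. f n \<le> g n" "g \<longlonglongrightarrow> 0"
  shows "f \<longlonglongrightarrow> 0"
  using assms by (intro tendsto_sandwich[of "\<lambda>n. 0" f _ g]) (auto intro!: always_eventually)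

text \<open>Boundedness of \<open>u\<close> and \<open>v\<close> first forces \<open>h n\<close> to
  zero. Maximality of \<open>u + v\<close> at \<open>x\<close> then bounds the penalty by
  \<open>v (a n + h n) - v (a n)\<close>, which vanishes by uniform continuity; this improves a
  bounded penalty to a vanishing one.\<close>

lemma doubling_tendsto:
  assumes u: "u \<in> C_torus" and v: "v \<in> C_torus"
    and max: "\<And>y. u y + v y \<le> u x + v x"
    and strict: "\<And>y. u y + v y = u x + v x \<Longrightarrow> lattice_equiv y x"
    and a: "\<And>n. a n \<in> cube x" and h: "\<And>n. h n \<in> cube 0"
    and dbl: "\<And>n. u x + v x \<le> u (a n) + v (a n + h n) - real (Suc n) * sper (h n)"
  shows "h \<longlonglongrightarrow> 0" "a \<longlonglongrightarrow> x" "(\<lambda>n. real (Suc n) * (norm (h n))\<^sup>2) \<longlonglongrightarrow> 0"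
proof -
  obtain B1 where B1: "\<And>y. \<bar>u y\<bar> \<le> B1" using C_torus_bounded[OF u] by metis
  obtain B2 where B2: "\<And>y. \<bar>v y\<bar> \<le> B2" using C_torus_bounded[OF v] by metis
  have sq: "(norm (h n))\<^sup>2 \<le> 2 * sper (h n)" for n
    using sper_ge[OF h[of n]] by simp
  have b1: "(norm (h n))\<^sup>2 \<le> (4 * (B1 + B2)) * (1 / real (Suc n))" for n
  proof -
    have "real (Suc n) * sper (h n) \<le> 2 * (B1 + B2)"
      using dbl[of n] B1[of x] B1[of "a n"] B2[of x] B2[of "a n + h n"] unfolding abs_le_iff by argo
    then have "real (Suc n) * (2 * sper (h n)) \<le> 4 * (B1 + B2)" by simp
    moreover have "real (Suc n) * (norm (h n))\<^sup>2 \<le> real (Suc n) * (2 * sper (h n))"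
      using sq by (intro mult_left_mono) auto
    ultimately have "real (Suc n) * (norm (h n))\<^sup>2 \<le> 4 * (B1 + B2)" by linarith
    then show ?thesis by (simp add: field_simps)
  qed
  have b2: "(\<lambda>n. (4 * (B1 + B2)) * (1 / real (Suc n))) \<longlonglongrightarrow> 0"
    by (rule tendsto_mult_right_zero[OF LIMSEQ_Suc[OF lim_1_over_n]])
  have "(\<lambda>n. (norm (h n))\<^sup>2) \<longlonglongrightarrow> 0"
    by (rule squeeze_null[OF _ b1 b2]) simp
  then have "(\<lambda>n. sqrt ((norm (h n))\<^sup>2)) \<longlonglongrightarrow> sqrt 0"
    by (rule tendsto_real_sqrt)
  then show h0: "h \<longlonglongrightarrow> 0"
    by (simp add: tendsto_norm_zero_iff)
  define \<delta> where "\<delta> n = v (a n + h n) - v (a n)" for n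
  have \<delta>0: "\<delta> \<longlonglongrightarrow> 0"
  proof (rule tendstoI)
    fix e :: real assume "e > 0"
    from C_torus_uniformly_continuous[OF v, unfolded uniformly_continuous_on_def, rule_format, OF this]
    obtain d where d: "d > 0" "\<And>y z. dist y z < d \<Longrightarrow> dist (v y) (v z) < e"
      by auto
    have "\<forall>\<^sub>F n in sequentially. dist (h n) 0 < d"
      using h0 d(1) tendstoD by blast
    then show "\<forall>\<^sub>F n in sequentially. dist (\<delta> n) 0 < e"
    proof eventually_elim
      case (elim n)
      then have "dist (a n + h n) (a n) < d" by (simp add: dist_norm)
      from d(2)[OF this] show ?case by (simp add: \<delta>_def dist_norm)
    qed
  qed
  have s\<delta>: "real (Suc n) * sper (h n) \<le> \<delta> n" for n
    using dbl[of n] max[of "a n"] by (simp add: \<delta>_def)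
  have b3: "real (Suc n) * (norm (h n))\<^sup>2 \<le> 2 * \<delta> n" for n
  proof -
    have "real (Suc n) * (norm (h n))\<^sup>2 \<le> real (Suc n) * (2 * sper (h n))"
      using sq by (intro mult_left_mono) auto
    also have "\<dots> = 2 * (real (Suc n) * sper (h n))"
      by simp
    also have "\<dots> \<le> 2 * \<delta> n"
      using s\<delta>[of n] by (rule mult_left_mono) simp
    finally show ?thesis .
  qed
  show "(\<lambda>n. real (Suc n) * (norm (h n))\<^sup>2) \<longlonglongrightarrow> 0"
    by (rule squeeze_null[OF _ b3 tendsto_mult_right_zero[OF \<delta>0]]) simp
  have b4: "(u x + v x) - (u (a n) + v (a n)) \<le> \<delta> n" for n
  proof -
    have "0 \<le> real (Suc n) * sper (h n)"
      using sper_nonneg[of "h n"] by (intro mult_nonneg_nonneg) auto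
    then show ?thesis using dbl[of n] by (simp add: \<delta>_def)
  qed
  have "(\<lambda>n. (u x + v x) - (u (a n) + v (a n))) \<longlonglongrightarrow> 0"
    by (rule squeeze_null[OF _ b4 \<delta>0]) (use max in simp)
  from tendsto_diff[OF tendsto_const this, of "u x + v x"]
  have "(\<lambda>n. u (a n) + v (a n)) \<longlonglongrightarrow> u x + v x"
    by simp
  then show "a \<longlonglongrightarrow> x"
  proof (rule strict_max_tendsto[where C = "cube x" and f = "\<lambda>y. u y + v y", rotated -1])
    show "continuous_on (cube x) (\<lambda>y. u y + v y)"
      by (intro continuous_intros C_torusD(2) u v)
    show "u y + v y < u x + v x" if "y \<in> cube x" "y \<noteq> x" for y
      using max[of y] strict[of y] cube_lattice_equiv_eq[of y x] that by fastforce
  qed (use a compact_cube in auto)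
qed

context levy_jump
begin

text \<open>
  The penalisation \<open>n s(x - y)\<close> contributes to the small jumps at most
  \<open>n |x - y|\<^sup>2\<close> times a constant, which vanishes in the limit; no error arises for the large jumps,
  where the measure is finite.
\<close>

lemma doubling_strict:
  assumes u1: "u1 \<in> C_torus" "vsub \<nu> j F1 u1" and u2: "u2 \<in> C_torus" "vsub \<nu> j F2 u2"
    and \<phi>: "\<phi> \<in> C2_torus"
    and max: "\<And>y. u1 y + u2 y - \<phi> y \<le> u1 x + u2 x - \<phi> x"
    and strict: "\<And>y. u1 y + u2 y - \<phi> y = u1 x + u2 x - \<phi> x \<Longrightarrow> lattice_equiv y x"
    and e: "e > 0"
  shows "\<exists>X Y p q. dist X x < e \<and> dist Y x < e \<and> norm (p + q - grad \<phi> x) < e \<and>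
    F1 X p + F2 Y q \<le> nonlocal_op \<nu> j \<phi> x + e"
proof -
  \<comment> \<open>The test function is absorbed into the first summand, so that doubling acts on
    \<open>v\<close> and \<open>u2\<close> alone.\<close>
  define v where "v y = u1 y - \<phi> y" for y
  have v: "v \<in> C_torus"
    unfolding v_def by (intro C_torus_diff u1 C2_torus_imp_C_torus \<phi>)
  define c where "c n = real (Suc n)" for n
  have c0: "c n > 0" for n by (simp add: c_def)
  have "\<exists>p. fst p \<in> cube x \<and> snd p \<in> cube 0 \<and>
      (\<forall>a' b'. v a' + u2 b' - c n * sper (a' - b') \<le> v (fst p) + u2 (fst p + snd p) - c n * sper (snd p))" for n
    using doubling_max[OF v u2(1), of x "c n"] by auto
  from choice[OF allI[OF this]] obtain P where P: "\<forall>n. fst (P n) \<in> cube x \<and> snd (P n) \<in> cube 0 \<and>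
      (\<forall>a' b'. v a' + u2 b' - c n * sper (a' - b') \<le> v (fst (P n)) + u2 (fst (P n) + snd (P n)) - c n * sper (snd (P n)))" ..
  define a where "a n = fst (P n)" for n
  define h where "h n = snd (P n)" for n
  define b where "b n = a n + h n" for n
  have acube: "a n \<in> cube x" and hcube: "h n \<in> cube 0"
    and top: "v a' + u2 b' - c n * sper (a' - b') \<le> v (a n) + u2 (b n) - c n * sper (h n)" for n a' b'
    using P by (auto simp: a_def h_def b_def)
  have lims: "h \<longlonglongrightarrow> 0" "a \<longlonglongrightarrow> x" "(\<lambda>n. c n * (norm (h n))\<^sup>2) \<longlonglongrightarrow> 0"
  proof -
    have m: "v y + u2 y \<le> v x + u2 x" for y using max[of y] by (simp add: v_def)
    have s: "lattice_equiv y x" if "v y + u2 y = v x + u2 x" for y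
      using strict[of y] that by (simp add: v_def algebra_simps)
    have d: "v x + u2 x \<le> v (a n) + u2 (a n + h n) - real (Suc n) * sper (h n)" for n
      using top[of x x n] by (simp add: b_def c_def)
    show "h \<longlonglongrightarrow> 0" "a \<longlonglongrightarrow> x" "(\<lambda>n. c n * (norm (h n))\<^sup>2) \<longlonglongrightarrow> 0"
      unfolding c_def by (rule doubling_tendsto[OF v u2(1) m _ acube hcube d], erule s)+
  qed
  have b_lim: "b \<longlonglongrightarrow> x"
    using tendsto_add[OF lims(2,1)] by (simp add: b_def[abs_def])
  \<comment> \<open>The penalty contributes opposite gradients at the two points, so
    \<open>p n + q n\<close> is the gradient of \<open>\<phi>\<close> at \<open>a n\<close>.\<close>
  define p where "p n = grad \<phi> (a n) - c n *\<^sub>R dsper (h n)" for n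
  define q where "q n = c n *\<^sub>R dsper (h n)" for n
  have ah: "a n - b n = - h n" "b n - a n = h n" for n by (simp_all add: b_def)
  have A1: "integrable \<nu> (incr u1 (p n) (a n))" "F1 (a n) (p n) \<le> (\<integral>z. incr u1 (p n) (a n) z \<partial>\<nu>)" for n
  proof -
    let ?\<phi> = "\<lambda>y. \<phi> y + c n * sper (y - b n)"
    note S = C2_torus_cmult[OF sper_shift(1)[of "b n"], of "c n"]
    have C: "?\<phi> \<in> C2_torus" by (rule C2_torus_add(1)[OF \<phi> S(1)])
    have "grad ?\<phi> (a n) = p n"
      unfolding C2_torus_add(2)[OF \<phi> S(1)] S(2) sper_shift(2) p_def ah by simp
    moreover have "u1 y - ?\<phi> y \<le> u1 (a n) - ?\<phi> (a n)" for y
      using top[of y "b n" n] by (simp add: v_def ah)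
    ultimately show "integrable \<nu> (incr u1 (p n) (a n))" "F1 (a n) (p n) \<le> (\<integral>z. incr u1 (p n) (a n) z \<partial>\<nu>)"
      using vsub_incr[OF u1(2,1) C, of "a n"] by auto
  qed
  have A2: "integrable \<nu> (incr u2 (q n) (b n))" "F2 (b n) (q n) \<le> (\<integral>z. incr u2 (q n) (b n) z \<partial>\<nu>)" for n
  proof -
    let ?\<phi> = "\<lambda>y. c n * sper (y - a n)"
    note S = C2_torus_cmult[OF sper_shift(1)[of "a n"], of "c n"]
    have "grad ?\<phi> (b n) = q n"
      unfolding S(2) sper_shift(2) q_def ah by simp
    moreover have "u2 y - ?\<phi> y \<le> u2 (b n) - ?\<phi> (b n)" for y
      using top[of "a n" y n] sper_minus(1)[of "y - a n"] by (simp add: ah)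
    ultimately show "integrable \<nu> (incr u2 (q n) (b n))" "F2 (b n) (q n) \<le> (\<integral>z. incr u2 (q n) (b n) z \<partial>\<nu>)"
      using vsub_incr[OF u2(2,1) S(1), of "b n"] by auto
  qed
  obtain C where C: "C > 0" "\<And>x y z. norm (j x z - j y z) \<le> C * norm (x - y) * norm z"
    using j_bound by metis
  obtain M where M: "M > 0" "\<And>y k :: real^'d. \<bar>sper (y + k) - sper y - k \<bullet> dsper y\<bar> \<le> M * (norm k)\<^sup>2"
    using C2_torus_Taylor[OF sper_C2_torus] unfolding grad_sper by blast
  define T where "T y z = u1 (y + j y z) - u1 y" for y z
  \<comment> \<open>A majorant for the sum of the two increments. For small jumps it carries the
    increment of \<open>\<phi>\<close> and the second order remainder of the penalty; for large
    jumps the slopes drop out and the plain increments are kept.\<close>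
  define R where "R n z = (if z \<in> ball 0 1 then incr \<phi> (grad \<phi> (a n)) (a n) z + c n * (M * (C * norm (h n) * norm z)\<^sup>2)
    else (u1 (a n + j (a n) z) - u1 (a n)) + (u2 (b n + j (b n) z) - u2 (b n)))" for n z
  define R0 where "R0 z = (if z \<in> ball 0 1 then incr \<phi> (grad \<phi> x) x z
    else (u1 (x + j x z) - u1 x) + (u2 (x + j x z) - u2 x))" for z
  have GR: "incr u1 (p n) (a n) z + incr u2 (q n) (b n) z \<le> R n z" for n z
  proof (cases "z \<in> ball 0 1")
    case False
    then show ?thesis by (simp add: R_def incr_def)
  next
    case True
    let ?j1 = "j (a n) z" and ?j2 = "j (b n) z"
    \<comment> \<open>The maximum is compared with the pair in which both points jump with the same
      \<open>z\<close>. By the Lipschitz bound on \<open>j\<close> the displacement changes by at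
      most \<open>C * norm (h n) * norm z\<close>, and the first order terms cancel against the
      slopes.\<close>
    have "v (a n + ?j1) + u2 (b n + ?j2) - c n * sper ((a n + ?j1) - (b n + ?j2)) \<le> v (a n) + u2 (b n) - c n * sper (h n)"
      by (rule top)
    moreover have e: "(a n + ?j1) - (b n + ?j2) = - h n + (?j1 - ?j2)"
      using ah[of n] by (simp add: algebra_simps)
    moreover have "c n * sper (- h n + (?j1 - ?j2)) \<le> c n * (sper (h n) - (?j1 - ?j2) \<bullet> dsper (h n) + M * (C * norm (h n) * norm z)\<^sup>2)"
    proof -
      have "norm (?j1 - ?j2) \<le> C * norm (h n) * norm z"
        using C(2)[of "a n" z "b n"] ah[of n] by simp
      then have "M * (norm (?j1 - ?j2))\<^sup>2 \<le> M * (C * norm (h n) * norm z)\<^sup>2"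
        using M(1) by (intro mult_left_mono power_mono) auto
      then show ?thesis
        using M(2)[of "- h n" "?j1 - ?j2"] c0[of n] by (intro mult_left_mono) auto
    qed
    ultimately have "v (a n + ?j1) + u2 (b n + ?j2) \<le> v (a n) + u2 (b n) - c n * ((?j1 - ?j2) \<bullet> dsper (h n)) + c n * (M * (C * norm (h n) * norm z)\<^sup>2)"
      by (simp add: algebra_simps)
    then show ?thesis
      using True by (simp add: R_def incr_def v_def p_def q_def inner_diff_right inner_diff_left algebra_simps)
  qed
  obtain B1 where B1: "B1 > 0" "\<And>y. \<bar>u1 y\<bar> \<le> B1" using C_torus_bounded[OF u1(1)] by blast
  obtain B2 where B2: "B2 > 0" "\<And>y. \<bar>u2 y\<bar> \<le> B2" using C_torus_bounded[OF u2(1)] by blast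
  obtain B3 where B3: "B3 > 0" "\<And>x z. \<bar>incr \<phi> (grad \<phi> x) x z\<bar> \<le> B3 * levy_weight z"
    using incr_C2_bound[OF \<phi>] by blast
  obtain K where K: "\<And>n. c n * (norm (h n))\<^sup>2 \<le> K"
    using convergent_imp_Bseq[OF convergentI[OF lims(3)]] unfolding Bseq_def by (auto simp: abs_le_iff)
  have K0: "0 \<le> K" using K[of 0] c0[of 0] by (smt (verit) mult_nonneg_nonneg zero_le_power2)
  define W where "W = B3 + M * C\<^sup>2 * K + 2 * B1 + 2 * B2"
  have Rform: "c n * (M * (C * norm (h n) * norm z)\<^sup>2) = (c n * (norm (h n))\<^sup>2) * (M * C\<^sup>2 * (norm z)\<^sup>2)" for n z
    by (simp add: power_mult_distrib mult_ac)
  have w_out: "levy_weight z = 1" if "z \<notin> ball 0 1" for z :: "real^'d"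
    using that by (simp add: one_le_power)
  have w_in: "levy_weight z = (norm z)\<^sup>2" if "z \<in> ball 0 1" for z :: "real^'d"
    using that by (simp add: power_le_one less_imp_le)
  have nn: "0 \<le> M * C\<^sup>2" using M(1) by simp
  have w0: "0 \<le> levy_weight z" for z :: "real^'d" by simp
  have RW: "\<bar>R n z\<bar> \<le> W * levy_weight z" for n z
  proof (cases "z \<in> ball 0 1")
    case True
    have "(c n * (norm (h n))\<^sup>2) * (M * C\<^sup>2 * (norm z)\<^sup>2) \<le> K * (M * C\<^sup>2 * (norm z)\<^sup>2)"
      using K nn by (intro mult_right_mono) auto
    moreover have "0 \<le> (c n * (norm (h n))\<^sup>2) * (M * C\<^sup>2 * (norm z)\<^sup>2)"
      using c0[of n] nn by simp
    ultimately have "\<bar>R n z\<bar> \<le> B3 * (norm z)\<^sup>2 + K * (M * C\<^sup>2 * (norm z)\<^sup>2)"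
      using B3(2)[of "a n" z] w_in[OF True] True by (simp add: R_def Rform)
    also have "\<dots> = (B3 + M * C\<^sup>2 * K) * (norm z)\<^sup>2"
      by (simp add: algebra_simps)
    also have "\<dots> \<le> W * (norm z)\<^sup>2"
      using B1(1) B2(1) by (intro mult_right_mono) (auto simp: W_def)
    finally show ?thesis using w_in[OF True] by simp
  next
    case False
    have "\<bar>R n z\<bar> \<le> 2 * B1 + 2 * B2"
      using B1(2)[of "a n"] B1(2)[of "a n + j (a n) z"] B2(2)[of "b n"] B2(2)[of "b n + j (b n) z"] False
      unfolding R_def by (simp only: if_False)
    also have "\<dots> \<le> W"
      using B3(1) K0 nn by (simp add: W_def)
    finally show ?thesis using w_out[OF False] by simp
  qed
  have R0W: "\<bar>R0 z\<bar> \<le> W * levy_weight z" for z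
  proof (cases "z \<in> ball 0 1")
    case True
    have "\<bar>R0 z\<bar> \<le> B3 * levy_weight z"
      using B3(2)[of x z] True by (simp add: R0_def)
    also have "\<dots> \<le> W * levy_weight z"
      using B1(1) B2(1) K0 nn w0 by (intro mult_right_mono) (auto simp: W_def)
    finally show ?thesis .
  next
    case False
    have "\<bar>R0 z\<bar> \<le> 2 * B1 + 2 * B2"
      using B1(2)[of x] B1(2)[of "x + j x z"] B2(2)[of x] B2(2)[of "x + j x z"] False
      unfolding R0_def by (simp only: if_False)
    also have "\<dots> \<le> W"
      using B3(1) K0 nn by (simp add: W_def)
    finally show ?thesis using w_out[OF False] by simp
  qed
  have cu: "continuous_on UNIV u1" "continuous_on UNIV u2"
    using C_torusD(2) u1(1) u2(1) by auto
  have zm: "(\<lambda>z. incr u 0 y z) \<in> borel_measurable \<nu>" if "continuous_on UNIV u" for u y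
    using incr_measurable[OF that] .
  have norm_m: "(\<lambda>z. norm z) \<in> borel_measurable \<nu>"
  proof -
    have "(\<lambda>z::real^'d. norm z) \<in> borel_measurable borel" by measurable
    then show ?thesis
      using measurable_cong_sets[OF sets_nu refl] by blast
  qed
  have bset: "ball 0 1 \<inter> space \<nu> \<in> sets \<nu>" by (simp add: sets_nu)
  have incr0: "u (y + j y z) - u y = incr u 0 y z" for u y z
    by (simp add: incr_def)
  have Rm: "R n \<in> borel_measurable \<nu>" for n
    unfolding R_def[abs_def] incr0
    using bset norm_m zm[OF cu(1)] zm[OF cu(2)] incr_measurable[OF C2_torus_gradD(5)[OF \<phi>]]
    by (intro measurable_If_set) auto
  have R0m: "R0 \<in> borel_measurable \<nu>"
    unfolding R0_def[abs_def] incr0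
    using bset zm[OF cu(1)] zm[OF cu(2)] incr_measurable[OF C2_torus_gradD(5)[OF \<phi>]]
    by (intro measurable_If_set) auto
  have Rlim: "(\<lambda>n. R n z) \<longlonglongrightarrow> R0 z" for z
  proof (cases "z \<in> ball 0 1")
    case True
    have "(\<lambda>n. incr \<phi> (grad \<phi> (a n)) (a n) z + (c n * (norm (h n))\<^sup>2) * (M * C\<^sup>2 * (norm z)\<^sup>2))
        \<longlonglongrightarrow> incr \<phi> (grad \<phi> x) x z + 0 * (M * C\<^sup>2 * (norm z)\<^sup>2)"
      by (intro tendsto_add tendsto_mult_right lims(3) incr_tendsto C2_torus_gradD(5)[OF \<phi>] lims(2)
          cont_tendsto[OF C2_torus_gradD(3)[OF \<phi>] lims(2)])
    then show ?thesis
      using True by (simp add: R_def R0_def Rform)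
  next
    case False
    have "(\<lambda>n. (u1 (a n + j (a n) z) - u1 (a n)) + (u2 (b n + j (b n) z) - u2 (b n)))
        \<longlonglongrightarrow> (u1 (x + j x z) - u1 x) + (u2 (x + j x z) - u2 x)"
      by (intro tendsto_add tendsto_diff cont_tendsto[OF cu(1)] cont_tendsto[OF cu(2)] j_tendsto lims(2) b_lim)
    then show ?thesis using False by (simp add: R_def R0_def)
  qed
  have "(\<lambda>n. integral\<^sup>L \<nu> (R n)) \<longlonglongrightarrow> integral\<^sup>L \<nu> R0"
  proof (rule integral_dominated_convergence[where w = "\<lambda>z. W * levy_weight z"])
    show "integrable \<nu> (\<lambda>z. W * levy_weight z)"
      by (rule integrable_mult_right[OF integrable_w])
  qed (use Rm R0m RW Rlim in auto)
  \<comment> \<open>For small jumps the integrands agree; for large jumps the inequality is the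
    maximality of \<open>u1 + u2 - \<phi>\<close> at \<open>x\<close>.\<close>
  moreover have "integral\<^sup>L \<nu> R0 \<le> nonlocal_op \<nu> j \<phi> x"
    unfolding nonlocal_op_eq
  proof (rule integral_mono[OF integrable_bound_w[OF R0m R0W] integrable_incr_C2[OF \<phi>]])
    fix z
    show "R0 z \<le> incr \<phi> (grad \<phi> x) x z"
      using max[of "x + j x z"] by (simp add: R0_def incr_def)
  qed
  ultimately have ev1: "\<forall>\<^sub>F n in sequentially. integral\<^sup>L \<nu> (R n) < nonlocal_op \<nu> j \<phi> x + e"
    using e by (intro order_tendstoD(2)) auto
  have "(\<lambda>n. p n + q n) \<longlonglongrightarrow> grad \<phi> x"
    using cont_tendsto[OF C2_torus_gradD(3)[OF \<phi>] lims(2)] by (simp add: p_def q_def)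
  then have "\<forall>\<^sub>F n in sequentially. dist (p n + q n) (grad \<phi> x) < e"
    using e tendstoD by blast
  moreover have "\<forall>\<^sub>F n in sequentially. dist (a n) x < e"
    using lims(2) e tendstoD by blast
  moreover have "\<forall>\<^sub>F n in sequentially. dist (b n) x < e"
    using b_lim e tendstoD by blast
  ultimately have "\<forall>\<^sub>F n in sequentially. dist (a n) x < e \<and> dist (b n) x < e \<and> norm (p n + q n - grad \<phi> x) < e \<and>
    F1 (a n) (p n) + F2 (b n) (q n) \<le> nonlocal_op \<nu> j \<phi> x + e"
    using ev1
  proof eventually_elim
    case (elim n)
    have "F1 (a n) (p n) + F2 (b n) (q n) \<le> (\<integral>z. incr u1 (p n) (a n) z \<partial>\<nu>) + (\<integral>z. incr u2 (q n) (b n) z \<partial>\<nu>)"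
      using A1(2)[of n] A2(2)[of n] by simp
    also have "\<dots> = (\<integral>z. incr u1 (p n) (a n) z + incr u2 (q n) (b n) z \<partial>\<nu>)"
      using A1(1) A2(1) by simp
    also have "\<dots> \<le> integral\<^sup>L \<nu> (R n)"
      using A1(1) A2(1) GR by (intro integral_mono integrable_bound_w[OF Rm RW]) auto
    finally show ?case using elim by (simp add: dist_norm)
  qed
  then obtain n where "dist (a n) x < e \<and> dist (b n) x < e \<and> norm (p n + q n - grad \<phi> x) < e \<and>
    F1 (a n) (p n) + F2 (b n) (q n) \<le> nonlocal_op \<nu> j \<phi> x + e"
    using eventually_happens'[OF sequentially_bot] by blast
  then show ?thesis by blast
qed

text \<open>A multiple of \<open>sper (y - x)\<close> is added to the test function: it has zero
  gradient at \<open>x\<close>, makes the maximum strict modulo the lattice, and its nonlocal term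
  is small with \<open>\<eta>\<close>.\<close>

lemma doubling:
  assumes u1: "u1 \<in> C_torus" "vsub \<nu> j F1 u1" and u2: "u2 \<in> C_torus" "vsub \<nu> j F2 u2"
    and \<phi>: "\<phi> \<in> C2_torus"
    and max: "\<And>y. u1 y + u2 y - \<phi> y \<le> u1 x + u2 x - \<phi> x"
    and e: "e > 0"
  shows "\<exists>X Y p q. dist X x < e \<and> dist Y x < e \<and> norm (p + q - grad \<phi> x) < e \<and>
    F1 X p + F2 Y q \<le> nonlocal_op \<nu> j \<phi> x + e"
proof -
  let ?s = "\<lambda>y. sper (y - x)"
  \<comment> \<open>The added 1 keeps \<open>N\<close> positive; \<open>\<eta> * N = e / 2\<close>
    then accounts for half of the error.\<close>
  define N where "N = \<bar>nonlocal_op \<nu> j ?s x\<bar> + 1"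
  have N: "N > 0" by (simp add: N_def add_nonneg_pos)
  define \<eta> where "\<eta> = e / (2 * N)"
  have \<eta>: "\<eta> > 0" using e N by (simp add: \<eta>_def)
  have small: "\<eta> * nonlocal_op \<nu> j ?s x \<le> e / 2"
  proof -
    have "\<eta> * nonlocal_op \<nu> j ?s x \<le> \<eta> * N"
      using \<eta> by (intro mult_left_mono) (auto simp: N_def)
    also have "\<dots> = e / 2" using N by (simp add: \<eta>_def)
    finally show ?thesis .
  qed
  define \<psi> where "\<psi> y = \<phi> y + \<eta> * ?s y" for y
  note S = C2_torus_cmult[OF sper_shift(1)[of x], of \<eta>]
  have \<psi>: "\<psi> \<in> C2_torus" "grad \<psi> x = grad \<phi> x" "nonlocal_op \<nu> j \<psi> x = nonlocal_op \<nu> j \<phi> x + \<eta> * nonlocal_op \<nu> j ?s x"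
    unfolding \<psi>_def C2_torus_add(2)[OF \<phi> S(1)] S(2) sper_shift(2) nonlocal_op_add[OF \<phi> S(1)] nonlocal_op_cmult[OF sper_shift(1)]
    using C2_torus_add(1)[OF \<phi> S(1)] by simp_all
  have m: "u1 y + u2 y - \<psi> y \<le> u1 x + u2 x - \<psi> x" for y
  proof -
    have "0 \<le> \<eta> * ?s y" using \<eta> sper_nonneg by (intro mult_nonneg_nonneg) auto
    then show ?thesis using max[of y] by (simp add: \<psi>_def)
  qed
  have s: "lattice_equiv y x" if eq: "u1 y + u2 y - \<psi> y = u1 x + u2 x - \<psi> x" for y
  proof (rule ccontr)
    assume "\<not> lattice_equiv y x"
    then have "\<eta> * ?s y > 0" by (intro mult_pos_pos sper_pos \<eta>)
    then show False using eq max[of y] by (simp add: \<psi>_def)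
  qed
  have "e / 2 > 0" using e by simp
  from doubling_strict[OF u1 u2 \<psi>(1) m s this] obtain X Y p q where
    "dist X x < e / 2" "dist Y x < e / 2" "norm (p + q - grad \<psi> x) < e / 2"
    "F1 X p + F2 Y q \<le> nonlocal_op \<nu> j \<psi> x + e / 2" by blast
  then have "dist X x < e \<and> dist Y x < e \<and> norm (p + q - grad \<phi> x) < e \<and>
    F1 X p + F2 Y q \<le> nonlocal_op \<nu> j \<phi> x + e"
    using small e unfolding \<psi>(2,3) by auto
  then show ?thesis by blast
qed

end

section \<open>Gradient bounds\<close>

text \<open>
  Averaging the increment \<open>u (y + h) - u y\<close> over a small ball and splitting it into \<open>n\<close> steps of
  length \<open>h / n\<close> reduces the Lipschitz bound to the bound on the difference quotients, which holds almost
  everywhere in the limit.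
\<close>

lemma gradient_bound_imp_increment_le:
  fixes u :: "real^'d \<Rightarrow> real"
  assumes "gradient_bound \<kappa> u"
  shows "u (x + h) - u x \<le> \<kappa> * norm h"
proof (rule ccontr)
  assume neg: "\<not> u (x + h) - u x \<le> \<kappa> * norm h"
  obtain C where Lip: "C-lipschitz_on UNIV u"
    and AE: "AE x in lborel. \<exists>D. (GDERIV u x :> D) \<and> norm D \<le> \<kappa>"
    using assms unfolding gradient_bound_def by blast
  have C0: "C \<ge> 0" by (rule lipschitz_on_nonneg[OF Lip])
  have uL: "\<bar>u a - u b\<bar> \<le> C * norm (a - b)" for a b
    using lipschitz_onD[OF Lip, of a b] by (simp add: dist_norm)
  have cu: "continuous_on UNIV u"
    by (rule lipschitz_on_continuous_on[OF Lip])
  \<comment> \<open>One point of differentiability suffices, and it exists because Lebesgue measure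
    is not null.\<close>
  have k0: "\<kappa> \<ge> 0"
  proof -
    have "\<exists>x::real^'d. \<exists>D. (GDERIV u x :> D) \<and> norm D \<le> \<kappa>"
    proof (rule ccontr)
      assume "\<not> ?thesis"
      then have "AE x in (lborel :: (real^'d) measure). False"
        using AE by auto
      then show False by (simp add: AE_iff_measurable[of UNIV])
    qed
    then show ?thesis using norm_ge_zero order_trans by blast
  qed
  \<comment> \<open>Half of the excess; the other half is spent on moving the base point within
    radius \<open>r\<close>.\<close>
  define \<eta> where "\<eta> = (u (x + h) - u x - \<kappa> * norm h) / 2"
  have \<eta>: "\<eta> > 0" using neg by (simp add: \<eta>_def)
  define r where "r = \<eta> / (2 * C + 1)"
  have r: "r > 0" using \<eta> C0 by (simp add: r_def)
  have near: "u (y + h) - u y \<ge> \<kappa> * norm h + \<eta>" if "y \<in> ball x r" for y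
  proof -
    have ny: "norm (y - x) \<le> r" using that by (simp add: dist_norm norm_minus_commute)
    have "\<bar>u (y + h) - u (x + h)\<bar> \<le> C * r" "\<bar>u y - u x\<bar> \<le> C * r"
      using uL[of "y + h" "x + h"] uL[of y x] mult_left_mono[OF ny C0] by auto
    moreover have "2 * (C * r) \<le> \<eta>"
      using C0 \<eta> by (simp add: r_def field_simps)
    ultimately have "u (y + h) - u y \<ge> u (x + h) - u x - \<eta>" by linarith
    then show ?thesis by (simp add: \<eta>_def field_simps)
  qed
  \<comment> \<open>Contains every segment from \<open>y\<close> to \<open>y + h\<close> with
    \<open>y\<close> in \<open>ball x r\<close>.\<close>
  define S where "S = ball x (r + norm h)"
  \<comment> \<open>The positive excess of the difference quotient over
    \<open>\<kappa> * norm h\<close>. It is bounded by \<open>C * norm h\<close> and vanishes in the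
    limit wherever the gradient exists with norm at most \<open>\<kappa>\<close>.\<close>
  define q where "q n y = max 0 (real (Suc n) * (u (y + (1 / real (Suc n)) *\<^sub>R h) - u y) - \<kappa> * norm h)" for n y
  have cq: "continuous_on UNIV (q n)" for n
    unfolding q_def by (intro continuous_intros continuous_on_compose2[OF cu]) auto
  have qm: "q n \<in> borel_measurable borel" for n
    by (rule borel_measurable_continuous_onI[OF cq])
  have qb: "q n y \<le> C * norm h" for n y
  proof -
    have "u (y + (1 / real (Suc n)) *\<^sub>R h) - u y \<le> C * (norm h / real (Suc n))"
      using uL[of "y + (1 / real (Suc n)) *\<^sub>R h" y] by (simp add: divide_inverse mult.commute)
    then have "real (Suc n) * (u (y + (1 / real (Suc n)) *\<^sub>R h) - u y) \<le> real (Suc n) * (C * (norm h / real (Suc n)))"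
      by (intro mult_left_mono) auto
    also have "\<dots> = C * norm h" by simp
    finally have "real (Suc n) * (u (y + (1 / real (Suc n)) *\<^sub>R h) - u y) \<le> C * norm h" .
    moreover have "0 \<le> C * norm h" "0 \<le> \<kappa> * norm h" using C0 k0 by auto
    ultimately show ?thesis unfolding q_def by linarith
  qed
  have q0: "0 \<le> q n y" for n y by (simp add: q_def)
  have qlim: "(\<lambda>n. q n y) \<longlonglongrightarrow> 0" if D: "GDERIV u y :> D" "norm D \<le> \<kappa>" for y D
  proof -
    have "((\<lambda>t. u (y + t *\<^sub>R h)) has_derivative (\<lambda>s. (s *\<^sub>R h) \<bullet> D)) (at 0)"
    proof (rule has_derivative_compose[where f = "\<lambda>t. y + t *\<^sub>R h"])
      show "((\<lambda>t. y + t *\<^sub>R h) has_derivative (\<lambda>s. s *\<^sub>R h)) (at (0::real))"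
        by (auto intro!: derivative_eq_intros)
      show "(u has_derivative (\<lambda>s. s \<bullet> D)) (at (y + 0 *\<^sub>R h))"
        using D(1) by (simp add: gderiv_def)
    qed
    then have "((\<lambda>t. u (y + t *\<^sub>R h)) has_real_derivative (h \<bullet> D)) (at 0)"
      unfolding has_field_derivative_def by (rule has_derivative_eq_rhs) (simp add: fun_eq_iff mult.commute)
    then have "((\<lambda>t. (u (y + t *\<^sub>R h) - u y) / t) \<longlongrightarrow> h \<bullet> D) (at 0)"
      unfolding DERIV_def by simp
    moreover have "filterlim (\<lambda>n. 1 / real (Suc n)) (at 0) sequentially"
      unfolding filterlim_at using LIMSEQ_Suc[OF lim_1_over_n] by auto
    ultimately have "(\<lambda>n. (u (y + (1 / real (Suc n)) *\<^sub>R h) - u y) / (1 / real (Suc n))) \<longlonglongrightarrow> h \<bullet> D"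
      by (rule filterlim_compose)
    then have "(\<lambda>n. real (Suc n) * (u (y + (1 / real (Suc n)) *\<^sub>R h) - u y)) \<longlonglongrightarrow> h \<bullet> D"
      by (simp add: mult.commute)
    then have lq: "(\<lambda>n. q n y) \<longlonglongrightarrow> max 0 (h \<bullet> D - \<kappa> * norm h)"
      unfolding q_def by (intro tendsto_intros)
    have "h \<bullet> D \<le> \<kappa> * norm h"
      using norm_cauchy_schwarz[of h D] mult_left_mono[OF D(2) norm_ge_zero[of h]] by (simp add: mult.commute)
    then have "max 0 (h \<bullet> D - \<kappa> * norm h) = 0" by simp
    with lq show ?thesis by metis
  qed
  have Sq: "(\<lambda>y. indicator S y * q n y) \<in> borel_measurable borel" for n
    using qm[of n] by (intro borel_measurable_times borel_measurable_indicator) (auto simp: S_def)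
  have fin: "emeasure lborel S < \<infinity>"
    unfolding S_def by (rule emeasure_lborel_ball_finite)
  have intS: "integrable lborel (\<lambda>y. indicator S y * (C * norm h) :: real)"
    using fin by (simp add: S_def)
  have lim: "(\<lambda>n. \<integral>y. indicator S y * q n y \<partial>lborel) \<longlonglongrightarrow> (\<integral>y. 0 \<partial>(lborel :: (real^'d) measure))"
  proof (rule integral_dominated_convergence[OF _ _ intS])
    show "AE y in lborel. (\<lambda>n. indicator S y * q n y) \<longlonglongrightarrow> 0"
      using AE
    proof eventually_elim
      case (elim y)
      then have "(\<lambda>n. indicator S y * q n y) \<longlonglongrightarrow> indicator S y * 0"
        by (intro tendsto_intros) (use qlim in blast)
      then show ?case by simp
    qed
    show "(\<lambda>y. indicator S y * q n y) \<in> borel_measurable lborel" for n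
      using Sq by simp
    show "AE y in lborel. norm (indicator S y * q n y) \<le> indicator S y * (C * norm h)" for n
      using qb[of n] q0[of n] by (auto simp: abs_mult intro!: mult_left_mono)
  qed simp
  define V where "V = measure lborel (ball x r)"
  have V: "V > 0"
    unfolding V_def by (rule content_ball_pos[OF r])
  \<comment> \<open>Telescoping over \<open>n + 1\<close> steps bounds \<open>\<eta>\<close> on the
    ball by the mean of translates of \<open>q n\<close>. Translation invariance makes the integrals
    of these translates equal, so the bound is independent of the number of steps.\<close>
  have key: "\<eta> * V \<le> (\<integral>y. indicator S y * q n y \<partial>lborel)" for n
  proof -
    define N where "N = Suc n"
    define a where "a k = (real k / real N) *\<^sub>R h" for k
    have tele: "(\<Sum>k<N. u (y + a (Suc k)) - u (y + a k)) = u (y + h) - u y" for y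
      by (subst sum_lessThan_telescope) (simp add: a_def N_def)
    have step: "y + a (Suc k) = (y + a k) + (1 / real (Suc n)) *\<^sub>R h" for y k
      by (simp add: a_def N_def algebra_simps add_divide_distrib flip: scaleR_add_left)
    have stepq: "u (y + a (Suc k)) - u (y + a k) \<le> (\<kappa> * norm h + q n (y + a k)) / real N" for y k
      unfolding step q_def N_def by (simp add: field_simps)
    have aS: "y + a k \<in> S" if "y \<in> ball x r" "k < N" for y k
    proof -
      have "norm (a k) \<le> norm h"
        using that(2) mult_right_mono[of "real k / real N" 1 "norm h"] by (simp add: a_def)
      then show ?thesis
        using that(1) norm_triangle_ineq[of "y - x" "a k"] unfolding S_def mem_ball dist_norm
        by (simp add: norm_minus_commute[of x] algebra_simps)
    qed
    have pw: "indicator (ball x r) y * \<eta> \<le> (\<Sum>k<N. indicator S (y + a k) * q n (y + a k)) / real N" for y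
    proof (cases "y \<in> ball x r")
      case True
      have "\<kappa> * norm h + \<eta> \<le> (\<Sum>k<N. u (y + a (Suc k)) - u (y + a k))"
        using near[OF True] tele by simp
      also have "\<dots> \<le> (\<Sum>k<N. (\<kappa> * norm h + q n (y + a k)) / real N)"
        by (intro sum_mono stepq)
      also have "\<dots> = \<kappa> * norm h + (\<Sum>k<N. q n (y + a k)) / real N"
        by (simp add: sum_divide_distrib[symmetric] sum.distrib N_def field_simps)
      also have "(\<Sum>k<N. q n (y + a k)) = (\<Sum>k<N. indicator S (y + a k) * q n (y + a k))"
        using aS[OF True] by (intro sum.cong) auto
      finally show ?thesis using True by simp
    next
      case False
      then show ?thesis using q0 by (simp add: sum_nonneg)
    qed
    have shift: "integrable lborel (\<lambda>y. indicator S (y + b) * q n (y + b))"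
      "(\<integral>y. indicator S (y + b) * q n (y + b) \<partial>lborel) = (\<integral>y. indicator S y * q n y \<partial>lborel)" for b
    proof -
      have i: "integrable lborel (\<lambda>y. indicator S y * q n y)"
        by (rule Bochner_Integration.integrable_bound[OF intS])
           (use Sq[of n] qb[of n] q0[of n] C0 in \<open>auto simp: abs_mult intro!: mult_left_mono\<close>)
      have "(\<lambda>y. y + b) = (+) b"
        by (rule ext) (rule add.commute)
      then have d: "distr lborel borel (\<lambda>y. y + b) = lborel"
        using lborel_distr_plus[of b] by simp
      show "integrable lborel (\<lambda>y. indicator S (y + b) * q n (y + b))"
        using i integrable_distr_eq[of "\<lambda>y. y + b" lborel borel "\<lambda>y. indicator S y * q n y"] Sq[of n]
        unfolding d by simp
      show "(\<integral>y. indicator S (y + b) * q n (y + b) \<partial>lborel) = (\<integral>y. indicator S y * q n y \<partial>lborel)"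
        using integral_distr[of "\<lambda>y. y + b" lborel borel "\<lambda>y. indicator S y * q n y"] Sq[of n]
        unfolding d by simp
    qed
    have "\<eta> * V = (\<integral>y. indicator (ball x r) y * \<eta> \<partial>lborel)"
      by (simp add: V_def mult.commute)
    also have "\<dots> \<le> (\<integral>y. (\<Sum>k<N. indicator S (y + a k) * q n (y + a k)) / real N \<partial>lborel)"
    proof (rule integral_mono)
      show "integrable lborel (\<lambda>y. indicator (ball x r) y * \<eta>)"
        using emeasure_lborel_ball_finite[of x r] by simp
      show "integrable lborel (\<lambda>y. (\<Sum>k<N. indicator S (y + a k) * q n (y + a k)) / real N)"
        by (intro integrable_divide Bochner_Integration.integrable_sum shift(1))
    qed (rule pw)
    also have "\<dots> = (\<integral>y. (\<Sum>k<N. indicator S (y + a k) * q n (y + a k)) \<partial>lborel) / real N"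
      by (rule integral_divide_zero)
    also have "(\<integral>y. (\<Sum>k<N. indicator S (y + a k) * q n (y + a k)) \<partial>lborel) =
        (\<Sum>k<N. \<integral>y. indicator S (y + a k) * q n (y + a k) \<partial>lborel)"
      by (rule Bochner_Integration.integral_sum) (rule shift(1))
    also have "(\<Sum>k<N. \<integral>y. indicator S (y + a k) * q n (y + a k) \<partial>lborel) / real N =
        (\<Sum>k<N. \<integral>y. indicator S y * q n y \<partial>lborel) / real N"
      by (simp only: shift(2))
    also have "\<dots> = (\<integral>y. indicator S y * q n y \<partial>lborel)"
      by (simp add: N_def)
    finally show ?thesis .
  qed
  have "\<eta> * V \<le> 0"
    using LIMSEQ_le_const[OF lim] key by auto
  then show False using \<eta> V by (simp add: mult_le_0_iff)
qed

lemma gradient_bound_imp_Lipschitz: "gradient_bound \<kappa> u \<Longrightarrow> \<bar>u x - u y\<bar> \<le> \<kappa> * norm (x - y)"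
  using gradient_bound_imp_increment_le[of \<kappa> u x "y - x"] gradient_bound_imp_increment_le[of \<kappa> u y "x - y"]
  by (simp add: norm_minus_commute abs_le_iff)

text \<open>Along \<open>- D\<close> the test function falls at rate \<open>(norm D)^2\<close>,
  whereas \<open>u\<close>, whose increments from \<open>x\<close> are at most those of
  \<open>\<phi>\<close>, falls at most at rate \<open>\<kappa> * norm D\<close>.\<close>

lemma touching_grad_bound:
  fixes u :: "real^'d \<Rightarrow> real"
  assumes D: "GDERIV \<phi> x :> D" and max: "\<And>y. u y - \<phi> y \<le> u x - \<phi> x"
    and Lip: "\<And>x y. \<bar>u x - u y\<bar> \<le> \<kappa> * norm (x - y)"
  shows "norm D \<le> \<kappa>"
proof (cases "D = 0")
  case True
  have "0 \<le> \<kappa> * norm (axis undefined 1 :: real^'d)"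
    using Lip[of "axis undefined 1" 0] by (smt (verit) diff_zero)
  then show ?thesis using True by (simp add: norm_axis_1)
next
  case False
  have "((\<lambda>t. \<phi> (x + t *\<^sub>R (- D))) has_derivative (\<lambda>s. (s *\<^sub>R (- D)) \<bullet> D)) (at 0)"
  proof (rule has_derivative_compose[where f = "\<lambda>t. x + t *\<^sub>R (- D)"])
    show "((\<lambda>t. x + t *\<^sub>R (- D)) has_derivative (\<lambda>s. s *\<^sub>R (- D))) (at (0::real))"
      by (auto intro!: derivative_eq_intros)
    show "(\<phi> has_derivative (\<lambda>s. s \<bullet> D)) (at (x + 0 *\<^sub>R (- D)))"
      using D by (simp add: gderiv_def)
  qed
  then have "((\<lambda>t. \<phi> (x + t *\<^sub>R (- D))) has_real_derivative (- (D \<bullet> D))) (at 0)"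
    unfolding has_field_derivative_def by (rule has_derivative_eq_rhs) (simp add: fun_eq_iff mult.commute)
  then have "((\<lambda>t. (\<phi> (x + t *\<^sub>R (- D)) - \<phi> x) / t) \<longlongrightarrow> - (D \<bullet> D)) (at 0)"
    unfolding DERIV_def by simp
  moreover have "filterlim (\<lambda>n. 1 / real (Suc n)) (at 0) sequentially"
    unfolding filterlim_at using LIMSEQ_Suc[OF lim_1_over_n] by auto
  ultimately have lim: "(\<lambda>n. (\<phi> (x + (1 / real (Suc n)) *\<^sub>R (- D)) - \<phi> x) / (1 / real (Suc n))) \<longlonglongrightarrow> - (D \<bullet> D)"
    by (rule filterlim_compose)
  have "- (\<kappa> * norm D) \<le> (\<phi> (x + (1 / real (Suc n)) *\<^sub>R (- D)) - \<phi> x) / (1 / real (Suc n))" for n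
  proof -
    let ?t = "1 / real (Suc n)"
    have t: "?t > 0" by simp
    have "\<bar>u (x + ?t *\<^sub>R (- D)) - u x\<bar> \<le> \<kappa> * (?t * norm D)"
      using Lip[of "x + ?t *\<^sub>R (- D)" x] by simp
    then have "- (\<kappa> * (?t * norm D)) \<le> \<phi> (x + ?t *\<^sub>R (- D)) - \<phi> x"
      using max[of "x + ?t *\<^sub>R (- D)"] by linarith
    then show ?thesis
      using t by (simp only: pos_le_divide_eq[OF t]) (simp add: mult_ac)
  qed
  then have "- (\<kappa> * norm D) \<le> - (D \<bullet> D)"
    by (intro LIMSEQ_le_const[OF lim] exI[of _ 0] allI impI)
  then have "norm D * norm D \<le> \<kappa> * norm D"
    by (simp add: dot_square_norm power2_eq_square)
  then show ?thesis using False by simp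
qed

section \<open>Hamiltonians of the form \<open>H_of Q \<phi>\<close>\<close>

lemma C_K_continuous:
  assumes "\<phi> \<in> C_K Q"
  shows "continuous_on (A \<times> Q) (\<lambda>p. \<phi> (fst p) (snd p))" "\<xi> \<in> Q \<Longrightarrow> continuous_on UNIV (\<lambda>x. \<phi> x \<xi>)"
    "continuous_on Q (\<phi> x)" "\<xi> \<in> Q \<Longrightarrow> lattice_equiv x y \<Longrightarrow> \<phi> x \<xi> = \<phi> y \<xi>"
proof -
  have c: "continuous_on (UNIV \<times> Q) (\<lambda>p. \<phi> (fst p) (snd p))"
    using assms by (simp add: C_K_def case_prod_unfold)
  show "continuous_on (A \<times> Q) (\<lambda>p. \<phi> (fst p) (snd p))"
    by (rule continuous_on_subset[OF c]) auto
  have "continuous_on UNIV (\<lambda>x. (x, \<xi>))" "continuous_on Q (\<lambda>\<xi>. (x, \<xi>))"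
    by (intro continuous_intros)+
  note c2 = continuous_on_compose2[OF c this(1)] continuous_on_compose2[OF c this(2)]
  show "continuous_on UNIV (\<lambda>x. \<phi> x \<xi>)" if "\<xi> \<in> Q"
    using c2(1) that by (auto simp: image_subset_iff)
  show "continuous_on Q (\<phi> x)"
    using c2(2) by (auto simp: image_subset_iff)
  show "\<xi> \<in> Q \<Longrightarrow> lattice_equiv x y \<Longrightarrow> \<phi> x \<xi> = \<phi> y \<xi>"
    using assms periodicD by (fastforce simp: C_K_def)
qed

lemma C_KI:
  assumes "continuous_on (UNIV \<times> Q) (\<lambda>p. \<phi> (fst p) (snd p))"
    "\<And>\<xi> x y. \<xi> \<in> Q \<Longrightarrow> lattice_equiv x y \<Longrightarrow> \<phi> x \<xi> = \<phi> y \<xi>"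
  shows "\<phi> \<in> C_K Q"
  using assms by (auto simp: C_K_def case_prod_unfold periodic_def)

lemma C_K_add:
  assumes "\<phi> \<in> C_K Q" "\<psi> \<in> C_K Q"
  shows "(\<lambda>x \<xi>. \<phi> x \<xi> + \<psi> x \<xi>) \<in> C_K Q"
proof (rule C_KI)
  show "continuous_on (UNIV \<times> Q) (\<lambda>p. \<phi> (fst p) (snd p) + \<psi> (fst p) (snd p))"
    by (intro continuous_on_add C_K_continuous(1) assms)
  show "\<phi> x \<xi> + \<psi> x \<xi> = \<phi> y \<xi> + \<psi> y \<xi>" if "\<xi> \<in> Q" "lattice_equiv x y" for \<xi> x y
    using C_K_continuous(4)[OF assms(1) that] C_K_continuous(4)[OF assms(2) that] by simp
qed

lemma C_K_cmult:
  assumes "\<phi> \<in> C_K Q"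
  shows "(\<lambda>x \<xi>. c * \<phi> x \<xi>) \<in> C_K Q"
proof (rule C_KI)
  show "continuous_on (UNIV \<times> Q) (\<lambda>p. c * \<phi> (fst p) (snd p))"
    by (intro continuous_on_mult_left C_K_continuous(1) assms)
  show "c * \<phi> x \<xi> = c * \<phi> y \<xi>" if "\<xi> \<in> Q" "lattice_equiv x y" for \<xi> x y
    using C_K_continuous(4)[OF assms(1) that] by simp
qed

lemma C_K_C_torus:
  assumes "u \<in> C_torus"
  shows "(\<lambda>x \<xi>. u x) \<in> C_K Q"
proof (rule C_KI)
  show "continuous_on (UNIV \<times> Q) (\<lambda>p. u (fst p))"
    by (rule continuous_on_compose2[OF C_torusD(2)[OF assms, of UNIV]]) (auto intro!: continuous_intros)
qed (use periodicD[OF C_torusD(1)[OF assms]] in blast)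

text \<open>The \<open>\<xi> n\<close> need not converge; uniform continuity on a compact
  neighbourhood of \<open>x\<close> times \<open>Q\<close> suffices. They will be maximisers for
  momenta that may be unbounded.\<close>

lemma C_K_uniform:
  assumes \<phi>: "\<phi> \<in> C_K Q" and Q: "compact Q" and X: "X \<longlonglongrightarrow> x" "Y \<longlonglongrightarrow> x" and \<xi>: "\<And>n. \<xi> n \<in> Q"
  shows "(\<lambda>n. \<phi> (X n) (\<xi> n) - \<phi> (Y n) (\<xi> n)) \<longlonglongrightarrow> 0"
proof (rule tendstoI)
  fix e :: real assume e: "e > 0"
  have uc: "uniformly_continuous_on (cball x 1 \<times> Q) (\<lambda>p. \<phi> (fst p) (snd p))"
    by (intro compact_uniformly_continuous C_K_continuous(1)[OF \<phi>] compact_Times compact_cball Q)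
  from uc[unfolded uniformly_continuous_on_def, rule_format, OF e]
  obtain d where d: "d > 0" "\<And>p q. p \<in> cball x 1 \<times> Q \<Longrightarrow> q \<in> cball x 1 \<times> Q \<Longrightarrow> dist q p < d \<Longrightarrow>
      dist (\<phi> (fst q) (snd q)) (\<phi> (fst p) (snd p)) < e"
    by auto
  have "\<forall>\<^sub>F n in sequentially. dist (X n) x < min 1 (d / 2)" "\<forall>\<^sub>F n in sequentially. dist (Y n) x < min 1 (d / 2)"
    by (rule tendstoD[OF X(1)] tendstoD[OF X(2)], use d(1) in simp)+
  then show "\<forall>\<^sub>F n in sequentially. dist (\<phi> (X n) (\<xi> n) - \<phi> (Y n) (\<xi> n)) 0 < e"
  proof eventually_elim
    case (elim n)
    have "dist (X n, \<xi> n) (Y n, \<xi> n) < d"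
      using elim dist_triangle2[of "X n" "Y n" x] by (simp add: dist_prod_def)
    moreover have "(X n, \<xi> n) \<in> cball x 1 \<times> Q" "(Y n, \<xi> n) \<in> cball x 1 \<times> Q"
      using elim \<xi>[of n] by (auto simp: dist_commute)
    ultimately have "dist (\<phi> (X n) (\<xi> n)) (\<phi> (Y n) (\<xi> n)) < e"
      using d(2)[of "(Y n, \<xi> n)" "(X n, \<xi> n)"] by simp
    then show ?case by (simp add: dist_norm)
  qed
qed

lemma H_of_max:
  assumes \<phi>: "\<phi> \<in> C_K Q" and Q: "compact Q" "Q \<noteq> {}"
  obtains \<xi> where "\<xi> \<in> Q" "H_of Q \<phi> x p = p \<bullet> \<xi> - \<phi> x \<xi>"
    and "\<And>\<xi>. \<xi> \<in> Q \<Longrightarrow> p \<bullet> \<xi> - \<phi> x \<xi> \<le> H_of Q \<phi> x p"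
proof -
  have "continuous_on Q (\<lambda>\<xi>. p \<bullet> \<xi> - \<phi> x \<xi>)"
    by (intro continuous_intros C_K_continuous(3)[OF \<phi>])
  from continuous_attains_sup[OF Q this] obtain \<xi> where
    \<xi>: "\<xi> \<in> Q" "\<forall>\<eta>\<in>Q. p \<bullet> \<eta> - \<phi> x \<eta> \<le> p \<bullet> \<xi> - \<phi> x \<xi>" by (rule bexE)
  then have "H_of Q \<phi> x p = p \<bullet> \<xi> - \<phi> x \<xi>"
    unfolding H_of_def by (intro cSup_eq_maximum) auto
  then show ?thesis using \<xi> that by simp
qed

lemma H_of_ge:
  assumes "\<phi> \<in> C_K Q" "compact Q" "\<xi> \<in> Q"
  shows "p \<bullet> \<xi> - \<phi> x \<xi> \<le> H_of Q \<phi> x p"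
  using H_of_max[OF assms(1,2), of x p] assms(3) by blast

lemma H_of_le:
  assumes "\<phi> \<in> C_K Q" "compact Q" "Q \<noteq> {}" "\<And>\<xi>. \<xi> \<in> Q \<Longrightarrow> p \<bullet> \<xi> - \<phi> x \<xi> \<le> c"
  shows "H_of Q \<phi> x p \<le> c"
proof -
  obtain \<xi> where "\<xi> \<in> Q" "H_of Q \<phi> x p = p \<bullet> \<xi> - \<phi> x \<xi>"
    using H_of_max[OF assms(1-3), of x p] by metis
  then show ?thesis using assms(4)[of \<xi>] by simp
qed

section \<open>Subsolutions\<close>

lemma vsub_shift:
  assumes "vsub \<nu> j F u" "\<And>x p. F' x p \<le> F x p"
  shows "vsub \<nu> j F' (\<lambda>x. u x + c)"
  unfolding vsub_def
proof (intro ballI allI impI)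
  fix \<phi> x assume "\<phi> \<in> C2_torus" "\<forall>y. u y + c - \<phi> y \<le> u x + c - \<phi> x"
  then have "F x (grad \<phi> x) \<le> nonlocal_op \<nu> j \<phi> x"
    using assms(1) unfolding vsub_def by (metis add_diff_cancel_right' add_le_cancel_right diff_add_eq)
  then show "F' x (grad \<phi> x) \<le> nonlocal_op \<nu> j \<phi> x"
    using assms(2)[of x "grad \<phi> x"] by linarith
qed

text \<open>A test function touching a \<open>\<kappa>\<close>-Lipschitz function has gradient of
  norm at most \<open>\<kappa>\<close>, so only the Hamiltonian on that ball matters. This is how
  \<open>H\<close> is traded for \<open>H_of Q L\<close>.\<close>

lemma vsub_Lipschitz:
  assumes "vsub \<nu> j F u" and Lip: "\<And>x y. \<bar>u x - u y\<bar> \<le> \<kappa> * norm (x - y)"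
    and F': "\<And>x p. norm p \<le> \<kappa> \<Longrightarrow> F' x p \<le> F x p"
  shows "vsub \<nu> j F' u"
  unfolding vsub_def
proof (intro ballI allI impI)
  fix \<phi> x assume \<phi>: "\<phi> \<in> C2_torus" and max: "\<forall>y. u y - \<phi> y \<le> u x - \<phi> x"
  have "norm (grad \<phi> x) \<le> \<kappa>"
    using max by (intro touching_grad_bound[OF C2_torus_gradD(6)[OF \<phi>] _ Lip]) auto
  moreover have "F x (grad \<phi> x) \<le> nonlocal_op \<nu> j \<phi> x"
    using assms(1) \<phi> max unfolding vsub_def by simp
  ultimately show "F' x (grad \<phi> x) \<le> nonlocal_op \<nu> j \<phi> x"
    using F'[of "grad \<phi> x" x] by linarith
qed

lemma visc_subsolution_iff:
  "visc_subsolution \<nu> j \<delta> G u \<longleftrightarrow> u \<in> C_torus \<and> vsub \<nu> j (\<lambda>x p. \<delta> * u x + G x p) u"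
proof -
  have "\<delta> * u x - nonlocal_op \<nu> j \<phi> x + G x (grad \<phi> x) \<le> 0 \<longleftrightarrow> \<delta> * u x + G x (grad \<phi> x) \<le> nonlocal_op \<nu> j \<phi> x" for x \<phi>
    by linarith
  then show ?thesis
    unfolding visc_subsolution_def vsub_def by simp
qed

context levy_jump
begin

text \<open>Negating the test function turns minima into maxima and reverses the gradient, whence
  the \<open>- p\<close>.\<close>

lemma visc_supersolution_iff:
  "visc_supersolution \<nu> j \<delta> G u \<longleftrightarrow>
    u \<in> C_torus \<and> vsub \<nu> j (\<lambda>x p. - (\<delta> * u x + G x (- p))) (\<lambda>x. - u x)"
proof -
  let ?A = "\<lambda>\<phi> x. (\<forall>y. u x - \<phi> x \<le> u y - \<phi> y) \<longrightarrow> \<delta> * u x - nonlocal_op \<nu> j \<phi> x + G x (grad \<phi> x) \<ge> 0"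
  let ?B = "\<lambda>\<phi> x. (\<forall>y. - u y - \<phi> y \<le> - u x - \<phi> x) \<longrightarrow> - (\<delta> * u x + G x (- grad \<phi> x)) \<le> nonlocal_op \<nu> j \<phi> x"
  have AB: "?B (\<lambda>y. - \<phi> y) x = ?A \<phi> x" if "\<phi> \<in> C2_torus" for \<phi> x
  proof -
    have "(\<forall>y. - u y - (- \<phi> y) \<le> - u x - (- \<phi> x)) = (\<forall>y. u x - \<phi> x \<le> u y - \<phi> y)"
      by (intro iff_allI) linarith
    then show ?thesis
      unfolding C2_torus_minus(2)[OF that] nonlocal_op_minus[OF that] minus_minus by auto
  qed
  have "(\<forall>\<phi>\<in>C2_torus. \<forall>x. ?A \<phi> x) = (\<forall>\<phi>\<in>C2_torus. \<forall>x. ?B \<phi> x)"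
  proof
    assume A: "\<forall>\<phi>\<in>C2_torus. \<forall>x. ?A \<phi> x"
    show "\<forall>\<phi>\<in>C2_torus. \<forall>x. ?B \<phi> x"
    proof (intro ballI allI)
      fix \<phi> :: "real^'d \<Rightarrow> real" and x assume \<phi>: "\<phi> \<in> C2_torus"
      have "?A (\<lambda>y. - \<phi> y) x"
        using bspec[OF A C2_torus_minus(1)[OF \<phi>]] by (rule spec)
      then have "?B (\<lambda>y. - (- \<phi> y)) x"
        unfolding AB[OF C2_torus_minus(1)[OF \<phi>]] .
      then show "?B \<phi> x" by (simp only: minus_minus)
    qed
  next
    assume B: "\<forall>\<phi>\<in>C2_torus. \<forall>x. ?B \<phi> x"
    show "\<forall>\<phi>\<in>C2_torus. \<forall>x. ?A \<phi> x"
    proof (intro ballI allI)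
      fix \<phi> :: "real^'d \<Rightarrow> real" and x assume \<phi>: "\<phi> \<in> C2_torus"
      have "?B (\<lambda>y. - \<phi> y) x"
        using bspec[OF B C2_torus_minus(1)[OF \<phi>]] by (rule spec)
      then show "?A \<phi> x" unfolding AB[OF \<phi>] .
    qed
  qed
  then show ?thesis
    unfolding visc_supersolution_def vsub_def by simp
qed

text \<open>Only the sum of the momenta is controlled; separately \<open>p n\<close> and
  \<open>q n\<close> may diverge.\<close>

lemma doubling_seq:
  assumes u1: "u1 \<in> C_torus" "vsub \<nu> j F1 u1" and u2: "u2 \<in> C_torus" "vsub \<nu> j F2 u2"
    and \<phi>: "\<phi> \<in> C2_torus"
    and max: "\<And>y. u1 y + u2 y - \<phi> y \<le> u1 x + u2 x - \<phi> x"
  obtains X Y p q where "X \<longlonglongrightarrow> x" "Y \<longlonglongrightarrow> x" "(\<lambda>n. p n + q n) \<longlonglongrightarrow> grad \<phi> x"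
    "\<And>n. F1 (X n) (p n) + F2 (Y n) (q n) \<le> nonlocal_op \<nu> j \<phi> x + 1 / real (Suc n)"
proof -
  have "\<exists>r. dist (fst r) x < 1 / real (Suc n) \<and> dist (fst (snd r)) x < 1 / real (Suc n) \<and>
      norm (fst (snd (snd r)) + snd (snd (snd r)) - grad \<phi> x) < 1 / real (Suc n) \<and>
      F1 (fst r) (fst (snd (snd r))) + F2 (fst (snd r)) (snd (snd (snd r))) \<le> nonlocal_op \<nu> j \<phi> x + 1 / real (Suc n)" for n
  proof -
    have "1 / real (Suc n) > 0" by simp
    from doubling[OF u1 u2 \<phi> max this] obtain X Y p q where
      "dist X x < 1 / real (Suc n) \<and> dist Y x < 1 / real (Suc n) \<and> norm (p + q - grad \<phi> x) < 1 / real (Suc n) \<and>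
        F1 X p + F2 Y q \<le> nonlocal_op \<nu> j \<phi> x + 1 / real (Suc n)" by (elim exE)
    then show ?thesis by (intro exI[of _ "(X, Y, p, q)"]) simp
  qed
  from choice[OF allI[OF this]] obtain r where r: "\<forall>n. dist (fst (r n)) x < 1 / real (Suc n) \<and> dist (fst (snd (r n))) x < 1 / real (Suc n) \<and>
      norm (fst (snd (snd (r n))) + snd (snd (snd (r n))) - grad \<phi> x) < 1 / real (Suc n) \<and>
      F1 (fst (r n)) (fst (snd (snd (r n)))) + F2 (fst (snd (r n))) (snd (snd (snd (r n)))) \<le> nonlocal_op \<nu> j \<phi> x + 1 / real (Suc n)" ..
  have lim: "f \<longlonglongrightarrow> l" if "\<And>n. norm (f n - l) \<le> 1 / real (Suc n)" for f :: "nat \<Rightarrow> real^'d" and l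
  proof -
    have "(\<lambda>n. norm (f n - l)) \<longlonglongrightarrow> 0"
      by (rule squeeze_null[OF norm_ge_zero that LIMSEQ_Suc[OF lim_1_over_n]])
    then show ?thesis
      by (rule LIM_zero_cancel[OF tendsto_norm_zero_cancel])
  qed
  show ?thesis
  proof (rule that)
    show "(\<lambda>n. fst (r n)) \<longlonglongrightarrow> x" "(\<lambda>n. fst (snd (r n))) \<longlonglongrightarrow> x"
      "(\<lambda>n. fst (snd (snd (r n))) + snd (snd (snd (r n)))) \<longlonglongrightarrow> grad \<phi> x"
      using r by (auto intro!: lim less_imp_le simp: dist_norm)
    show "F1 (fst (r n)) (fst (snd (snd (r n)))) + F2 (fst (snd (r n))) (snd (snd (snd (r n)))) \<le> nonlocal_op \<nu> j \<phi> x + 1 / real (Suc n)" for n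
      using r by blast
  qed
qed

lemma lim_plus_null: "(\<lambda>n. c + 1 / real (Suc n)) \<longlonglongrightarrow> c"
  using tendsto_add[OF tendsto_const LIMSEQ_Suc[OF lim_1_over_n], of c] by simp

text \<open>For a fixed \<open>\<xi>\<close> the lower bounds
  \<open>p n \<bullet> \<xi> - \<phi>1\<close> and \<open>q n \<bullet> \<xi> - \<phi>2\<close> add
  up to an expression in \<open>p n + q n\<close>, which converges; the supremum over
  \<open>\<xi>\<close> is taken after the limit.\<close>

lemma subsolution_add:
  assumes Q: "compact Q" "Q \<noteq> {}" and \<phi>1: "\<phi>1 \<in> C_K Q" and \<phi>2: "\<phi>2 \<in> C_K Q"
    and s1: "visc_subsolution \<nu> j \<delta> (H_of Q \<phi>1) u1" and s2: "visc_subsolution \<nu> j \<delta> (H_of Q \<phi>2) u2"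
  shows "visc_subsolution \<nu> j \<delta> (H_of Q (\<lambda>x \<xi>. \<phi>1 x \<xi> + \<phi>2 x \<xi>)) (\<lambda>x. u1 x + u2 x)"
  unfolding visc_subsolution_iff
proof
  have u: "u1 \<in> C_torus" "u2 \<in> C_torus"
    and v: "vsub \<nu> j (\<lambda>x p. \<delta> * u1 x + H_of Q \<phi>1 x p) u1" "vsub \<nu> j (\<lambda>x p. \<delta> * u2 x + H_of Q \<phi>2 x p) u2"
    using s1 s2 unfolding visc_subsolution_iff by auto
  show "(\<lambda>x. u1 x + u2 x) \<in> C_torus" by (intro C_torus_add u)
  show "vsub \<nu> j (\<lambda>x p. \<delta> * (u1 x + u2 x) + H_of Q (\<lambda>x \<xi>. \<phi>1 x \<xi> + \<phi>2 x \<xi>) x p) (\<lambda>x. u1 x + u2 x)"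
    unfolding vsub_def
  proof (intro ballI allI impI)
    fix \<phi> x assume \<phi>: "\<phi> \<in> C2_torus" and max: "\<forall>y. u1 y + u2 y - \<phi> y \<le> u1 x + u2 x - \<phi> x"
    obtain X Y p q where X: "X \<longlonglongrightarrow> x" and Y: "Y \<longlonglongrightarrow> x" and pq: "(\<lambda>n. p n + q n) \<longlonglongrightarrow> grad \<phi> x"
      and le: "\<And>n. (\<delta> * u1 (X n) + H_of Q \<phi>1 (X n) (p n)) + (\<delta> * u2 (Y n) + H_of Q \<phi>2 (Y n) (q n)) \<le> nonlocal_op \<nu> j \<phi> x + 1 / real (Suc n)"
      by (rule doubling_seq[OF u(1) v(1) u(2) v(2) \<phi>, of x]) (use max in auto)
    have "grad \<phi> x \<bullet> \<xi> - (\<phi>1 x \<xi> + \<phi>2 x \<xi>) \<le> nonlocal_op \<nu> j \<phi> x - \<delta> * (u1 x + u2 x)" if \<xi>: "\<xi> \<in> Q" for \<xi>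
    proof -
      have "\<delta> * u1 (X n) + \<delta> * u2 (Y n) + (p n + q n) \<bullet> \<xi> - \<phi>1 (X n) \<xi> - \<phi>2 (Y n) \<xi> \<le> nonlocal_op \<nu> j \<phi> x + 1 / real (Suc n)" for n
        using le[of n] H_of_ge[OF \<phi>1 Q(1) \<xi>, of "p n" "X n"] H_of_ge[OF \<phi>2 Q(1) \<xi>, of "q n" "Y n"]
        unfolding inner_add_left by linarith
      moreover have "(\<lambda>n. \<delta> * u1 (X n) + \<delta> * u2 (Y n) + (p n + q n) \<bullet> \<xi> - \<phi>1 (X n) \<xi> - \<phi>2 (Y n) \<xi>)
          \<longlonglongrightarrow> \<delta> * u1 x + \<delta> * u2 x + grad \<phi> x \<bullet> \<xi> - \<phi>1 x \<xi> - \<phi>2 x \<xi>"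
        by (intro tendsto_diff tendsto_add tendsto_mult_left tendsto_inner tendsto_const pq
            cont_tendsto[OF C_torusD(2)[OF u(1)] X] cont_tendsto[OF C_torusD(2)[OF u(2)] Y]
            cont_tendsto[OF C_K_continuous(2)[OF \<phi>1 \<xi>] X] cont_tendsto[OF C_K_continuous(2)[OF \<phi>2 \<xi>] Y])
      ultimately have "\<delta> * u1 x + \<delta> * u2 x + grad \<phi> x \<bullet> \<xi> - \<phi>1 x \<xi> - \<phi>2 x \<xi> \<le> nonlocal_op \<nu> j \<phi> x"
        by (intro LIMSEQ_le[OF _ lim_plus_null]) auto
      then show ?thesis by (simp add: algebra_simps)
    qed
    then have "H_of Q (\<lambda>x \<xi>. \<phi>1 x \<xi> + \<phi>2 x \<xi>) x (grad \<phi> x) \<le> nonlocal_op \<nu> j \<phi> x - \<delta> * (u1 x + u2 x)"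
      by (intro H_of_le[OF C_K_add[OF \<phi>1 \<phi>2] Q]) auto
    then show "\<delta> * (u1 x + u2 x) + H_of Q (\<lambda>x \<xi>. \<phi>1 x \<xi> + \<phi>2 x \<xi>) x (grad \<phi> x) \<le> nonlocal_op \<nu> j \<phi> x"
      by simp
  qed
qed

lemma subsolution_scale:
  assumes Q: "compact Q" "Q \<noteq> {}" and \<phi>: "\<phi> \<in> C_K Q" and c: "c > 0"
    and s: "visc_subsolution \<nu> j \<delta> (H_of Q \<phi>) u"
  shows "visc_subsolution \<nu> j \<delta> (H_of Q (\<lambda>x \<xi>. c * \<phi> x \<xi>)) (\<lambda>x. c * u x)"
  unfolding visc_subsolution_iff
proof
  have u: "u \<in> C_torus" and v: "vsub \<nu> j (\<lambda>x p. \<delta> * u x + H_of Q \<phi> x p) u"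
    using s unfolding visc_subsolution_iff by auto
  show "(\<lambda>x. c * u x) \<in> C_torus" by (intro C_torus_cmult u)
  show "vsub \<nu> j (\<lambda>x p. \<delta> * (c * u x) + H_of Q (\<lambda>x \<xi>. c * \<phi> x \<xi>) x p) (\<lambda>x. c * u x)"
    unfolding vsub_def
  proof (intro ballI allI impI)
    fix \<psi> x assume \<psi>: "\<psi> \<in> C2_torus" and max: "\<forall>y. c * u y - \<psi> y \<le> c * u x - \<psi> x"
    have m: "u y - (1/c) * \<psi> y \<le> u x - (1/c) * \<psi> x" for y
    proof -
      have "(1/c) * (c * u y - \<psi> y) \<le> (1/c) * (c * u x - \<psi> x)"
        using c max by (intro mult_left_mono) auto
      then show ?thesis using c by (simp add: algebra_simps)
    qed
    have "\<delta> * u x + H_of Q \<phi> x ((1/c) *\<^sub>R grad \<psi> x) \<le> (1/c) * nonlocal_op \<nu> j \<psi> x"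
      using vsubD[OF v C2_torus_cmult(1)[OF \<psi>], of "1/c" x, OF m]
      unfolding C2_torus_cmult(2)[OF \<psi>] nonlocal_op_cmult[OF \<psi>] .
    then have "c * (\<delta> * u x + H_of Q \<phi> x ((1/c) *\<^sub>R grad \<psi> x)) \<le> c * ((1/c) * nonlocal_op \<nu> j \<psi> x)"
      using c by (intro mult_left_mono) auto
    then have 1: "\<delta> * (c * u x) + c * H_of Q \<phi> x ((1/c) *\<^sub>R grad \<psi> x) \<le> nonlocal_op \<nu> j \<psi> x"
      using c by (simp add: algebra_simps)
    have "H_of Q (\<lambda>x \<xi>. c * \<phi> x \<xi>) x (grad \<psi> x) \<le> c * H_of Q \<phi> x ((1/c) *\<^sub>R grad \<psi> x)"
    proof (rule H_of_le[OF C_K_cmult[OF \<phi>] Q])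
      fix \<xi> assume \<xi>: "\<xi> \<in> Q"
      have "c * (((1/c) *\<^sub>R grad \<psi> x) \<bullet> \<xi> - \<phi> x \<xi>) \<le> c * H_of Q \<phi> x ((1/c) *\<^sub>R grad \<psi> x)"
        using c H_of_ge[OF \<phi> Q(1) \<xi>, of "(1/c) *\<^sub>R grad \<psi> x" x] by (intro mult_left_mono) auto
      then show "grad \<psi> x \<bullet> \<xi> - c * \<phi> x \<xi> \<le> c * H_of Q \<phi> x ((1/c) *\<^sub>R grad \<psi> x)"
        using c by (simp add: algebra_simps)
    qed
    then show "\<delta> * (c * u x) + H_of Q (\<lambda>x \<xi>. c * \<phi> x \<xi>) x (grad \<psi> x) \<le> nonlocal_op \<nu> j \<psi> x"
      using 1 by linarith
  qed
qed

text \<open>The maximiser for the Hamiltonian of the supersolution is also tried in that of the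
  subsolution. The difference is then at least its scalar product with \<open>p n + q n\<close>,
  minus a difference of values of \<open>L\<close> at nearby points, and both vanish however large
  the momenta are. Keeping \<open>a\<close> and \<open>b\<close> general allows different discounts
  to be compared.\<close>

lemma comparison_at_max:
  assumes Q: "compact Q" "Q \<noteq> {}" and L: "L \<in> C_K Q" and u: "u \<in> C_torus" and v: "v \<in> C_torus"
    and a: "continuous_on UNIV a" and b: "continuous_on UNIV b"
    and sub: "vsub \<nu> j (\<lambda>x p. a x + H_of Q L x p) u"
    and super: "vsub \<nu> j (\<lambda>x p. - (b x + H_of Q L x (- p))) (\<lambda>x. - v x)"
    and max: "\<And>y. u y - v y \<le> u x - v x"
  shows "a x \<le> b x"
proof -
  obtain X Y p q where X: "X \<longlonglongrightarrow> x" and Y: "Y \<longlonglongrightarrow> x" and pq: "(\<lambda>n. p n + q n) \<longlonglongrightarrow> grad (\<lambda>x. 0) x"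
    and le: "\<And>n. (a (X n) + H_of Q L (X n) (p n)) + (- (b (Y n) + H_of Q L (Y n) (- q n))) \<le> nonlocal_op \<nu> j (\<lambda>x. 0) x + 1 / real (Suc n)"
    by (rule doubling_seq[OF u sub C_torus_minus[OF v] super C2_torus_const(1)[of 0], of x]) (use max in auto)
  have pq0: "(\<lambda>n. p n + q n) \<longlonglongrightarrow> 0"
    using pq by (simp add: C2_torus_const(2))
  have "\<exists>\<xi>. \<xi> \<in> Q \<and> H_of Q L (Y n) (- q n) = (- q n) \<bullet> \<xi> - L (Y n) \<xi>" for n
    using H_of_max[OF L Q, of "Y n" "- q n"] by metis
  from choice[OF allI[OF this]] obtain \<xi> where \<xi>: "\<forall>n. \<xi> n \<in> Q \<and> H_of Q L (Y n) (- q n) = (- q n) \<bullet> \<xi> n - L (Y n) (\<xi> n)" ..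
  then have \<xi>Q: "\<xi> n \<in> Q" for n by blast
  obtain B where B: "\<And>\<xi>. \<xi> \<in> Q \<Longrightarrow> norm \<xi> \<le> B"
    using compact_imp_bounded[OF Q(1)] unfolding bounded_iff by metis
  have "a (X n) - b (Y n) + (p n + q n) \<bullet> \<xi> n - (L (X n) (\<xi> n) - L (Y n) (\<xi> n)) \<le> 0 + 1 / real (Suc n)" for n
    using le[of n] \<xi> H_of_ge[OF L Q(1) \<xi>Q[of n], of "p n" "X n"]
    by (simp add: nonlocal_op_const inner_add_left algebra_simps)
  moreover have "(\<lambda>n. a (X n) - b (Y n) + (p n + q n) \<bullet> \<xi> n - (L (X n) (\<xi> n) - L (Y n) (\<xi> n))) \<longlonglongrightarrow> a x - b x + 0 - 0"
  proof (intro tendsto_diff tendsto_add cont_tendsto[OF a X] cont_tendsto[OF b Y])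
    show "(\<lambda>n. L (X n) (\<xi> n) - L (Y n) (\<xi> n)) \<longlonglongrightarrow> 0"
      by (rule C_K_uniform[OF L Q(1) X Y \<xi>Q])
    have "norm ((p n + q n) \<bullet> \<xi> n) \<le> norm (p n + q n) * B" for n
      using Cauchy_Schwarz_ineq2[of "p n + q n" "\<xi> n"] mult_left_mono[OF B[OF \<xi>Q[of n]] norm_ge_zero[of "p n + q n"]] by simp
    then show "(\<lambda>n. (p n + q n) \<bullet> \<xi> n) \<longlonglongrightarrow> 0"
      by (intro Lim_null_comparison[OF _ tendsto_mult_left_zero[OF tendsto_norm_zero[OF pq0]]] always_eventually) blast
  qed
  ultimately have "a x - b x + 0 - 0 \<le> 0"
    by (intro LIMSEQ_le[OF _ lim_plus_null[of 0]]) auto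
  then show ?thesis by simp
qed

text \<open>Adding \<open>\<eta> * sper (y - x)\<close> makes the maximum strict, which forces the
  maxima of \<open>u n - \<psi>\<close> to converge to \<open>x\<close>; \<open>\<eta>\<close> is
  removed last. The momenta converge because they are gradients of one test function.\<close>

lemma vsub_stable:
  assumes u: "\<And>n. u n \<in> C_torus" and w: "w \<in> C_torus" and lim: "uniform_limit UNIV u w sequentially"
    and sub: "\<And>n. vsub \<nu> j (F n) (u n)"
    and F: "\<And>X x p D. X \<longlonglongrightarrow> x \<Longrightarrow> p \<longlonglongrightarrow> D \<Longrightarrow> (\<lambda>n. F n (X n) (p n)) \<longlonglongrightarrow> F0 x D"
  shows "vsub \<nu> j F0 w"
  unfolding vsub_def
proof (intro ballI allI impI)
  fix \<phi> x assume \<phi>: "\<phi> \<in> C2_torus" and max: "\<forall>y. w y - \<phi> y \<le> w x - \<phi> x"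
  let ?s = "\<lambda>y. sper (y - x)"
  have all: "F0 x (grad \<phi> x) \<le> nonlocal_op \<nu> j \<phi> x + \<eta> * nonlocal_op \<nu> j ?s x" if \<eta>: "\<eta> > 0" for \<eta>
  proof -
    define \<psi> where "\<psi> y = \<phi> y + \<eta> * ?s y" for y
    note S = C2_torus_cmult[OF sper_shift(1)[of x], of \<eta>]
    have \<psi>: "\<psi> \<in> C2_torus" "grad \<psi> x = grad \<phi> x" "nonlocal_op \<nu> j \<psi> x = nonlocal_op \<nu> j \<phi> x + \<eta> * nonlocal_op \<nu> j ?s x"
      unfolding \<psi>_def C2_torus_add(2)[OF \<phi> S(1)] S(2) sper_shift(2) nonlocal_op_add[OF \<phi> S(1)] nonlocal_op_cmult[OF sper_shift(1)]
      using C2_torus_add(1)[OF \<phi> S(1)] by simp_all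
    have strict: "w y - \<psi> y < w x - \<psi> x" if "y \<in> cube x" "y \<noteq> x" for y
    proof -
      have "\<not> lattice_equiv y x" using that cube_lattice_equiv_eq by blast
      then have "0 < \<eta> * ?s y" by (intro mult_pos_pos sper_pos \<eta>)
      then show ?thesis using max[rule_format, of y] by (simp add: \<psi>_def)
    qed
    have mle: "w y - \<psi> y \<le> w x - \<psi> x" for y
    proof -
      have "0 \<le> \<eta> * ?s y" using \<eta> sper_nonneg by (intro mult_nonneg_nonneg) auto
      then show ?thesis using max[rule_format, of y] by (simp add: \<psi>_def)
    qed
    have "\<exists>X. X \<in> cube x \<and> (\<forall>y. u n y - \<psi> y \<le> u n X - \<psi> X)" for n
      by (rule C_torus_attains_max[OF C_torus_diff[OF u[of n] C2_torus_imp_C_torus[OF \<psi>(1)]], of x]) blast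
    from choice[OF allI[OF this]] obtain X where X: "\<forall>n. X n \<in> cube x \<and> (\<forall>y. u n y - \<psi> y \<le> u n (X n) - \<psi> (X n))" ..
    have "(\<lambda>n. w (X n) - \<psi> (X n)) \<longlonglongrightarrow> w x - \<psi> x"
    proof (rule tendstoI)
      fix e :: real assume "e > 0"
      then have "e / 2 > 0" by simp
      from uniform_limitD[OF lim this] show "\<forall>\<^sub>F n in sequentially. dist (w (X n) - \<psi> (X n)) (w x - \<psi> x) < e"
      proof eventually_elim
        case (elim n)
        have "\<bar>u n (X n) - w (X n)\<bar> < e / 2" "\<bar>u n x - w x\<bar> < e / 2"
          using elim by (auto simp: dist_norm)
        moreover have "u n x - \<psi> x \<le> u n (X n) - \<psi> (X n)" using X by blast
        ultimately show ?case
          using mle[of "X n"] unfolding dist_norm real_norm_def by arith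
      qed
    qed
    then have Xx: "X \<longlonglongrightarrow> x"
    proof (rule strict_max_tendsto[where C = "cube x" and f = "\<lambda>y. w y - \<psi> y", rotated -1])
      show "continuous_on (cube x) (\<lambda>y. w y - \<psi> y)"
        by (intro continuous_on_diff C_torusD(2)[OF w] C2_torus_gradD(5)[OF \<psi>(1)])
    qed (use strict X compact_cube in auto)
    have "F n (X n) (grad \<psi> (X n)) \<le> nonlocal_op \<nu> j \<psi> (X n)" for n
      by (rule vsubD[OF sub \<psi>(1)]) (use X in blast)
    then have "F0 x (grad \<psi> x) \<le> nonlocal_op \<nu> j \<psi> x"
      by (intro LIMSEQ_le[OF F[OF Xx cont_tendsto[OF C2_torus_gradD(3)[OF \<psi>(1)] Xx]] nonlocal_op_tendsto[OF \<psi>(1) Xx]]) auto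
    then show ?thesis unfolding \<psi>(2,3) .
  qed
  have "F0 x (grad \<phi> x) \<le> nonlocal_op \<nu> j \<phi> x + (1 / real (Suc n)) * nonlocal_op \<nu> j ?s x" for n
    by (rule all) simp
  moreover have "(\<lambda>n. nonlocal_op \<nu> j \<phi> x + (1 / real (Suc n)) * nonlocal_op \<nu> j ?s x) \<longlonglongrightarrow> nonlocal_op \<nu> j \<phi> x + 0"
    by (intro tendsto_add tendsto_const tendsto_mult_left_zero LIMSEQ_Suc[OF lim_1_over_n])
  ultimately have "F0 x (grad \<phi> x) \<le> nonlocal_op \<nu> j \<phi> x + 0"
    by (intro LIMSEQ_le_const) auto
  then show "F0 x (grad \<phi> x) \<le> nonlocal_op \<nu> j \<phi> x" by simp
qed

end

section \<open>Linear functionals dominated by sublinear ones\<close>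

definition function_space :: "('b \<Rightarrow> real) set \<Rightarrow> bool" where
  "function_space V \<longleftrightarrow> (\<forall>f\<in>V. \<forall>g\<in>V. (\<lambda>x. f x + g x) \<in> V) \<and> (\<forall>f\<in>V. \<forall>c. (\<lambda>x. c * f x) \<in> V)"

text \<open>Homogeneity is demanded as an inequality for positive factors; applied to a factor and
  to its inverse, it gives equality.\<close>

definition sublinear_on :: "('b \<Rightarrow> real) set \<Rightarrow> (('b \<Rightarrow> real) \<Rightarrow> real) \<Rightarrow> bool" where
  "sublinear_on V p \<longleftrightarrow> (\<forall>f\<in>V. \<forall>g\<in>V. p (\<lambda>x. f x + g x) \<le> p f + p g) \<and>
     (\<forall>f\<in>V. \<forall>c>0. p (\<lambda>x. c * f x) \<le> c * p f)"

definition linear_functional_on :: "('b \<Rightarrow> real) set \<Rightarrow> (('b \<Rightarrow> real) \<Rightarrow> real) \<Rightarrow> bool" where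
  "linear_functional_on V p \<longleftrightarrow> (\<forall>f\<in>V. \<forall>g\<in>V. p (\<lambda>x. f x + g x) = p f + p g) \<and>
     (\<forall>f\<in>V. \<forall>c. p (\<lambda>x. c * f x) = c * p f)"

lemma linear_functional_onD:
  assumes "linear_functional_on V p" "f \<in> V"
  shows "g \<in> V \<Longrightarrow> p (\<lambda>x. f x + g x) = p f + p g" "p (\<lambda>x. c * f x) = c * p f"
  using assms by (auto simp: linear_functional_on_def)

lemma function_spaceD:
  assumes "function_space V" "f \<in> V"
  shows "g \<in> V \<Longrightarrow> (\<lambda>x. f x + g x) \<in> V" "(\<lambda>x. c * f x) \<in> V" "(\<lambda>x. - f x) \<in> V" "(\<lambda>x. 0) \<in> V"
proof -
  show c: "(\<lambda>x. c * f x) \<in> V" for c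
    using assms unfolding function_space_def by blast
  show "(\<lambda>x. - f x) \<in> V" "(\<lambda>x. 0) \<in> V"
    using c[of "-1"] c[of 0] by simp_all
  show "g \<in> V \<Longrightarrow> (\<lambda>x. f x + g x) \<in> V"
    using assms unfolding function_space_def by blast
qed

lemma sublinear_onD:
  assumes V: "function_space V" and p: "sublinear_on V p" and f: "f \<in> V"
  shows "g \<in> V \<Longrightarrow> p (\<lambda>x. f x + g x) \<le> p f + p g"
    and "c \<ge> 0 \<Longrightarrow> p (\<lambda>x. c * f x) = c * p f"
    and "p (\<lambda>x. 0) = 0"
    and "- p (\<lambda>x. - f x) \<le> p f"
proof -
  show a: "g \<in> V \<Longrightarrow> p (\<lambda>x. f x + g x) \<le> p f + p g" for g
    using p f unfolding sublinear_on_def by blast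
  have s: "p (\<lambda>x. c * g x) \<le> c * p g" if "g \<in> V" "c > 0" for g c
    using p that unfolding sublinear_on_def by blast
  show z: "p (\<lambda>x. 0) = 0"
    using s[OF function_spaceD(4)[OF V f], of 2] s[OF function_spaceD(4)[OF V f], of "1/2"] by simp
  show "p (\<lambda>x. c * f x) = c * p f" if "c \<ge> 0" for c
  proof (cases "c = 0")
    case False
    then have c: "c > 0" using that by simp
    have "p (\<lambda>x. (1/c) * (c * f x)) \<le> (1/c) * p (\<lambda>x. c * f x)"
      using c by (intro s function_spaceD(2)[OF V f]) auto
    then have "c * p f \<le> p (\<lambda>x. c * f x)"
      using c by (simp add: field_simps)
    then show ?thesis using s[OF f c] by simp
  qed (simp add: z)
  have "p (\<lambda>x. f x + - f x) \<le> p f + p (\<lambda>x. - f x)"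
    by (rule a[OF function_spaceD(3)[OF V f]])
  then show "- p (\<lambda>x. - f x) \<le> p f"
    using z by simp
qed

lemma Inf_add_ge:
  fixes A B :: "real set"
  assumes "A \<noteq> {}" "B \<noteq> {}" "\<And>a b. a \<in> A \<Longrightarrow> b \<in> B \<Longrightarrow> x \<le> a + b"
  shows "x \<le> Inf A + Inf B"
proof -
  have "x - Inf B \<le> a" if "a \<in> A" for a
  proof -
    have "x - a \<le> b" if "b \<in> B" for b
      using assms(3)[OF \<open>a \<in> A\<close> that] by simp
    then have "x - a \<le> Inf B"
      by (intro cInf_greatest assms(2))
    then show ?thesis by simp
  qed
  then have "x - Inf B \<le> Inf A"
    by (intro cInf_greatest assms(1))
  then show ?thesis by simp
qed

text \<open>\<open>q f\<close> is the infimum over \<open>t \<ge> 0\<close> of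
  \<open>p (f + t * g) - t * p g\<close>. For a minimal \<open>p\<close> nothing can be gained in
  this way, and the case \<open>t = 1\<close> then gives superadditivity.\<close>

lemma sublinear_decrease:
  assumes V: "function_space V" and p: "sublinear_on V p" and g: "g \<in> V"
  obtains q where "sublinear_on V q" "\<And>f. f \<in> V \<Longrightarrow> q f \<le> p f"
    "\<And>f. f \<in> V \<Longrightarrow> q f \<le> p (\<lambda>x. f x + g x) - p g"
proof -
  define P where "P f = (\<lambda>t. p (\<lambda>x. f x + t * g x) - t * p g) ` {0..}" for f
  define q where "q f = Inf (P f)" for f
  have ne: "P f \<noteq> {}" for f by (simp add: P_def)
  have cl: "(\<lambda>x. f x + t * g x) \<in> V" if "f \<in> V" for f t
    using function_spaceD[OF V] that g by simp
  have bb: "bdd_below (P f)" if f: "f \<in> V" for f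
  proof (rule bdd_belowI)
    fix y assume "y \<in> P f"
    then obtain t where t: "t \<ge> 0" "y = p (\<lambda>x. f x + t * g x) - t * p g"
      by (auto simp: P_def)
    have "t * p g = p (\<lambda>x. (f x + t * g x) + - f x)"
      using sublinear_onD(2)[OF V p g t(1)] by simp
    also have "\<dots> \<le> p (\<lambda>x. f x + t * g x) + p (\<lambda>x. - f x)"
      by (intro sublinear_onD(1)[OF V p cl[OF f]] function_spaceD(3)[OF V f])
    finally show "- p (\<lambda>x. - f x) \<le> y" using t(2) by simp
  qed
  have le: "q f \<le> p (\<lambda>x. f x + t * g x) - t * p g" if "f \<in> V" "t \<ge> 0" for f t
    unfolding q_def using that by (intro cInf_lower bb) (auto simp: P_def)
  have "sublinear_on V q"
    unfolding sublinear_on_def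
  proof (intro conjI ballI allI impI)
    fix f1 f2 assume f: "f1 \<in> V" "f2 \<in> V"
    have "q (\<lambda>x. f1 x + f2 x) \<le> a + b" if ab: "a \<in> P f1" "b \<in> P f2" for a b
    proof -
      obtain s where s: "s \<ge> 0" "a = p (\<lambda>x. f1 x + s * g x) - s * p g"
        using ab(1) by (auto simp: P_def)
      obtain t where t: "t \<ge> 0" "b = p (\<lambda>x. f2 x + t * g x) - t * p g"
        using ab(2) by (auto simp: P_def)
      have "q (\<lambda>x. f1 x + f2 x) \<le> p (\<lambda>x. (f1 x + f2 x) + (s + t) * g x) - (s + t) * p g"
        using f s(1) t(1) by (intro le function_spaceD(1)[OF V]) auto
      also have "(\<lambda>x. (f1 x + f2 x) + (s + t) * g x) = (\<lambda>x. (f1 x + s * g x) + (f2 x + t * g x))"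
        by (simp add: algebra_simps)
      also have "p \<dots> \<le> p (\<lambda>x. f1 x + s * g x) + p (\<lambda>x. f2 x + t * g x)"
        by (intro sublinear_onD(1)[OF V p] cl f)
      finally show ?thesis using s(2) t(2) by (simp add: algebra_simps)
    qed
    then show "q (\<lambda>x. f1 x + f2 x) \<le> q f1 + q f2"
      unfolding q_def[of f1] q_def[of f2] by (intro Inf_add_ge ne) auto
  next
    fix f and c :: real assume f: "f \<in> V" and c: "c > 0"
    have "q (\<lambda>x. c * f x) / c \<le> y" if y: "y \<in> P f" for y
    proof -
      obtain t where t: "t \<ge> 0" "y = p (\<lambda>x. f x + t * g x) - t * p g"
        using y by (auto simp: P_def)
      have "q (\<lambda>x. c * f x) \<le> p (\<lambda>x. c * f x + (c * t) * g x) - (c * t) * p g"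
        using f c t(1) by (intro le function_spaceD(2)[OF V]) auto
      also have "(\<lambda>x. c * f x + (c * t) * g x) = (\<lambda>x. c * (f x + t * g x))"
        by (simp add: algebra_simps)
      also have "p \<dots> = c * p (\<lambda>x. f x + t * g x)"
        using c by (intro sublinear_onD(2)[OF V p] cl f) auto
      finally have "q (\<lambda>x. c * f x) \<le> c * y"
        using t(2) by (simp add: right_diff_distrib mult.assoc)
      then show ?thesis using c by (simp add: pos_divide_le_eq mult.commute)
    qed
    then have "q (\<lambda>x. c * f x) / c \<le> q f"
      unfolding q_def[of f] by (intro cInf_greatest ne) auto
    then show "q (\<lambda>x. c * f x) \<le> c * q f"
      using c by (simp add: field_simps)
  qed
  moreover have "q f \<le> p f" if "f \<in> V" for f
    using le[OF that, of 0] by simp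
  moreover have "q f \<le> p (\<lambda>x. f x + g x) - p g" if "f \<in> V" for f
    using le[OF that, of 1] by simp
  ultimately show ?thesis using that by blast
qed

lemma sublinear_minorant_chain:
  assumes V: "function_space V" and C: "C \<noteq> {}"
    and sub: "\<And>q. q \<in> C \<Longrightarrow> sublinear_on V q" and le: "\<And>q f. q \<in> C \<Longrightarrow> f \<in> V \<Longrightarrow> q f \<le> p f"
    and chain: "\<And>q r. q \<in> C \<Longrightarrow> r \<in> C \<Longrightarrow> (\<forall>f. q f \<le> r f) \<or> (\<forall>f. r f \<le> q f)"
  shows "sublinear_on V (\<lambda>f. INF q\<in>C. q f)"
    and "\<And>q f. q \<in> C \<Longrightarrow> f \<in> V \<Longrightarrow> (INF q\<in>C. q f) \<le> q f"
proof -
  have bb: "bdd_below ((\<lambda>q. q f) ` C)" if f: "f \<in> V" for f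
  proof (rule bdd_belowI2)
    fix q assume q: "q \<in> C"
    show "- p (\<lambda>x. - f x) \<le> q f"
      using sublinear_onD(4)[OF V sub[OF q] f] le[OF q function_spaceD(3)[OF V f]] by linarith
  qed
  show lower: "(INF q\<in>C. q f) \<le> q f" if "q \<in> C" "f \<in> V" for q f
    using that by (intro cINF_lower bb)
  show "sublinear_on V (\<lambda>f. INF q\<in>C. q f)"
    unfolding sublinear_on_def
  proof (intro conjI ballI allI impI)
    fix f g assume f: "f \<in> V" "g \<in> V"
    then have fg: "(\<lambda>x. f x + g x) \<in> V" using function_spaceD(1)[OF V] by blast
    \<comment> \<open>Two members of the chain are comparable, so the smaller one bounds both
      terms.\<close>
    have *: "(INF q\<in>C. q (\<lambda>x. f x + g x)) \<le> q f + r g" if "q \<in> C" "r \<in> C" for q r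
    proof -
      have "(INF q\<in>C. q (\<lambda>x. f x + g x)) \<le> s f + s g" if "s \<in> C" for s
        using lower[OF that fg] sublinear_onD(1)[OF V sub[OF that] f] by linarith
      then show ?thesis
        using chain[OF that] that add_mono[OF order_refl] by (smt (verit))
    qed
    show "(INF q\<in>C. q (\<lambda>x. f x + g x)) \<le> (INF q\<in>C. q f) + (INF q\<in>C. q g)"
      by (rule Inf_add_ge) (use C * in auto)
  next
    fix f and c :: real assume f: "f \<in> V" and c: "c > 0"
    have "(INF q\<in>C. q (\<lambda>x. c * f x)) / c \<le> (INF q\<in>C. q f)"
    proof (rule cINF_greatest[OF C])
      fix q assume q: "q \<in> C"
      have "(INF q\<in>C. q (\<lambda>x. c * f x)) \<le> c * q f"
        using lower[OF q function_spaceD(2)[OF V f], of c] sublinear_onD(2)[OF V sub[OF q] f, of c] c by simp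
      then show "(INF q\<in>C. q (\<lambda>x. c * f x)) / c \<le> q f"
        using c by (simp add: field_simps)
    qed
    then show "(INF q\<in>C. q (\<lambda>x. c * f x)) \<le> c * (INF q\<in>C. q f)"
      using c by (simp add: field_simps)
  qed
qed

text \<open>A sublinear functional that is minimal in the pointwise order is linear.\<close>

lemma sublinear_minorant_linear:
  assumes V: "function_space V" and p: "sublinear_on V p" and f0: "f0 \<in> V"
  obtains \<Lambda> where "linear_functional_on V \<Lambda>" "\<And>f. f \<in> V \<Longrightarrow> \<Lambda> f \<le> p f" "\<Lambda> f0 = p f0"
proof -
  \<comment> \<open>Lowering once along \<open>f0\<close> forces equality at \<open>f0\<close>: the
    third property, taken at \<open>- f0\<close>, bounds \<open>p'\<close> there by
    \<open>- p f0\<close>.\<close>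
  obtain p' where p': "sublinear_on V p'" "\<And>f. f \<in> V \<Longrightarrow> p' f \<le> p f"
    "\<And>f. f \<in> V \<Longrightarrow> p' f \<le> p (\<lambda>x. f x + f0 x) - p f0"
    using sublinear_decrease[OF V p f0] by blast
  \<comment> \<open>Values off \<open>V\<close> are fixed to 0, since they could otherwise decrease
    without bound and no minimal element would exist. \<open>P\<close> reverses the order so that
    Zorn's lemma yields a minimal element.\<close>
  define A where "A = {q. sublinear_on V q \<and> (\<forall>f\<in>V. q f \<le> p' f) \<and> (\<forall>f. f \<notin> V \<longrightarrow> q f = 0)}"
  define P where "P = (\<lambda>a b :: ('a \<Rightarrow> real) \<Rightarrow> real. \<forall>f. b f \<le> a f)"
  have restr: "sublinear_on V (\<lambda>f. if f \<in> V then q f else 0)" if "sublinear_on V q" for q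
    using that function_spaceD[OF V] unfolding sublinear_on_def by simp
  have po: "partial_order_on A (relation_of P A)"
    unfolding partial_order_on_def preorder_on_def refl_on_def trans_def antisym_def relation_of_def P_def
    by (auto intro!: ext order_antisym) (meson order_trans)
  have ch: "\<exists>u\<in>A. \<forall>a\<in>C. P a u" if C: "C \<in> Chains (relation_of P A)" for C
  proof (cases "C = {}")
    case True
    then show ?thesis
      using restr[OF p'(1)] by (intro bexI[of _ "\<lambda>f. if f \<in> V then p' f else 0"]) (auto simp: A_def)
  next
    case False
    have CA: "q \<in> A" if "q \<in> C" for q
      using C that unfolding Chains_def relation_of_def by blast
    have cc: "(\<forall>f. q f \<le> r f) \<or> (\<forall>f. r f \<le> q f)" if "q \<in> C" "r \<in> C" for q r
      using C that unfolding Chains_def relation_of_def P_def by blast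
    let ?u = "\<lambda>f. INF q\<in>C. q f"
    have C1: "sublinear_on V q" "f \<in> V \<Longrightarrow> q f \<le> p' f" if "q \<in> C" for q f
      using CA[OF that] unfolding A_def by auto
    have u: "sublinear_on V ?u" "\<And>q f. q \<in> C \<Longrightarrow> f \<in> V \<Longrightarrow> ?u f \<le> q f"
      by (rule sublinear_minorant_chain[OF V False, where p = p'];
          (assumption | erule C1(1) | erule (1) C1(2) | erule (1) cc))+
    define v where "v f = (if f \<in> V then ?u f else 0)" for f
    have "v \<in> A"
      unfolding A_def
    proof (intro CollectI conjI ballI allI impI)
      show "sublinear_on V v"
        unfolding v_def by (rule restr[OF u(1)])
      fix f assume f: "f \<in> V"
      obtain q where "q \<in> C" using False by blast
      then show "v f \<le> p' f"
        using u(2)[of q f] C1(2)[of q f] f by (simp add: v_def)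
    qed (simp add: v_def)
    moreover have "P a v" if "a \<in> C" for a
      using u(2)[OF that] CA[OF that] unfolding P_def v_def A_def by auto
    ultimately show ?thesis by blast
  qed
  obtain m where m: "m \<in> A" "\<And>a. a \<in> A \<Longrightarrow> P m a \<Longrightarrow> a = m"
    using predicate_Zorn[OF po ch] by blast
  have ms: "sublinear_on V m" and mp: "\<And>f. f \<in> V \<Longrightarrow> m f \<le> p' f" and mo: "\<And>f. f \<notin> V \<Longrightarrow> m f = 0"
    using m(1) unfolding A_def by auto
  have add: "m (\<lambda>x. f x + g x) = m f + m g" if f: "f \<in> V" and g: "g \<in> V" for f g
  proof -
    obtain q where q: "sublinear_on V q" "\<And>f. f \<in> V \<Longrightarrow> q f \<le> m f"
      "\<And>f. f \<in> V \<Longrightarrow> q f \<le> m (\<lambda>x. f x + g x) - m g"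
      using sublinear_decrease[OF V ms g] by blast
    define r where "r f = (if f \<in> V then q f else 0)" for f
    have "r \<in> A"
      using restr[OF q(1)] q(2) mp unfolding A_def r_def by (auto intro: order_trans)
    moreover have "P m r"
      using q(2) mo unfolding P_def r_def by simp
    ultimately have "r = m" using m(2) by blast
    then have "m f \<le> m (\<lambda>x. f x + g x) - m g"
      using q(3)[OF f] f r_def[of f] by simp
    then show ?thesis
      using sublinear_onD(1)[OF V ms f g] by linarith
  qed
  have neg: "m (\<lambda>x. - f x) = - m f" if f: "f \<in> V" for f
    using add[OF f function_spaceD(3)[OF V f]] sublinear_onD(3)[OF V ms f] by simp
  have scale: "m (\<lambda>x. c * f x) = c * m f" if f: "f \<in> V" for f c
  proof (cases "c \<ge> 0")
    case True
    then show ?thesis using sublinear_onD(2)[OF V ms f] by blast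
  next
    case False
    have "m (\<lambda>x. - ((- c) * f x)) = - m (\<lambda>x. (- c) * f x)"
      by (rule neg[OF function_spaceD(2)[OF V f]])
    also have "m (\<lambda>x. (- c) * f x) = (- c) * m f"
      using False by (intro sublinear_onD(2)[OF V ms f]) simp
    finally show ?thesis by simp
  qed
  have lin: "linear_functional_on V m"
    unfolding linear_functional_on_def using add scale by blast
  have mle: "m f \<le> p f" if "f \<in> V" for f
    using mp[OF that] p'(2)[OF that] by linarith
  have "m (\<lambda>x. - f0 x) \<le> p (\<lambda>x. - f0 x + f0 x) - p f0"
    using mp[OF function_spaceD(3)[OF V f0]] p'(3)[OF function_spaceD(3)[OF V f0]] by linarith
  then have "m f0 = p f0"
    using neg[OF f0] mle[OF f0] sublinear_onD(3)[OF V p f0] by simp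
  with lin mle that show ?thesis by blast
qed

section \<open>The Riesz representation theorem on a compact set\<close>

text \<open>\<open>t\<close> is cut into slices of height one; the \<open>k\<close>-th summand is
  the part between \<open>k\<close> and \<open>k + 1\<close>.\<close>

lemma sum_clamp:
  fixes t :: real
  assumes "t \<ge> 0"
  shows "(\<Sum>k<n. min (max (t - real k) 0) 1) = min t (real n)"
  using assms by (induction n) (auto simp: min_def max_def)

text \<open>\<open>upper\<close> expresses positivity and normalisation at once:
  \<open>t = 0\<close> gives monotonicity, and the constants 1 and -1 give the value 1 on the
  constant function 1.\<close>

locale positive_functional =
  fixes X :: "'a::euclidean_space set" and \<Lambda> :: "('a \<Rightarrow> real) \<Rightarrow> real"
  assumes compact: "compact X"
    and add: "\<And>f g. continuous_on X f \<Longrightarrow> continuous_on X g \<Longrightarrow> \<Lambda> (\<lambda>x. f x + g x) = \<Lambda> f + \<Lambda> g"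
    and scale: "\<And>c f. continuous_on X f \<Longrightarrow> \<Lambda> (\<lambda>x. c * f x) = c * \<Lambda> f"
    and upper: "\<And>f t. continuous_on X f \<Longrightarrow> (\<And>x. x \<in> X \<Longrightarrow> f x \<le> t) \<Longrightarrow> \<Lambda> f \<le> t"
begin

lemma diff: "continuous_on X f \<Longrightarrow> continuous_on X g \<Longrightarrow> \<Lambda> (\<lambda>x. f x - g x) = \<Lambda> f - \<Lambda> g"
  using add[of f "\<lambda>x. (-1) * g x"] scale[of g "-1"] by (simp add: continuous_on_minus)

lemma mono:
  assumes "continuous_on X f" "continuous_on X g" "\<And>x. x \<in> X \<Longrightarrow> f x \<le> g x"
  shows "\<Lambda> f \<le> \<Lambda> g"
proof -
  have "\<Lambda> (\<lambda>x. f x - g x) \<le> 0"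
    using assms by (intro upper continuous_intros) auto
  then show ?thesis using diff[OF assms(1,2)] by simp
qed

lemma const: "\<Lambda> (\<lambda>x. c) = c"
proof -
  have "\<Lambda> (\<lambda>x. 1) \<le> 1" "\<Lambda> (\<lambda>x. (-1) * 1) \<le> - 1"
    by (intro upper continuous_intros; simp)+
  then have "\<Lambda> (\<lambda>x. 1) = 1"
    using scale[of "\<lambda>x. 1" "-1"] by simp
  then show ?thesis using scale[of "\<lambda>x. 1" c] by simp
qed

lemma sum: "finite I \<Longrightarrow> (\<And>i. i \<in> I \<Longrightarrow> continuous_on X (f i)) \<Longrightarrow> \<Lambda> (\<lambda>x. \<Sum>i\<in>I. f i x) = (\<Sum>i\<in>I. \<Lambda> (f i))"
proof (induction I rule: finite_induct)
  case (insert i I)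
  then have "\<Lambda> (\<lambda>x. f i x + (\<Sum>i\<in>I. f i x)) = \<Lambda> (f i) + \<Lambda> (\<lambda>x. \<Sum>i\<in>I. f i x)"
    by (intro add continuous_on_sum) auto
  then show ?case using insert by simp
qed (simp add: const)

text \<open>In place of compact support inside \<open>U\<close> only vanishing on \<open>X\<close>
  off \<open>U\<close> is required; \<open>adm_cut\<close> recovers the stronger property up to an
  error \<open>e\<close>.\<close>

definition adm :: "'a set \<Rightarrow> ('a \<Rightarrow> real) set" where
  "adm U = {f. continuous_on X f \<and> (\<forall>x\<in>X. 0 \<le> f x \<and> f x \<le> indicator U x)}"

definition content :: "'a set \<Rightarrow> real" where
  "content U = (SUP f\<in>adm U. \<Lambda> f)"

definition outer :: "'a set \<Rightarrow> ennreal" where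
  "outer A = (INF U\<in>{U. open U \<and> A \<subseteq> U}. ennreal (content U))"

lemma zero_adm: "(\<lambda>x. 0) \<in> adm U"
  by (auto simp: adm_def)

lemma bdd_adm: "bdd_above (\<Lambda> ` adm U)"
proof (rule bdd_aboveI2)
  fix f assume "f \<in> adm U"
  then show "\<Lambda> f \<le> 1"
    by (intro upper) (auto simp: adm_def indicator_def split: if_splits intro: order_trans)
qed

lemma le_content: "f \<in> adm U \<Longrightarrow> \<Lambda> f \<le> content U"
  unfolding content_def by (intro cSUP_upper bdd_adm)

lemma content_le: "(\<And>f. f \<in> adm U \<Longrightarrow> \<Lambda> f \<le> c) \<Longrightarrow> content U \<le> c"
  unfolding content_def using zero_adm by (intro cSUP_least) auto

lemma content_nonneg: "0 \<le> content U"
  using le_content[OF zero_adm, of U] const[of 0] by simp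

lemma adm_mono: "U \<subseteq> V \<Longrightarrow> adm U \<subseteq> adm V"
  by (auto simp: adm_def indicator_def split: if_splits)

lemma content_mono: "U \<subseteq> V \<Longrightarrow> content U \<le> content V"
  by (rule content_le) (use adm_mono le_content in blast)

lemma content_null: "X \<inter> U = {} \<Longrightarrow> content U = 0"
proof -
  assume a: "X \<inter> U = {}"
  have "content U \<le> 0"
  proof (rule content_le)
    fix f assume f: "f \<in> adm U"
    have "f x \<le> 0" if "x \<in> X" for x
    proof -
      have "x \<notin> U" "f x \<le> indicator U x"
        using a f that by (auto simp: adm_def)
      then show ?thesis by simp
    qed
    then show "\<Lambda> f \<le> 0"
      using f by (intro upper) (auto simp: adm_def)
  qed
  then show ?thesis using content_nonneg[of U] by simp
qed

lemma content_UNIV: "content UNIV = 1"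
proof (rule antisym)
  show "content UNIV \<le> 1"
    by (rule content_le) (auto simp: adm_def intro!: upper)
  have "(\<lambda>x. 1) \<in> adm UNIV" by (auto simp: adm_def)
  then show "1 \<le> content UNIV" using le_content const by metis
qed

lemma closed_superlevel:
  fixes f :: "'a \<Rightarrow> real"
  assumes "continuous_on X f"
  shows "closed {x \<in> X. f x \<ge> e}" "closed {x \<in> X. f x \<le> e}"
proof -
  have "{x \<in> X. f x \<ge> e} = f -` {e..} \<inter> X" "{x \<in> X. f x \<le> e} = f -` {..e} \<inter> X"
    by auto
  then show "closed {x \<in> X. f x \<ge> e}" "closed {x \<in> X. f x \<le> e}"
    using continuous_on_closed_vimage[THEN iffD1, rule_format, OF compact_imp_closed[OF compact] assms closed_atLeast[of e]]
      continuous_on_closed_vimage[THEN iffD1, rule_format, OF compact_imp_closed[OF compact] assms closed_atMost[of e]]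
    by simp_all
qed

text \<open>Cutting at height \<open>e\<close> moves the support of an admissible function into a closed set.\<close>

lemma adm_cut:
  assumes f: "continuous_on X f" "\<And>x. x \<in> X \<Longrightarrow> f x \<le> 1" and e: "e > 0" and U: "{x \<in> X. f x \<ge> e} \<subseteq> U"
  shows "(\<lambda>x. max 0 (f x - e)) \<in> adm U" "\<Lambda> f \<le> \<Lambda> (\<lambda>x. max 0 (f x - e)) + e"
proof -
  have c: "continuous_on X (\<lambda>x. max 0 (f x - e))"
    using f(1) by (intro continuous_intros)
  have "max 0 (f x - e) \<le> indicator U x" if "x \<in> X" for x
  proof (cases "f x \<ge> e")
    case True
    then have "x \<in> U" using U that by blast
    then show ?thesis using f(2)[OF that] e by simp
  next
    case False
    then show ?thesis by simp
  qed
  then show "(\<lambda>x. max 0 (f x - e)) \<in> adm U"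
    using c by (auto simp: adm_def)
  have "\<Lambda> f \<le> \<Lambda> (\<lambda>x. max 0 (f x - e) + e)"
    using f(1) c by (intro mono continuous_intros) auto
  also have "\<dots> = \<Lambda> (\<lambda>x. max 0 (f x - e)) + e"
    using add[OF c, of "\<lambda>x. e"] const by simp
  finally show "\<Lambda> f \<le> \<Lambda> (\<lambda>x. max 0 (f x - e)) + e" .
qed

lemma admD: "f \<in> adm U \<Longrightarrow> continuous_on X f" "f \<in> adm U \<Longrightarrow> x \<in> X \<Longrightarrow> 0 \<le> f x"
  "f \<in> adm U \<Longrightarrow> x \<in> X \<Longrightarrow> f x \<le> 1" "f \<in> adm U \<Longrightarrow> x \<in> X \<Longrightarrow> x \<notin> U \<Longrightarrow> f x = 0"
proof -
  show "f \<in> adm U \<Longrightarrow> continuous_on X f" "f \<in> adm U \<Longrightarrow> x \<in> X \<Longrightarrow> 0 \<le> f x"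
    "f \<in> adm U \<Longrightarrow> x \<in> X \<Longrightarrow> x \<notin> U \<Longrightarrow> f x = 0"
    by (auto simp: adm_def intro: antisym)
  show "f \<in> adm U \<Longrightarrow> x \<in> X \<Longrightarrow> f x \<le> 1"
    by (auto simp: adm_def indicator_def split: if_splits intro: order_trans)
qed

text \<open>A Urysohn function \<open>h\<close> splits \<open>f\<close>. The part
  \<open>f * h\<close> vanishes off \<open>U\<close>, but \<open>f * (1 - h)\<close> is known to
  vanish off \<open>V\<close> only where \<open>f \<ge> e\<close>, which is why it is cut at height
  \<open>e\<close>.\<close>

lemma content_Un:
  assumes U: "open U" and V: "open V"
  shows "content (U \<union> V) \<le> content U + content V"
proof (rule content_le)
  fix f assume f: "f \<in> adm (U \<union> V)"
  show "\<Lambda> f \<le> content U + content V"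
  proof (rule field_le_epsilon)
    fix e :: real assume e: "e > 0"
    have "closed ({x \<in> X. f x \<ge> e} - V)" "closed (X - U)"
      using closed_superlevel(1)[OF admD(1)[OF f]] compact_imp_closed[OF compact] U V by (auto intro: closed_Diff)
    moreover have "({x \<in> X. f x \<ge> e} - V) \<inter> (X - U) = {}"
      using admD(4)[OF f] e by fastforce
    ultimately obtain h :: "'a \<Rightarrow> real" where h: "continuous_on UNIV h" "\<And>x. h x \<in> closed_segment 1 0"
      "\<And>x. x \<in> {x \<in> X. f x \<ge> e} - V \<Longrightarrow> h x = 1" "\<And>x. x \<in> X - U \<Longrightarrow> h x = 0"
      using Urysohn by blast
    have h01: "0 \<le> h x" "h x \<le> 1" for x
      using h(2)[of x] by (auto simp: closed_segment_eq_real_ivl)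
    have ch: "continuous_on X h"
      using h(1) continuous_on_subset by blast
    have f1: "(\<lambda>x. f x * h x) \<in> adm U"
      unfolding adm_def
    proof (intro CollectI conjI ballI)
      show "continuous_on X (\<lambda>x. f x * h x)"
        by (intro continuous_intros ch admD(1)[OF f])
      fix x assume x: "x \<in> X"
      show "0 \<le> f x * h x" using admD(2)[OF f x] h01 by simp
      show "f x * h x \<le> indicator U x"
        using admD(2,3)[OF f x] h01[of x] h(4)[of x] x by (auto simp: indicator_def mult_le_one)
    qed
    have cf2: "continuous_on X (\<lambda>x. f x * (1 - h x))"
      by (intro continuous_intros ch admD(1)[OF f])
    have le1: "f x * (1 - h x) \<le> 1" if "x \<in> X" for x
      using admD(2,3)[OF f that] h01[of x] by (intro mult_le_one) auto
    have sub: "{x \<in> X. e \<le> f x * (1 - h x)} \<subseteq> V"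
    proof safe
      fix x assume x: "x \<in> X" "e \<le> f x * (1 - h x)"
      show "x \<in> V"
      proof (rule ccontr)
        assume "x \<notin> V"
        have "f x * (1 - h x) \<le> f x * 1"
          using admD(2)[OF f x(1)] h01[of x] by (intro mult_left_mono) auto
        then have "f x \<ge> e" using x(2) by simp
        then have "h x = 1" using h(3) x(1) \<open>x \<notin> V\<close> by blast
        then show False using x(2) e by simp
      qed
    qed
    note f2 = adm_cut[OF cf2 le1 e sub]
    have "\<Lambda> f = \<Lambda> (\<lambda>x. f x * h x + f x * (1 - h x))"
      by (simp add: algebra_simps)
    also have "\<dots> = \<Lambda> (\<lambda>x. f x * h x) + \<Lambda> (\<lambda>x. f x * (1 - h x))"
      by (rule add[OF admD(1)[OF f1] cf2])
    also have "\<dots> \<le> content U + (content V + e)"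
      using le_content[OF f1] le_content[OF f2(1)] f2(2) by simp
    finally show "\<Lambda> f \<le> content U + content V + e" by simp
  qed
qed

lemma content_UN_finite:
  fixes n :: nat
  assumes "\<And>i. open (U i)"
  shows "content (\<Union>i<n. U i) \<le> (\<Sum>i<n. content (U i))"
proof (induction n)
  case 0
  then show ?case by (simp add: content_null)
next
  case (Suc n)
  have "content (\<Union>i<Suc n. U i) = content ((\<Union>i<n. U i) \<union> U n)"
    by (simp add: lessThan_Suc Un_commute)
  also have "\<dots> \<le> content (\<Union>i<n. U i) + content (U n)"
    using assms by (intro content_Un) auto
  finally show ?case using Suc by simp
qed

text \<open>A nearly optimal \<open>f\<close> reaches \<open>e / 2\<close> only on a compact set,
  which finitely many of the \<open>U i\<close> cover; the cut function is then admissible for a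
  finite union.\<close>

lemma content_UN:
  fixes U :: "nat \<Rightarrow> 'a set"
  assumes U: "\<And>i. open (U i)"
  shows "ennreal (content (\<Union>i. U i)) \<le> (\<Sum>i. ennreal (content (U i)))"
proof (rule ennreal_le_epsilon)
  fix e :: real assume e: "0 < e"
  have "\<exists>f\<in>adm (\<Union>i. U i). content (\<Union>i. U i) - e / 2 < \<Lambda> f"
    using less_cSUP_iff[of "adm (\<Union>i. U i)" \<Lambda> "content (\<Union>i. U i) - e / 2", OF _ bdd_adm] zero_adm e
    unfolding content_def[symmetric] by auto
  then obtain f where f: "f \<in> adm (\<Union>i. U i)" "content (\<Union>i. U i) - e / 2 < \<Lambda> f"
    by blast
  have cK: "compact {x \<in> X. f x \<ge> e / 2}"
    using compact_Int_closed[OF compact closed_superlevel(1)[OF admD(1)[OF f(1)]], of "e / 2"]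
    by (simp add: Int_def conj_commute conj_left_commute)
  have sK: "{x \<in> X. f x \<ge> e / 2} \<subseteq> (\<Union>i\<in>UNIV. U i)"
    using admD(4)[OF f(1)] e by fastforce
  obtain I where I: "finite I" "{x \<in> X. f x \<ge> e / 2} \<subseteq> (\<Union>i\<in>I. U i)"
    by (rule compactE_image[OF cK _ sK]) (use U in auto)
  obtain n where n: "\<forall>i\<in>I. i < n"
    using I(1) unfolding finite_nat_set_iff_bounded by (rule exE)
  have sub: "{x \<in> X. f x \<ge> e / 2} \<subseteq> (\<Union>i<n. U i)"
    using I(2) n by blast
  note cut = adm_cut[OF admD(1,3)[OF f(1)] _ sub]
  have "content (\<Union>i. U i) \<le> content (\<Union>i<n. U i) + e"
    using f(2) cut(2) le_content[OF cut(1)] e by simp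
  also have "\<dots> \<le> (\<Sum>i<n. content (U i)) + e"
    using content_UN_finite[where n = n and U = U] U by simp
  finally have "ennreal (content (\<Union>i. U i)) \<le> ennreal ((\<Sum>i<n. content (U i)) + e)"
    by (rule ennreal_leI)
  also have "\<dots> = (\<Sum>i<n. ennreal (content (U i))) + ennreal e"
    using e by (simp add: ennreal_plus sum_nonneg content_nonneg sum_ennreal)
  also have "\<dots> \<le> (\<Sum>i. ennreal (content (U i))) + ennreal e"
    by (intro add_right_mono sum_le_suminf) auto
  finally show "ennreal (content (\<Union>i. U i)) \<le> (\<Sum>i. ennreal (content (U i))) + ennreal e" .
qed

lemma outer_le: "open U \<Longrightarrow> A \<subseteq> U \<Longrightarrow> outer A \<le> ennreal (content U)"
  unfolding outer_def by (intro INF_lower) auto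

lemma outer_open: "open U \<Longrightarrow> outer U = ennreal (content U)"
  by (rule antisym[OF outer_le]) (auto simp: outer_def intro!: INF_greatest ennreal_leI content_mono)

lemma outer_mono: "A \<subseteq> B \<Longrightarrow> outer A \<le> outer B"
  unfolding outer_def by (intro INF_superset_mono) auto

lemma outer_le_1: "outer A \<le> 1"
  using outer_le[of UNIV A] content_UNIV by simp

lemma outer_real: "\<exists>b\<ge>0. outer A = ennreal b"
  using outer_le_1[of A] by (cases "outer A") (auto simp: top_unique)

lemma outer_countable:
  fixes A :: "nat \<Rightarrow> 'a set"
  shows "outer (\<Union>i. A i) \<le> (\<Sum>i. outer (A i))"
proof (rule ennreal_le_epsilon)
  fix e :: real assume e: "0 < e"
  have ep: "0 < e * (1/2) ^ Suc i" for i using e by simp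
  have "\<exists>U. open U \<and> A i \<subseteq> U \<and> ennreal (content U) \<le> outer (A i) + ennreal (e * (1/2) ^ Suc i)" for i
  proof -
    obtain b where b: "b \<ge> 0" "outer (A i) = ennreal b"
      using outer_real by blast
    have "ennreal b < ennreal (b + e * (1/2) ^ Suc i)"
      using b(1) ep[of i] by (intro ennreal_lessI) auto
    then have "outer (A i) < outer (A i) + ennreal (e * (1/2) ^ Suc i)"
      unfolding b(2) using b(1) ep[of i] by (simp add: ennreal_plus)
    then show ?thesis
      unfolding outer_def[of "A i"] INF_less_iff by (auto intro: less_imp_le)
  qed
  from choice[OF allI[OF this]] obtain U where
    "\<forall>i. open (U i) \<and> A i \<subseteq> U i \<and> ennreal (content (U i)) \<le> outer (A i) + ennreal (e * (1/2) ^ Suc i)" ..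
  then have U: "open (U i)" "A i \<subseteq> U i"
    "ennreal (content (U i)) \<le> outer (A i) + ennreal (e * (1/2) ^ Suc i)" for i
    by auto
  have "outer (\<Union>i. A i) \<le> ennreal (content (\<Union>i. U i))"
    using U(1,2) by (intro outer_le) auto
  also have "\<dots> \<le> (\<Sum>i. ennreal (content (U i)))"
    by (rule content_UN[OF U(1)])
  also have "\<dots> \<le> (\<Sum>i. outer (A i) + ennreal (e * (1/2) ^ Suc i))"
    using U(3) by (intro suminf_le) auto
  also have "\<dots> = (\<Sum>i. outer (A i)) + (\<Sum>i. ennreal (e * (1/2) ^ Suc i))"
    by (rule suminf_add[symmetric]) auto
  also have "(\<Sum>i. ennreal (e * (1/2) ^ Suc i)) = ennreal e"
    using sums_mult[OF power_half_series, of e] ep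
    by (subst suminf_ennreal2) (auto simp: sums_iff less_imp_le)
  finally show "outer (\<Union>i. A i) \<le> (\<Sum>i. outer (A i)) + ennreal e" .
qed

lemma outer_Un: "outer (A \<union> B) \<le> outer A + outer B"
proof -
  have "outer (A \<union> B) \<le> outer (\<Union>i. binaryset A B i)"
    by (simp add: UN_binaryset_eq)
  also have "\<dots> \<le> (\<Sum>i. outer (binaryset A B i))"
    by (rule outer_countable)
  also have "\<dots> = outer A + outer B"
    using outer_open[of "{}"] content_null[of "{}"] by (subst suminf_binaryset_eq) auto
  finally show ?thesis .
qed

lemma outer_space: "outer_measure_space UNIV_sets outer" if "UNIV_sets = Pow (UNIV :: 'a set)"
  unfolding outer_measure_space_def positive_def increasing_def countably_subadditive_def
  using outer_open[of "{}"] content_null[of "{}"] outer_mono outer_countable by auto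

text \<open>A function \<open>f\<close> admissible for \<open>V \<inter> U\<close>, cut at height
  \<open>e\<close>, lives where \<open>f \<ge> e\<close>; one admissible for the rest of
  \<open>V\<close> vanishes there. Hence their sum is admissible for \<open>V\<close>.\<close>

lemma content_split:
  assumes U: "open U" and V: "open V"
  shows "outer (V \<inter> U) + outer (V - U) \<le> ennreal (content V)"
proof -
  have *: "\<Lambda> f + \<Lambda> h \<le> content V + e" if f: "f \<in> adm (V \<inter> U)" and e: "e > 0"
    and h: "h \<in> adm (V - {x \<in> X. f x \<ge> e})" for f h e
  proof -
    have sub: "{x \<in> X. f x \<ge> e} \<subseteq> V \<inter> U"
      using admD(4)[OF f] e by fastforce
    note cut = adm_cut[OF admD(1,3)[OF f] e sub]
    let ?g = "\<lambda>x. max 0 (f x - e) + h x"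
    have "?g \<in> adm V"
      unfolding adm_def
    proof (intro CollectI conjI ballI)
      show "continuous_on X ?g"
        by (intro continuous_on_add admD(1)[OF cut(1)] admD(1)[OF h])
      fix x assume x: "x \<in> X"
      show "0 \<le> ?g x" using admD(2)[OF h x] by simp
      show "?g x \<le> indicator V x"
      proof (cases "f x \<ge> e")
        case True
        then have "h x = 0" "x \<in> V" using admD(4)[OF h x] x sub by auto
        then show ?thesis using admD(3)[OF f x] e by simp
      next
        case False
        then show ?thesis using admD(3)[OF h x] admD(4)[OF h x] by (auto simp: indicator_def)
      qed
    qed
    then have "\<Lambda> ?g \<le> content V" by (rule le_content)
    then show ?thesis
      using add[OF admD(1)[OF cut(1)] admD(1)[OF h]] cut(2) by linarith
  qed
  obtain b where b: "outer (V - U) = ennreal b" "b \<ge> 0"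
    using outer_real by blast
  have "content (V \<inter> U) \<le> content V - b"
  proof (rule content_le)
    fix f assume f: "f \<in> adm (V \<inter> U)"
    show "\<Lambda> f \<le> content V - b"
    proof (rule field_le_epsilon)
      fix e :: real assume e: "e > 0"
      \<comment> \<open>An open set containing \<open>V - U\<close>, since \<open>f\<close> reaches
        \<open>e\<close> only inside \<open>U\<close>; its content therefore bounds \<open>b\<close>
        from above.\<close>
      let ?W = "V - {x \<in> X. f x \<ge> e}"
      have "{x \<in> X. f x \<ge> e} \<subseteq> V \<inter> U"
        using admD(4)[OF f] e by fastforce
      then have "ennreal b \<le> ennreal (content ?W)"
        unfolding b(1)[symmetric] using closed_superlevel(1)[OF admD(1)[OF f]] V by (intro outer_le) auto
      then have "b \<le> content ?W"
        using content_nonneg by simp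
      also have "content ?W \<le> content V + e - \<Lambda> f"
        by (rule content_le) (use *[OF f e] in \<open>simp add: algebra_simps\<close>)
      finally show "\<Lambda> f \<le> content V - b + e" by simp
    qed
  qed
  then have "ennreal (content (V \<inter> U) + b) \<le> ennreal (content V)"
    by (intro ennreal_leI) simp
  moreover have "outer (V \<inter> U) = ennreal (content (V \<inter> U))"
    using U V by (intro outer_open) auto
  ultimately show ?thesis
    using b content_nonneg by simp
qed

lemma open_measurable: "open U \<Longrightarrow> outer (A \<inter> U) + outer (A - U) \<le> outer A"
  unfolding outer_def[of A]
proof (rule INF_greatest)
  fix V assume "open U" "V \<in> {V. open V \<and> A \<subseteq> V}"
  then have "outer (A \<inter> U) + outer (A - U) \<le> outer (V \<inter> U) + outer (V - U)"
    by (intro add_mono outer_mono) auto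
  also have "\<dots> \<le> ennreal (content V)"
    using \<open>open U\<close> \<open>V \<in> _\<close> by (intro content_split) auto
  finally show "outer (A \<inter> U) + outer (A - U) \<le> ennreal (content V)" .
qed

section \<open>The Borel probability measure generated by the outer measure\<close>

definition riesz :: "'a measure" where
  "riesz = measure_of UNIV (sets borel) outer"

lemma sets_riesz [simp]: "sets riesz = sets borel" "space riesz = UNIV"
  unfolding riesz_def using sets.sigma_sets_eq[of "borel :: 'a measure"] by (auto simp: sets_measure_of_conv)

text \<open>Open sets satisfy the Caratheodory condition, and the sets satisfying it form a
  sigma-algebra on which the outer measure is a measure.\<close>

lemma emeasure_riesz: "A \<in> sets borel \<Longrightarrow> emeasure riesz A = outer A"
proof -
  assume A: "A \<in> sets borel"
  interpret P: sigma_algebra UNIV "Pow (UNIV :: 'a set)" by (rule sigma_algebra_Pow)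
  let ?L = "lambda_system UNIV (Pow UNIV) outer"
  have ms: "measure_space UNIV ?L outer"
    by (rule P.caratheodory_lemma[OF outer_space[OF refl]])
  then interpret L: sigma_algebra UNIV ?L by (simp add: measure_space_def)
  have L: "U \<in> ?L" if "open U" for U
    unfolding P.lambda_system_eq
    using open_measurable[OF that] outer_Un[of "x \<inter> U" "x - U" for x] by (auto intro!: antisym simp: Int_Diff_Un)
  have "sigma_sets UNIV {S. open S} \<subseteq> ?L"
    by (rule L.sigma_sets_subset) (use L in blast)
  moreover have "sets (borel :: 'a measure) = sigma_sets UNIV {S. open S}"
    unfolding borel_def by (rule sets_measure_of) simp
  ultimately have "sets borel \<subseteq> ?L" by blast
  then have "measure_space UNIV (sets borel) outer"
    using sets.sigma_algebra_axioms[of "borel :: 'a measure"] by (intro measure_down[OF ms]) auto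
  then show ?thesis
    unfolding riesz_def using A
    by (intro emeasure_measure_of_sigma) (auto simp: measure_space_def)
qed

lemma emeasure_riesz_open: "open U \<Longrightarrow> emeasure riesz U = ennreal (content U)"
  by (simp add: emeasure_riesz outer_open)

lemma prob_space_riesz: "prob_space riesz"
  by standard (simp add: emeasure_riesz_open content_UNIV)

lemma AE_riesz: "AE x in riesz. x \<in> X"
proof (rule AE_I[of _ _ "- X"])
  show "emeasure riesz (- X) = 0"
    using emeasure_riesz_open[OF open_Compl[OF compact_imp_closed[OF compact]]] content_null[of "- X"] by simp
qed (use compact_imp_closed[OF compact] in auto)

definition repr :: "'a measure" where
  "repr = restrict_space riesz X"

lemma X_sets: "X \<in> sets borel"
  using compact_imp_closed[OF compact] by auto

lemma sets_repr: "sets repr = sets (restrict_space borel X)" "space repr = X"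
  unfolding repr_def by (auto simp: sets_restrict_space space_restrict_space)

lemma prob_space_repr: "prob_space repr"
proof -
  interpret prob_space riesz by (rule prob_space_riesz)
  have "emeasure riesz X = 1"
    using AE_riesz X_sets emeasure_eq_1_AE[of X] by auto
  then show ?thesis
    unfolding repr_def using X_sets by (intro prob_spaceI) (simp add: emeasure_restrict_space space_restrict_space)
qed

lemma repr_measurable: "continuous_on X f \<Longrightarrow> f \<in> borel_measurable repr" for f :: "'a \<Rightarrow> real"
  using borel_measurable_continuous_on_restrict[of X f] measurable_cong_sets[OF sets_repr(1) refl] by blast

lemma repr_integrable:
  fixes f :: "'a \<Rightarrow> real"
  assumes f: "continuous_on X f"
  shows "integrable repr f"
proof -
  interpret prob_space repr by (rule prob_space_repr)
  obtain B where "\<And>x. x \<in> X \<Longrightarrow> norm (f x) \<le> B"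
    using compact_imp_bounded[OF compact_continuous_image[OF f compact]] unfolding bounded_iff by blast
  then show ?thesis
    using repr_measurable[OF f] by (intro integrable_const_bound[of _ B]) (auto simp: sets_repr)
qed

text \<open>\<open>n * f\<close> is cut into slices; the \<open>k\<close>-th is admissible for the
  set where \<open>n * f > k\<close>, hence bounded by its measure. The indicators of these sets add
  up to at most \<open>n * f + 1\<close>, and the error 1 disappears after division by
  \<open>n\<close>.\<close>

lemma le_integral:
  assumes f: "continuous_on X f" "\<And>x. x \<in> X \<Longrightarrow> 0 \<le> f x" "\<And>x. x \<in> X \<Longrightarrow> f x \<le> 1"
  shows "\<Lambda> f \<le> integral\<^sup>L repr f"
proof -
  interpret prob_space repr by (rule prob_space_repr)
  have "real n * \<Lambda> f \<le> real n * integral\<^sup>L repr f + 1" for n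
  proof -
    define t where "t k x = min (max (real n * f x - real k) 0) 1" for k x
    define U where "U k = - {x \<in> X. real n * f x \<le> real k}" for k
    have cn: "continuous_on X (\<lambda>x. real n * f x)"
      using f(1) by (intro continuous_intros)
    have ct: "continuous_on X (t k)" for k
      unfolding t_def using f(1) by (intro continuous_intros)
    have oU: "open (U k)" for k
      unfolding U_def using closed_superlevel(2)[OF cn] by auto
    have adm: "t k \<in> adm (U k)" for k
      using ct by (auto simp: adm_def t_def U_def indicator_def)
    have mU: "U k \<inter> X \<in> sets repr" for k
      using oU by (auto simp: sets_repr sets_restrict_space)
    have me: "content (U k) = measure repr (U k \<inter> X)" for k
    proof -
      have "emeasure repr (U k \<inter> X) = emeasure riesz (U k \<inter> X)"
        unfolding repr_def using X_sets by (intro emeasure_restrict_space) auto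
      also have "\<dots> = emeasure riesz (U k)"
        using AE_riesz oU X_sets by (intro emeasure_eq_AE) auto
      finally have "emeasure repr (U k \<inter> X) = ennreal (content (U k))"
        using emeasure_riesz_open[OF oU] by simp
      then show ?thesis by (simp add: measure_def content_nonneg)
    qed
    have "real n * \<Lambda> f = \<Lambda> (\<lambda>x. real n * f x)"
      using scale[OF f(1)] by simp
    also have "\<dots> \<le> \<Lambda> (\<lambda>x. \<Sum>k<n. t k x)"
    proof (intro mono cn continuous_on_sum ct)
      fix x assume x: "x \<in> X"
      have "real n * f x \<le> real n" using f(3)[OF x] by (simp add: mult_left_le)
      then show "real n * f x \<le> (\<Sum>k<n. t k x)"
        unfolding t_def using sum_clamp[of "real n * f x" n] f(2)[OF x] by simp
    qed
    also have "\<dots> = (\<Sum>k<n. \<Lambda> (t k))"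
      by (rule sum) (auto intro: ct)
    also have "\<dots> \<le> (\<Sum>k<n. measure repr (U k \<inter> X))"
      using le_content[OF adm] me by (intro sum_mono) auto
    also have "\<dots> = (\<Sum>k<n. integral\<^sup>L repr (indicator (U k \<inter> X)))"
      using mU sets.sets_into_space[OF mU] by (simp add: Int_absorb2)
    also have "\<dots> = (\<integral>x. (\<Sum>k<n. indicator (U k \<inter> X) x) \<partial>repr)"
      using mU by (subst Bochner_Integration.integral_sum) (auto simp: emeasure_eq_measure)
    also have "\<dots> \<le> (\<integral>x. real n * f x + 1 \<partial>repr)"
    proof (rule integral_mono)
      show "integrable repr (\<lambda>x. \<Sum>k<n. indicator (U k \<inter> X) x :: real)"
        using mU by (intro Bochner_Integration.integrable_sum) (auto simp: emeasure_eq_measure)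
      show "integrable repr (\<lambda>x. real n * f x + 1)"
        using repr_integrable[OF f(1)] by auto
      fix x assume "x \<in> space repr"
      then have x: "x \<in> X" by (simp add: sets_repr)
      \<comment> \<open>Where \<open>n * f x > k\<close>, the slice of \<open>n * f x + 1\<close> at
        level \<open>k\<close> is full; this is the source of the \<open>+ 1\<close>.\<close>
      have "(\<Sum>k<n. indicator (U k \<inter> X) x :: real) \<le> (\<Sum>k<n. min (max ((real n * f x + 1) - real k) 0) 1)"
        by (intro sum_mono) (auto simp: U_def indicator_def)
      also have "\<dots> \<le> real n * f x + 1"
        using f(2)[OF x] by (subst sum_clamp) auto
      finally show "(\<Sum>k<n. indicator (U k \<inter> X) x) \<le> real n * f x + 1" .
    qed
    also have "\<dots> = real n * integral\<^sup>L repr f + 1"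
      using repr_integrable[OF f(1)] prob_space by simp
    finally show ?thesis .
  qed
  then have "\<Lambda> f - integral\<^sup>L repr f \<le> 1 / real (Suc n)" for n
    using \<open>\<And>n. real n * \<Lambda> f \<le> real n * integral\<^sup>L repr f + 1\<close>[of "Suc n"] by (simp add: field_simps)
  then have "\<Lambda> f - integral\<^sup>L repr f \<le> 0"
    by (intro LIMSEQ_le_const[OF LIMSEQ_Suc[OF lim_1_over_n]]) auto
  then show ?thesis by simp
qed

text \<open>An affine rescaling brings \<open>f\<close> into the unit interval; the one-sided
  estimate for \<open>g\<close> and for \<open>1 - g\<close> together gives equality.\<close>

theorem integral_repr:
  assumes f: "continuous_on X f"
  shows "integral\<^sup>L repr f = \<Lambda> f"
proof -
  interpret prob_space repr by (rule prob_space_repr)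
  obtain B where B: "B > 0" "\<And>x. x \<in> X \<Longrightarrow> norm (f x) \<le> B"
    using compact_imp_bounded[OF compact_continuous_image[OF f compact]] unfolding bounded_pos by auto
  define g where "g x = (1 / (2 * B)) * (f x + B)" for x
  have g: "continuous_on X g" "\<And>x. x \<in> X \<Longrightarrow> 0 \<le> g x" "\<And>x. x \<in> X \<Longrightarrow> g x \<le> 1"
    using f B unfolding g_def by (auto intro!: continuous_intros simp: field_simps abs_le_iff) (smt (verit))+
  have "\<Lambda> g \<le> integral\<^sup>L repr g"
    by (rule le_integral[OF g])
  moreover have "\<Lambda> (\<lambda>x. 1 - g x) \<le> (\<integral>x. 1 - g x \<partial>repr)"
    using g by (intro le_integral continuous_intros) auto
  then have "1 - \<Lambda> g \<le> 1 - integral\<^sup>L repr g"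
    using diff[OF continuous_on_const g(1), of 1] const repr_integrable[OF g(1)] prob_space by simp
  ultimately have "\<Lambda> g = integral\<^sup>L repr g" by simp
  moreover have "\<Lambda> g = (1 / (2 * B)) * (\<Lambda> f + B)"
    unfolding g_def using f add[OF f continuous_on_const[of X B]] const by (subst scale) (auto intro!: continuous_intros)
  moreover have "integral\<^sup>L repr g = (1 / (2 * B)) * (integral\<^sup>L repr f + B)"
    unfolding g_def using repr_integrable[OF f] prob_space by simp
  ultimately show ?thesis using B(1) by simp
qed

end

section \<open>The Lagrangian\<close>

text \<open>A hyperplane separating the strict epigraph from the point of the graph cannot be
  vertical, because the epigraph projects onto the whole space; its slope is the
  subgradient.\<close>

lemma subdiff_nonempty:
  fixes f :: "real^'d \<Rightarrow> real"
  assumes f: "convex_on UNIV f" and c: "continuous_on UNIV f"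
  shows "subdiff f p \<noteq> {}"
proof -
  let ?E = "{z :: (real^'d) \<times> real. f (fst z) < snd z}"
  have "convex ?E"
  proof (rule convexI)
    fix y z :: "(real^'d) \<times> real" and u v :: real
    assume yz: "y \<in> ?E" "z \<in> ?E" and uv: "0 \<le> u" "0 \<le> v" "u + v = 1"
    have "f (u *\<^sub>R fst y + v *\<^sub>R fst z) \<le> u * f (fst y) + v * f (fst z)"
      using f uv unfolding convex_on_def by simp
    also have "\<dots> < u * snd y + v * snd z"
    proof (cases "u = 0")
      case True
      then show ?thesis using yz uv by simp
    next
      case False
      then have "u * f (fst y) < u * snd y"
        using yz uv by (intro mult_strict_left_mono) auto
      moreover have "v * f (fst z) \<le> v * snd z"
        using yz uv by (intro mult_left_mono) auto
      ultimately show ?thesis by linarith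
    qed
    finally show "u *\<^sub>R y + v *\<^sub>R z \<in> ?E" by simp
  qed
  moreover have "convex {(p, f p)}" by simp
  moreover have "?E \<noteq> {}"
  proof -
    have "(p, f p + 1) \<in> ?E" by simp
    then show ?thesis by blast
  qed
  moreover have "?E \<inter> {(p, f p)} = {}" by auto
  ultimately obtain a b where ab: "a \<noteq> 0" "\<forall>z\<in>?E. a \<bullet> z \<le> b" "\<forall>z\<in>{(p, f p)}. b \<le> a \<bullet> z"
    using separating_hyperplane_sets[of ?E "{(p, f p)}"] by auto
  obtain \<alpha> \<beta> where a: "a = (\<alpha>, \<beta>)" by (cases a)
  have le: "\<alpha> \<bullet> q + \<beta> * t \<le> \<alpha> \<bullet> p + \<beta> * f p" if "f q < t" for q t
    using ab(2,3) that by (auto simp: a intro: order_trans)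
  have "\<beta> \<le> 0"
    using le[of p "f p + 1"] by (simp add: algebra_simps)
  moreover have "\<beta> \<noteq> 0"
  proof
    assume b: "\<beta> = 0"
    have "\<alpha> \<bullet> \<alpha> \<le> 0"
      using le[of "p + \<alpha>" "f (p + \<alpha>) + 1"] by (simp add: b inner_add_right)
    then have "\<alpha> \<bullet> \<alpha> = 0"
      using inner_ge_zero[of \<alpha>] by linarith
    then have "\<alpha> = 0" by simp
    then show False using ab(1) a b by (simp add: zero_prod_def)
  qed
  ultimately have "\<beta> < 0" by simp
  define \<gamma> where "\<gamma> = - \<beta>"
  have \<gamma>: "\<gamma> > 0" "\<beta> = - \<gamma>" using \<open>\<beta> < 0\<close> by (auto simp: \<gamma>_def)
  have "f q \<ge> f p + ((1 / \<gamma>) *\<^sub>R \<alpha>) \<bullet> (q - p)" for q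
  proof (rule field_le_epsilon)
    fix e :: real assume "e > 0"
    then have "\<alpha> \<bullet> q + \<beta> * (f q + e) \<le> \<alpha> \<bullet> p + \<beta> * f p"
      by (intro le) simp
    then have "\<alpha> \<bullet> (q - p) \<le> (f q + e - f p) * \<gamma>"
      unfolding \<gamma>(2) by (simp add: inner_diff_right algebra_simps)
    then have "(\<alpha> \<bullet> (q - p)) / \<gamma> \<le> f q + e - f p"
      using \<gamma>(1) by (simp add: pos_divide_le_eq)
    then show "f p + ((1 / \<gamma>) *\<^sub>R \<alpha>) \<bullet> (q - p) \<le> f q + e"
      by simp
  qed
  then show ?thesis unfolding subdiff_def by blast
qed

locale hamiltonian =
  fixes H :: "real^'d \<Rightarrow> real^'d \<Rightarrow> real" and \<kappa> :: real and Q :: "(real^'d) set" and k :: nat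
  assumes H_periodic: "periodic H"
    and H_continuous: "continuous_on UNIV (\<lambda>(x, p). H x p)"
    and H_convex: "\<And>x. convex_on UNIV (H x)"
    and kappa: "\<kappa> > 0"
    and Q_compact: "compact Q"
    and Q_subdiff: "\<And>x p. p \<in> cball 0 \<kappa> \<Longrightarrow> subdiff (H x) p \<subseteq> Q"
    and k_large: "\<And>x p. p \<in> cball 0 \<kappa> \<Longrightarrow> H_tilde H k x p = H x p"
begin

abbreviation L :: "real^'d \<Rightarrow> real^'d \<Rightarrow> real" where
  "L \<equiv> lagrangian H k"

lemma cont_H: "continuous_on A (\<lambda>z. H (fst z) (snd z))"
  using continuous_on_subset[OF H_continuous, of A] by (simp add: case_prod_unfold)

lemma cont_H2: "continuous_on UNIV (H x)"
proof -
  have "continuous_on UNIV (\<lambda>p. (x, p))" by (intro continuous_intros)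
  from continuous_on_compose2[OF cont_H this] show ?thesis by auto
qed

lemma cont_Ht: "continuous_on A (\<lambda>z. H_tilde H k (fst z) (snd z))"
  unfolding H_tilde_def by (intro continuous_intros cont_H)

lemma Q_nonempty: "Q \<noteq> {}"
proof -
  have "subdiff (H 0) 0 \<noteq> {}"
    by (rule subdiff_nonempty[OF H_convex cont_H2])
  moreover have "subdiff (H 0) 0 \<subseteq> Q"
    using kappa by (intro Q_subdiff) simp
  ultimately show ?thesis by blast
qed

text \<open>The term \<open>(norm p)^2 - k\<close> makes \<open>H_tilde\<close> superlinear, so
  large momenta lose against 0. One radius serves all \<open>x\<close> near \<open>x0\<close> and
  all \<open>\<xi>\<close> in a ball, as needed for continuity of \<open>L\<close>.\<close>

lemma bound_L:
  obtains P where "P > 0" "\<And>x \<xi> p. norm (x - x0) \<le> 1 \<Longrightarrow> norm \<xi> \<le> r \<Longrightarrow> norm p > P \<Longrightarrow>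
    p \<bullet> \<xi> - H_tilde H k x p \<le> 0 \<bullet> \<xi> - H_tilde H k x 0"
proof -
  have "continuous_on (cball x0 1) (\<lambda>x. (x, 0 :: real^'d))" by (intro continuous_intros)
  then have "continuous_on (cball x0 1) (\<lambda>x. H_tilde H k x 0)"
    using continuous_on_compose2[OF cont_Ht[of UNIV], of "cball x0 1" "\<lambda>x. (x, 0)"] by simp
  then have "compact ((\<lambda>x. H_tilde H k x 0) ` cball x0 1)"
    by (rule compact_continuous_image[OF _ compact_cball])
  from compact_imp_bounded[OF this] obtain m where
    m: "\<forall>y\<in>(\<lambda>x. H_tilde H k x 0) ` cball x0 1. norm y \<le> m" unfolding bounded_iff ..
  \<comment> \<open>For \<open>norm p > P\<close> this gives \<open>norm p * (\<bar>r\<bar> + k +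
    \<bar>m\<bar>) \<le> (norm p)^2\<close>; the summand 1 ensures
    \<open>norm p \<ge> 1\<close>.\<close>
  define P where "P = \<bar>r\<bar> + real k + \<bar>m\<bar> + 1"
  have "p \<bullet> \<xi> - H_tilde H k x p \<le> 0 \<bullet> \<xi> - H_tilde H k x 0"
    if a: "norm (x - x0) \<le> 1" "norm \<xi> \<le> r" "norm p > P" for x \<xi> p
  proof -
    have m': "H_tilde H k x 0 \<le> \<bar>m\<bar>"
    proof -
      have "H_tilde H k x 0 \<in> (\<lambda>x. H_tilde H k x 0) ` cball x0 1"
        using a(1) by (intro imageI) (simp add: dist_norm norm_minus_commute)
      then have "norm (H_tilde H k x 0) \<le> m" using m by (rule bspec[rotated])
      then show ?thesis by simp
    qed
    have "p \<bullet> \<xi> \<le> norm p * \<bar>r\<bar>"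
    proof -
      have "norm \<xi> \<le> \<bar>r\<bar>" using a(2) by linarith
      from mult_left_mono[OF this norm_ge_zero[of p]] show ?thesis
        using norm_cauchy_schwarz[of p \<xi>] by linarith
    qed
    moreover have "(norm p)\<^sup>2 - real k \<le> H_tilde H k x p"
      by (simp add: H_tilde_def)
    moreover have "norm p * \<bar>r\<bar> + (real k + \<bar>m\<bar>) \<le> norm p * norm p"
    proof -
      have "norm p \<ge> 1" using a(3) by (simp add: P_def)
      then have "real k + \<bar>m\<bar> \<le> norm p * (real k + \<bar>m\<bar>)"
        using mult_right_mono[of 1 "norm p" "real k + \<bar>m\<bar>"] by simp
      then have "norm p * \<bar>r\<bar> + (real k + \<bar>m\<bar>) \<le> norm p * (\<bar>r\<bar> + real k + \<bar>m\<bar>)"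
        by (simp add: algebra_simps)
      also have "\<dots> \<le> norm p * norm p"
        using a(3) by (intro mult_left_mono) (auto simp: P_def)
      finally show ?thesis .
    qed
    ultimately show ?thesis
      using m' by (simp add: power2_eq_square)
  qed
  moreover have "P > 0" by (simp add: P_def add_nonneg_pos)
  ultimately show ?thesis using that by blast
qed

lemma L_max:
  obtains p where "L x \<xi> = p \<bullet> \<xi> - H_tilde H k x p" "\<And>q. q \<bullet> \<xi> - H_tilde H k x q \<le> L x \<xi>"
proof -
  obtain P where P: "P > 0" "\<And>y \<eta> p. norm (y - x) \<le> 1 \<Longrightarrow> norm \<eta> \<le> norm \<xi> \<Longrightarrow> norm p > P \<Longrightarrow>
    p \<bullet> \<eta> - H_tilde H k y p \<le> 0 \<bullet> \<eta> - H_tilde H k y 0"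
    using bound_L[of x "norm \<xi>"] by metis
  have "continuous_on (cball 0 P) (\<lambda>p. (x, p))" by (intro continuous_intros)
  then have "continuous_on (cball 0 P) (\<lambda>p. H_tilde H k x p)"
    using continuous_on_compose2[OF cont_Ht[of UNIV], of "cball 0 P" "\<lambda>p. (x, p)"] by simp
  then have "continuous_on (cball 0 P) (\<lambda>p. p \<bullet> \<xi> - H_tilde H k x p)"
    by (intro continuous_intros)
  moreover have "cball (0::real^'d) P \<noteq> {}" using P(1) by simp
  ultimately have "\<exists>p\<in>cball 0 P. \<forall>q\<in>cball 0 P. q \<bullet> \<xi> - H_tilde H k x q \<le> p \<bullet> \<xi> - H_tilde H k x p"
    by (intro continuous_attains_sup compact_cball)
  then obtain p where p: "p \<in> cball 0 P" "\<forall>q\<in>cball 0 P. q \<bullet> \<xi> - H_tilde H k x q \<le> p \<bullet> \<xi> - H_tilde H k x p"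
    by (rule bexE)
  have all: "q \<bullet> \<xi> - H_tilde H k x q \<le> p \<bullet> \<xi> - H_tilde H k x p" for q
  proof (cases "norm q \<le> P")
    case True
    then show ?thesis using p(2) by simp
  next
    case False
    then have "q \<bullet> \<xi> - H_tilde H k x q \<le> 0 \<bullet> \<xi> - H_tilde H k x 0"
      by (intro P(2)) auto
    also have "\<dots> \<le> p \<bullet> \<xi> - H_tilde H k x p"
      using p(2)[rule_format, of 0] P(1) by simp
    finally show ?thesis .
  qed
  then have "L x \<xi> = p \<bullet> \<xi> - H_tilde H k x p"
    unfolding lagrangian_def by (intro cSup_eq_maximum) auto
  then show ?thesis using all that[of p] by simp
qed

lemma L_ge: "q \<bullet> \<xi> - H_tilde H k x q \<le> L x \<xi>"
  by (rule L_max[of x \<xi>]) blast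

lemma L_periodic: "lattice_equiv x y \<Longrightarrow> L x \<xi> = L y \<xi>"
  using periodicD[OF H_periodic, of x y] by (simp add: lagrangian_def H_tilde_def)

text \<open>Near any point the supremum runs over one fixed ball of momenta, and on the compact
  product the integrand \<open>?f\<close> is uniformly continuous; a maximiser at one point is then
  almost optimal at a neighbouring one.\<close>

lemma L_continuous: "continuous_on UNIV (\<lambda>z. L (fst z) (snd z))"
  unfolding continuous_on_eq_continuous_at[OF open_UNIV]
proof
  fix z0 :: "(real^'d) \<times> (real^'d)"
  obtain x0 \<xi>0 where z0: "z0 = (x0, \<xi>0)" by (cases z0)
  obtain P where P: "P > 0" "\<And>x \<xi> p. norm (x - x0) \<le> 1 \<Longrightarrow> norm \<xi> \<le> norm \<xi>0 + 1 \<Longrightarrow> norm p > P \<Longrightarrow>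
    p \<bullet> \<xi> - H_tilde H k x p \<le> 0 \<bullet> \<xi> - H_tilde H k x 0"
    using bound_L[of x0 "norm \<xi>0 + 1"] by metis
  let ?f = "\<lambda>w :: ((real^'d) \<times> (real^'d)) \<times> (real^'d). snd w \<bullet> snd (fst w) - H_tilde H k (fst (fst w)) (snd w)"
  let ?C = "cball z0 1 \<times> cball (0::real^'d) P"
  have "continuous_on ?C (\<lambda>w. (fst (fst w), snd w))" by (intro continuous_intros)
  then have "continuous_on ?C (\<lambda>w. H_tilde H k (fst (fst w)) (snd w))"
    using continuous_on_compose2[OF cont_Ht[of UNIV], of ?C "\<lambda>w. (fst (fst w), snd w)"] by simp
  then have "continuous_on ?C ?f" by (intro continuous_intros)
  then have uc: "uniformly_continuous_on ?C ?f"
    by (intro compact_uniformly_continuous compact_Times compact_cball)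
  have near: "norm (fst z - x0) \<le> 1" "norm (snd z) \<le> norm \<xi>0 + 1" if "z \<in> cball z0 1" for z
  proof -
    have d: "dist z z0 \<le> 1" using that by (simp add: dist_commute)
    show "norm (fst z - x0) \<le> 1"
      using dist_fst_le[of z z0] d by (simp add: z0 dist_norm)
    have "norm (snd z - \<xi>0) \<le> 1"
      using dist_snd_le[of z z0] d by (simp add: z0 dist_norm)
    then show "norm (snd z) \<le> norm \<xi>0 + 1"
      using norm_triangle_sub[of "snd z" \<xi>0] by linarith
  qed
  have att: "\<exists>p\<in>cball 0 P. L (fst z) (snd z) = ?f (z, p)" if "z \<in> cball z0 1" for z
  proof -
    obtain p where p: "L (fst z) (snd z) = p \<bullet> snd z - H_tilde H k (fst z) p" by (rule L_max)
    show ?thesis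
    proof (cases "norm p \<le> P")
      case True
      then show ?thesis using p by (intro bexI[of _ p]) auto
    next
      case False
      then have "L (fst z) (snd z) \<le> 0 \<bullet> snd z - H_tilde H k (fst z) 0"
        unfolding p by (intro P(2) near[OF that]) auto
      then have "L (fst z) (snd z) = ?f (z, 0)"
        using L_ge[of 0 "snd z" "fst z"] by simp
      then show ?thesis using P(1) by (intro bexI[of _ 0]) auto
    qed
  qed
  show "isCont (\<lambda>z. L (fst z) (snd z)) z0"
    unfolding continuous_at_eps_delta
  proof (intro allI impI)
    fix e :: real assume e: "e > 0"
    from uc[unfolded uniformly_continuous_on_def, rule_format, OF e]
    obtain d where dd: "d > 0 \<and> (\<forall>v\<in>?C. \<forall>w\<in>?C. dist w v < d \<longrightarrow> dist (?f w) (?f v) < e)" by (rule exE)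
    have d: "d > 0" "v \<in> ?C \<Longrightarrow> w \<in> ?C \<Longrightarrow> dist w v < d \<Longrightarrow> dist (?f w) (?f v) < e" for v w
      by (rule dd[THEN conjunct1]) (rule dd[THEN conjunct2, rule_format])
    have one: "L (fst y) (snd y) - L (fst z) (snd z) < e"
      if yz: "y \<in> cball z0 1" "z \<in> cball z0 1" "dist y z < d" for y z
    proof -
      obtain p where p: "p \<in> cball 0 P" "L (fst y) (snd y) = ?f (y, p)"
        using att[OF yz(1)] by (rule bexE)
      have "dist (?f (y, p)) (?f (z, p)) < e"
        using d(2)[of "(z, p)" "(y, p)"] p(1) yz by (simp add: dist_Pair_Pair)
      moreover have "?f (z, p) \<le> L (fst z) (snd z)"
        using L_ge[of p "snd z" "fst z"] by simp
      ultimately show ?thesis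
        unfolding p(2) dist_norm real_norm_def by linarith
    qed
    have "dist (L (fst z) (snd z)) (L (fst z0) (snd z0)) < e" if "dist z z0 < min d 1" for z
    proof -
      have "z \<in> cball z0 1" "z0 \<in> cball z0 1" "dist z z0 < d" "dist z0 z < d"
        using that by (auto simp: dist_commute)
      then show ?thesis
        using one[of z z0] one[of z0 z] by (simp add: dist_norm abs_less_iff)
    qed
    then show "\<exists>d>0. \<forall>x'. dist x' z0 < d \<longrightarrow> dist (L (fst x') (snd x')) (L (fst z0) (snd z0)) < e"
      using d(1) by (intro exI[of _ "min d 1"]) auto
  qed
qed

lemma L_C_K: "L \<in> C_K Q"
  by (rule C_KI[OF continuous_on_subset[OF L_continuous] L_periodic]) auto

lemma H_of_L_le: "H_of Q L x p \<le> H_tilde H k x p"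
  using L_ge[of p] by (intro H_of_le[OF L_C_K Q_compact Q_nonempty]) (simp add: algebra_simps)

text \<open>A subgradient of \<open>H x\<close> at \<open>p\<close> attains the supremum in the
  biconjugate, and it lies in \<open>Q\<close> because \<open>norm p \<le> \<kappa>\<close>;
  restricting the supremum to \<open>Q\<close> loses nothing.\<close>

lemma H_of_L:
  assumes p: "norm p \<le> \<kappa>"
  shows "H_of Q L x p = H x p"
proof (rule antisym)
  have pc: "p \<in> cball 0 \<kappa>" using p by simp
  show "H_of Q L x p \<le> H x p"
    using H_of_L_le[of x p] k_large[OF pc, of x] by simp
  obtain \<xi> where \<xi>: "\<xi> \<in> subdiff (H x) p"
    using subdiff_nonempty[OF H_convex cont_H2, of x p] by blast
  then have "\<xi> \<in> Q" using Q_subdiff[OF pc] by blast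
  obtain q where q: "L x \<xi> = q \<bullet> \<xi> - H_tilde H k x q" by (rule L_max)
  \<comment> \<open>The subgradient belongs to \<open>H\<close>, whereas \<open>L\<close> is the
    conjugate of \<open>H_tilde\<close>; this inequality carries the convexity bound over.\<close>
  have "H x q \<le> H_tilde H k x q" by (simp add: H_tilde_def)
  moreover have "H x q \<ge> H x p + \<xi> \<bullet> (q - p)"
    using \<xi> by (simp add: subdiff_def)
  ultimately have "H x p \<le> p \<bullet> \<xi> - L x \<xi>"
    unfolding q by (simp add: inner_diff_right inner_commute)
  also have "\<dots> \<le> H_of Q L x p"
    by (rule H_of_ge[OF L_C_K Q_compact \<open>\<xi> \<in> Q\<close>])
  finally show "H x p \<le> H_of Q L x p" .
qed

end

section \<open>Limits of functionals and measures on the torus\<close>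

text \<open>The limit superior, written as the infimum \<open>p\<close> of the eventual upper
  bounds, is sublinear, and any linear minorant of it respects every bound that holds
  eventually.\<close>

lemma limit_functional:
  fixes \<Lambda> :: "nat \<Rightarrow> ('b \<Rightarrow> real) \<Rightarrow> real"
  assumes V: "function_space V" and ne: "V \<noteq> {}"
    and lin: "\<And>n. linear_functional_on V (\<Lambda> n)"
    and bdd: "\<And>f. f \<in> V \<Longrightarrow> \<exists>B. \<forall>n. \<bar>\<Lambda> n f\<bar> \<le> B"
  obtains \<Lambda>0 where "linear_functional_on V \<Lambda>0"
    "\<And>f t. f \<in> V \<Longrightarrow> (\<forall>\<^sub>F n in sequentially. \<Lambda> n f \<le> t) \<Longrightarrow> \<Lambda>0 f \<le> t"
proof -
  define P where "P f = {t. \<forall>\<^sub>F n in sequentially. \<Lambda> n f \<le> t}" for f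
  have neP: "P f \<noteq> {}" if f: "f \<in> V" for f
  proof -
    obtain B where "\<forall>n. \<bar>\<Lambda> n f\<bar> \<le> B" using bdd[OF f] ..
    then have "B \<in> P f" by (auto simp: P_def abs_le_iff)
    then show ?thesis by blast
  qed
  have bb: "bdd_below (P f)" if f: "f \<in> V" for f
  proof -
    obtain B where B: "\<forall>n. \<bar>\<Lambda> n f\<bar> \<le> B" using bdd[OF f] ..
    show ?thesis
    proof (rule bdd_belowI)
      fix t assume "t \<in> P f"
      then have "\<forall>\<^sub>F n in sequentially. \<Lambda> n f \<le> t" by (simp add: P_def)
      then obtain n where "\<Lambda> n f \<le> t"
        using eventually_happens'[OF sequentially_bot] by blast
      moreover have "\<bar>\<Lambda> n f\<bar> \<le> B" using B by blast
      ultimately show "- B \<le> t" by linarith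
    qed
  qed
  define p where "p f = Inf (P f)" for f
  have sub: "sublinear_on V p"
    unfolding sublinear_on_def
  proof (intro conjI ballI allI impI)
    fix f g assume f: "f \<in> V" and g: "g \<in> V"
    have "p (\<lambda>x. f x + g x) \<le> a + b" if "a \<in> P f" "b \<in> P g" for a b
    proof -
      have "\<forall>\<^sub>F n in sequentially. \<Lambda> n f \<le> a" "\<forall>\<^sub>F n in sequentially. \<Lambda> n g \<le> b"
        using that by (simp_all add: P_def)
      then have "\<forall>\<^sub>F n in sequentially. \<Lambda> n (\<lambda>x. f x + g x) \<le> a + b"
      proof eventually_elim
        case (elim n)
        have "\<Lambda> n (\<lambda>x. f x + g x) = \<Lambda> n f + \<Lambda> n g"
          using lin[of n] f g unfolding linear_functional_on_def by simp
        then show ?case using elim by simp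
      qed
      then show ?thesis
        unfolding p_def by (intro cInf_lower bb function_spaceD(1)[OF V f g]) (simp add: P_def)
    qed
    then show "p (\<lambda>x. f x + g x) \<le> p f + p g"
      unfolding p_def[of f] p_def[of g] by (intro Inf_add_ge neP f g) auto
  next
    fix f and c :: real assume f: "f \<in> V" and c: "c > 0"
    have "p (\<lambda>x. c * f x) / c \<le> a" if a: "a \<in> P f" for a
    proof -
      have "\<forall>\<^sub>F n in sequentially. \<Lambda> n f \<le> a" using a by (simp add: P_def)
      then have "\<forall>\<^sub>F n in sequentially. \<Lambda> n (\<lambda>x. c * f x) \<le> c * a"
      proof eventually_elim
        case (elim n)
        have "\<Lambda> n (\<lambda>x. c * f x) = c * \<Lambda> n f"
          using lin[of n] f unfolding linear_functional_on_def by simp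
        then show ?case using elim c by simp
      qed
      then have "p (\<lambda>x. c * f x) \<le> c * a"
        unfolding p_def by (intro cInf_lower bb function_spaceD(2)[OF V f]) (simp add: P_def)
      then show ?thesis using c by (simp add: pos_divide_le_eq mult.commute)
    qed
    then have "p (\<lambda>x. c * f x) / c \<le> p f"
      unfolding p_def[of f] by (intro cInf_greatest neP f) auto
    then show "p (\<lambda>x. c * f x) \<le> c * p f"
      using c by (simp add: pos_divide_le_eq mult.commute)
  qed
  obtain f0 where f0: "f0 \<in> V" using ne by blast
  obtain \<Lambda>0 where \<Lambda>0: "linear_functional_on V \<Lambda>0" "\<And>f. f \<in> V \<Longrightarrow> \<Lambda>0 f \<le> p f" "\<Lambda>0 f0 = p f0"
    by (rule sublinear_minorant_linear[OF V sub f0]) (rule that)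
  have "\<Lambda>0 f \<le> t" if f: "f \<in> V" and t: "\<forall>\<^sub>F n in sequentially. \<Lambda> n f \<le> t" for f t
  proof -
    have "p f \<le> t"
      unfolding p_def using t by (intro cInf_lower bb f) (simp add: P_def)
    then show ?thesis using \<Lambda>0(2)[OF f] by linarith
  qed
  then show ?thesis using \<Lambda>0(1) that by blast
qed

section \<open>Functions and measures on the quotient torus\<close>

lemma continuous_abs_torus: "continuous_on UNIV (abs_torus :: real^'d \<Rightarrow> 'd torus)"
  using continuous_on_open_vimage[OF open_UNIV, of "abs_torus :: real^'d \<Rightarrow> 'd torus"]
  by (simp add: open_torus_def)

text \<open>The saturation of \<open>U\<close> is the union of its lattice translates.\<close>

lemma open_image_abs_torus:
  assumes "open U"
  shows "open (abs_torus ` U)"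
proof -
  have "abs_torus -` (abs_torus ` U) = (\<Union>l\<in>{l. lattice_equiv l 0}. (\<lambda>x. l + x) ` U)"
  proof (intro equalityI subsetI)
    fix y assume "y \<in> abs_torus -` (abs_torus ` U)"
    then obtain x where x: "x \<in> U" "abs_torus y = abs_torus x" by auto
    then have "lattice_equiv y x" by (simp add: torus.abs_eq_iff)
    then have "lattice_equiv (y - x) 0" by (simp add: lattice_equiv_def)
    moreover have "y = (y - x) + x" by simp
    ultimately show "y \<in> (\<Union>l\<in>{l. lattice_equiv l 0}. (\<lambda>x. l + x) ` U)"
      using x(1) by blast
  next
    fix y assume "y \<in> (\<Union>l\<in>{l. lattice_equiv l 0}. (\<lambda>x. l + x) ` U)"
    then obtain l x where lx: "lattice_equiv l 0" "x \<in> U" "y = l + x" by auto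
    then have "lattice_equiv y x" by (simp add: lattice_equiv_def)
    then have "abs_torus y = abs_torus x" by (simp add: torus.abs_eq_iff)
    then show "y \<in> abs_torus -` (abs_torus ` U)" using lx(2) by simp
  qed
  moreover have "open \<dots>"
    by (intro open_UN ballI open_translation assms)
  ultimately show ?thesis by (simp add: open_torus_def)
qed

lemma abs_rep_torus [simp]: "abs_torus (rep_torus a) = a"
  by (rule Quotient3_abs_rep[OF Quotient3_torus])

lemma C_K_rep_abs:
  assumes "\<phi> \<in> C_K Q" "\<xi> \<in> Q"
  shows "\<phi> (rep_torus (abs_torus x)) \<xi> = \<phi> x \<xi>"
proof -
  have "periodic (\<lambda>x. \<phi> x \<xi>)" using assms by (simp add: C_K_def)
  from periodic_rep_abs[OF this] show ?thesis .
qed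

text \<open>\<open>rep_torus\<close> only picks representatives and offers no continuity; the
  composition is continuous because \<open>\<phi>\<close> does not depend on the representative and
  the quotient map is open.\<close>

lemma C_K_torus_continuous:
  fixes \<phi> :: "real^'d \<Rightarrow> real^'d \<Rightarrow> real"
  assumes \<phi>: "\<phi> \<in> C_K Q"
  shows "continuous_on (UNIV \<times> Q) (\<lambda>b. \<phi> (rep_torus (fst b)) (snd b))"
  unfolding continuous_on_open_invariant
proof (intro allI impI)
  fix B :: "real set" assume "open B"
  then obtain A where A: "open A" "A \<inter> (UNIV \<times> Q) = (\<lambda>p. \<phi> (fst p) (snd p)) -` B \<inter> (UNIV \<times> Q)"
    using C_K_continuous(1)[OF \<phi>, of UNIV] unfolding continuous_on_open_invariant by blast
  let ?T = "\<lambda>p :: (real^'d) \<times> (real^'d). (abs_torus (fst p), snd p)"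
  have "open (?T ` A)"
    unfolding open_prod_def
  proof (intro ballI)
    fix b assume "b \<in> ?T ` A"
    then obtain x \<xi> where x: "(x, \<xi>) \<in> A" "b = (abs_torus x, \<xi>)" by auto
    obtain U W where U: "open U" "open W" "(x, \<xi>) \<in> U \<times> W" "U \<times> W \<subseteq> A"
      by (rule open_prod_elim[OF A(1) x(1)])
    have "open (abs_torus ` U)" "b \<in> (abs_torus ` U) \<times> W" "(abs_torus ` U) \<times> W \<subseteq> ?T ` A"
      using U x(2) open_image_abs_torus by (auto simp: image_iff) force
    then show "\<exists>U W. open U \<and> open W \<and> b \<in> U \<times> W \<and> U \<times> W \<subseteq> ?T ` A"
      using U(2) by blast
  qed
  moreover have "?T ` A \<inter> (UNIV \<times> Q) = (\<lambda>b. \<phi> (rep_torus (fst b)) (snd b)) -` B \<inter> (UNIV \<times> Q)"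
  proof (intro equalityI subsetI)
    fix b assume "b \<in> ?T ` A \<inter> (UNIV \<times> Q)"
    then obtain x \<xi> where x: "(x, \<xi>) \<in> A" "b = (abs_torus x, \<xi>)" "\<xi> \<in> Q" by auto
    then have "(x, \<xi>) \<in> A \<inter> (UNIV \<times> Q)" by simp
    then have "\<phi> x \<xi> \<in> B" unfolding A(2) by simp
    then show "b \<in> (\<lambda>b. \<phi> (rep_torus (fst b)) (snd b)) -` B \<inter> (UNIV \<times> Q)"
      using x C_K_rep_abs[OF \<phi> x(3)] by simp
  next
    fix b assume b: "b \<in> (\<lambda>b. \<phi> (rep_torus (fst b)) (snd b)) -` B \<inter> (UNIV \<times> Q)"
    then have "(rep_torus (fst b), snd b) \<in> (\<lambda>p. \<phi> (fst p) (snd p)) -` B \<inter> (UNIV \<times> Q)" by auto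
    then have "(rep_torus (fst b), snd b) \<in> A" unfolding A(2)[symmetric] by simp
    then have "?T (rep_torus (fst b), snd b) \<in> ?T ` A" by (rule imageI)
    then show "b \<in> ?T ` A \<inter> (UNIV \<times> Q)" using b by auto
  qed
  ultimately show "\<exists>A. open A \<and> A \<inter> (UNIV \<times> Q) = (\<lambda>b. \<phi> (rep_torus (fst b)) (snd b)) -` B \<inter> (UNIV \<times> Q)"
    by blast
qed

lemma C_K_bounded:
  assumes \<phi>: "\<phi> \<in> C_K Q" and Q: "compact Q"
  obtains B where "\<And>x \<xi>. \<xi> \<in> Q \<Longrightarrow> \<bar>\<phi> x \<xi>\<bar> \<le> B"
proof -
  have "compact ((\<lambda>p. \<phi> (fst p) (snd p)) ` (cube 0 \<times> Q))"
    by (intro compact_continuous_image C_K_continuous(1)[OF \<phi>] compact_Times compact_cube Q)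
  from compact_imp_bounded[OF this] obtain B where
    B: "\<forall>y\<in>(\<lambda>p. \<phi> (fst p) (snd p)) ` (cube 0 \<times> Q). norm y \<le> B" unfolding bounded_iff ..
  have "\<bar>\<phi> x \<xi>\<bar> \<le> B" if \<xi>: "\<xi> \<in> Q" for x \<xi>
  proof -
    obtain y where y: "y \<in> cube 0" "lattice_equiv x y" using lattice_equiv_cube_ex by blast
    have "\<phi> y \<xi> \<in> (\<lambda>p. \<phi> (fst p) (snd p)) ` (cube 0 \<times> Q)"
      by (rule image_eqI[of _ _ "(y, \<xi>)"]) (use y \<xi> in auto)
    from bspec[OF B this] show ?thesis
      using C_K_continuous(4)[OF \<phi> \<xi> y(2)] by simp
  qed
  then show ?thesis using that by blast
qed

lemma integral_K_alt: "integral_K \<mu> f = (\<integral>b. f (rep_torus (fst b)) (snd b) \<partial>\<mu>)"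
  by (simp add: integral_K_def case_prod_unfold)

lemma K_integrable:
  fixes \<mu> :: "('d::finite torus \<times> (real^'d)) measure"
  assumes \<mu>: "prob_space \<mu>" "sets \<mu> = sets (restrict_space borel (UNIV \<times> Q))"
    and \<phi>: "\<phi> \<in> C_K Q" and Q: "compact Q"
  shows "integrable \<mu> (\<lambda>b. \<phi> (rep_torus (fst b)) (snd b))"
proof -
  interpret prob_space \<mu> by (rule \<mu>(1))
  have sp: "space \<mu> = UNIV \<times> Q"
    using sets_eq_imp_space_eq[OF \<mu>(2)] by (simp add: space_restrict_space)
  obtain B where B: "\<And>x \<xi>. \<xi> \<in> Q \<Longrightarrow> \<bar>\<phi> x \<xi>\<bar> \<le> B" using C_K_bounded[OF \<phi> Q] by metis
  have "(\<lambda>b. \<phi> (rep_torus (fst b)) (snd b)) \<in> borel_measurable (restrict_space borel (UNIV \<times> Q))"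
    by (rule borel_measurable_continuous_on_restrict[OF C_K_torus_continuous[OF \<phi>]])
  then have "(\<lambda>b. \<phi> (rep_torus (fst b)) (snd b)) \<in> borel_measurable \<mu>"
    using measurable_cong_sets[OF \<mu>(2) refl] by blast
  then show ?thesis
    by (intro integrable_const_bound[of _ B]) (auto simp: sp intro!: B)
qed

lemma integral_K_add:
  fixes \<mu> :: "('d::finite torus \<times> (real^'d)) measure"
  assumes \<mu>: "prob_space \<mu>" "sets \<mu> = sets (restrict_space borel (UNIV \<times> Q))"
    and \<phi>: "\<phi> \<in> C_K Q" and \<psi>: "\<psi> \<in> C_K Q" and Q: "compact Q"
  shows "integral_K \<mu> (\<lambda>x \<xi>. \<phi> x \<xi> + c * \<psi> x \<xi>) = integral_K \<mu> \<phi> + c * integral_K \<mu> \<psi>"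
  unfolding integral_K_alt
  using K_integrable[OF \<mu> \<phi> Q] K_integrable[OF \<mu> \<psi> Q] by simp

text \<open>\<open>\<Lambda>\<close> acts on all continuous functions on the Euclidean compact set,
  also on those that differ on equivalent faces. The measure found there is pushed forward by the
  quotient map, which leaves integrals of functions in \<open>C_K Q\<close> unchanged.\<close>

lemma measure_of_functional:
  fixes \<Lambda> :: "((real^'d) \<times> (real^'d) \<Rightarrow> real) \<Rightarrow> real"
  assumes Q: "compact Q"
    and lin: "linear_functional_on {f. continuous_on (cube 0 \<times> Q) f} \<Lambda>"
    and upper: "\<And>f t. continuous_on (cube 0 \<times> Q) f \<Longrightarrow> (\<And>y. y \<in> cube 0 \<times> Q \<Longrightarrow> f y \<le> t) \<Longrightarrow> \<Lambda> f \<le> t"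
  obtains \<mu> :: "('d torus \<times> (real^'d)) measure" where "prob_space \<mu>"
    "sets \<mu> = sets (restrict_space borel (UNIV \<times> Q))"
    "\<And>\<phi>. \<phi> \<in> C_K Q \<Longrightarrow> integral_K \<mu> \<phi> = \<Lambda> (\<lambda>y. \<phi> (fst y) (snd y))"
proof -
  let ?X = "cube 0 \<times> Q :: ((real^'d) \<times> (real^'d)) set"
  interpret R: positive_functional ?X \<Lambda>
  proof
    show "compact ?X" by (intro compact_Times compact_cube Q)
  qed (use lin upper in \<open>auto simp: linear_functional_on_def\<close>)
  interpret prob_space R.repr by (rule R.prob_space_repr)
  let ?T = "\<lambda>p :: (real^'d) \<times> (real^'d). (abs_torus (fst p), snd p)"
  have "continuous_on UNIV ?T"
    by (intro continuous_on_Pair continuous_on_compose2[OF continuous_abs_torus] continuous_on_fst continuous_on_snd continuous_on_id) auto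
  then have "?T \<in> borel_measurable borel"
    by (rule borel_measurable_continuous_onI)
  then have "?T \<in> borel_measurable (restrict_space borel ?X)"
    by (rule measurable_restrict_space1)
  then have "?T \<in> borel_measurable R.repr"
    using measurable_cong_sets[OF R.sets_repr(1) refl] by blast
  then have T: "?T \<in> measurable R.repr (restrict_space borel (UNIV \<times> Q))"
    by (intro measurable_restrict_space2) (auto simp: R.sets_repr(2))
  define \<mu> where "\<mu> = distr R.repr (restrict_space borel (UNIV \<times> Q)) ?T"
  have "prob_space \<mu>" unfolding \<mu>_def by (rule prob_space_distr[OF T])
  moreover have "sets \<mu> = sets (restrict_space borel (UNIV \<times> Q))" by (simp add: \<mu>_def)
  moreover have "integral_K \<mu> \<phi> = \<Lambda> (\<lambda>y. \<phi> (fst y) (snd y))" if \<phi>: "\<phi> \<in> C_K Q" for \<phi>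
  proof -
    have "integral_K \<mu> \<phi> = (\<integral>y. \<phi> (rep_torus (fst (?T y))) (snd (?T y)) \<partial>R.repr)"
      unfolding integral_K_alt \<mu>_def
      by (rule integral_distr[OF T borel_measurable_continuous_on_restrict[OF C_K_torus_continuous[OF \<phi>]]])
    also have "\<dots> = (\<integral>y. \<phi> (fst y) (snd y) \<partial>R.repr)"
      by (rule Bochner_Integration.integral_cong[OF refl]) (auto simp: R.sets_repr(2) C_K_rep_abs[OF \<phi>])
    also have "\<dots> = \<Lambda> (\<lambda>y. \<phi> (fst y) (snd y))"
      by (rule R.integral_repr[OF C_K_continuous(1)[OF \<phi>]])
    finally show ?thesis .
  qed
  ultimately show ?thesis using that by blast
qed

context levy_jump
begin

text \<open>The trivial competitor in the infimum defining the sublinear functional below; it yields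
  the bound by the maximum of \<open>f\<close>.\<close>

lemma zero_subsolution:
  assumes Q: "compact Q" "Q \<noteq> {}"
  shows "visc_subsolution \<nu> j \<delta> (H_of Q (\<lambda>x \<xi>. 0)) (\<lambda>x. 0)"
  unfolding visc_subsolution_iff
proof
  show "(\<lambda>x. 0) \<in> C_torus" by (rule C_torus_const)
  show "vsub \<nu> j (\<lambda>x p. \<delta> * 0 + H_of Q (\<lambda>x \<xi>. 0) x p) (\<lambda>x. 0)"
    unfolding vsub_def
  proof (intro ballI allI impI)
    fix \<phi> :: "real^'d \<Rightarrow> real" and x assume \<phi>: "\<phi> \<in> C2_torus" and max: "\<forall>y. 0 - \<phi> y \<le> 0 - \<phi> x"
    have g: "grad \<phi> x = 0"
      by (rule GDERIV_zero_at_min[OF C2_torus_gradD(6)[OF \<phi>]]) (use max in simp)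
    have "H_of Q (\<lambda>x \<xi>. 0) x 0 \<le> 0"
      by (rule H_of_le[OF C_K_C_torus[OF C_torus_const] Q]) simp
    moreover have "0 \<le> nonlocal_op \<nu> j \<phi> x"
      unfolding nonlocal_op_eq g using max by (intro Bochner_Integration.integral_nonneg) (simp add: incr_def)
    ultimately show "\<delta> * 0 + H_of Q (\<lambda>x \<xi>. 0) x (grad \<phi> x) \<le> nonlocal_op \<nu> j \<phi> x"
      unfolding g by simp
  qed
qed

end

section \<open>The vanishing discount limit\<close>

lemma integral_K_mono:
  fixes \<mu> :: "('d::finite torus \<times> (real^'d)) measure"
  assumes \<mu>: "prob_space \<mu>" "sets \<mu> = sets (restrict_space borel (UNIV \<times> Q))"
    and \<phi>: "\<phi> \<in> C_K Q" and \<psi>: "\<psi> \<in> C_K Q" and Q: "compact Q" and le: "\<And>x \<xi>. \<phi> x \<xi> \<le> \<psi> x \<xi>"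
  shows "integral_K \<mu> \<phi> \<le> integral_K \<mu> \<psi>"
  unfolding integral_K_alt
  by (rule integral_mono[OF K_integrable[OF \<mu> \<phi> Q] K_integrable[OF \<mu> \<psi> Q]]) (rule le)

locale vanishing_discount = levy_jump \<nu> j + hamiltonian H \<kappa> Q k
  for \<nu> :: "(real^'d) measure" and j and H :: "real^'d \<Rightarrow> real^'d \<Rightarrow> real" and \<kappa> Q k +
  fixes u :: "real \<Rightarrow> real^'d \<Rightarrow> real"
  assumes EX0: "\<exists>v. visc_solution \<nu> j 0 H v"
    and LB: "\<And>\<delta> v. 0 \<le> \<delta> \<Longrightarrow> \<delta> < 1 \<Longrightarrow> visc_solution \<nu> j \<delta> H v \<Longrightarrow> gradient_bound \<kappa> v"
    and u_solution: "\<And>\<delta>. 0 < \<delta> \<Longrightarrow> \<delta> < 1 \<Longrightarrow> visc_solution \<nu> j \<delta> H (u \<delta>)"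
begin

lemma solutionD:
  assumes \<delta>: "0 \<le> \<delta>" "\<delta> < 1" and v: "visc_solution \<nu> j \<delta> H v"
  shows "v \<in> C_torus" "\<And>x y. \<bar>v x - v y\<bar> \<le> \<kappa> * norm (x - y)"
    "vsub \<nu> j (\<lambda>x p. \<delta> * v x + H x p) v" "vsub \<nu> j (\<lambda>x p. - (\<delta> * v x + H x (- p))) (\<lambda>x. - v x)"
    "vsub \<nu> j (\<lambda>x p. \<delta> * v x + H_of Q L x p) v"
    "vsub \<nu> j (\<lambda>x p. - (\<delta> * v x + H_of Q L x (- p))) (\<lambda>x. - v x)"
proof -
  show C: "v \<in> C_torus" and s: "vsub \<nu> j (\<lambda>x p. \<delta> * v x + H x p) v"
    and S: "vsub \<nu> j (\<lambda>x p. - (\<delta> * v x + H x (- p))) (\<lambda>x. - v x)"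
    using v unfolding visc_solution_def visc_subsolution_iff visc_supersolution_iff by blast+
  show Lip: "\<bar>v x - v y\<bar> \<le> \<kappa> * norm (x - y)" for x y
    by (rule gradient_bound_imp_Lipschitz[OF LB[OF \<delta> v]])
  show "vsub \<nu> j (\<lambda>x p. \<delta> * v x + H_of Q L x p) v"
    by (rule vsub_Lipschitz[OF s Lip]) (simp add: H_of_L)
  have Lip': "\<bar>- v x - - v y\<bar> \<le> \<kappa> * norm (x - y)" for x y
    using Lip[of x y] by simp
  show "vsub \<nu> j (\<lambda>x p. - (\<delta> * v x + H_of Q L x (- p))) (\<lambda>x. - v x)"
    by (rule vsub_Lipschitz[OF S Lip']) (simp add: H_of_L)
qed

lemma continuous_scaled: "v \<in> C_torus \<Longrightarrow> continuous_on UNIV (\<lambda>x. c * v x)"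
  by (intro continuous_on_mult_left C_torusD(2))

lemma subsolution_le_u:
  assumes \<delta>: "0 < \<delta>" "\<delta> < 1" and \<psi>: "\<psi> \<in> C_torus" "vsub \<nu> j (\<lambda>x p. \<delta> * \<psi> x + H_of Q L x p) \<psi>"
  shows "\<psi> x \<le> u \<delta> x"
proof -
  note U = solutionD[OF less_imp_le[OF \<delta>(1)] \<delta>(2) u_solution[OF \<delta>]]
  obtain y where y: "\<And>z. \<psi> z - u \<delta> z \<le> \<psi> y - u \<delta> y"
    by (rule C_torus_attains_max[OF C_torus_diff[OF \<psi>(1) U(1)], of 0]) (rule that)
  have "\<delta> * \<psi> y \<le> \<delta> * u \<delta> y"
    by (rule comparison_at_max[OF Q_compact Q_nonempty L_C_K \<psi>(1) U(1) continuous_scaled[OF \<psi>(1)] continuous_scaled[OF U(1)] \<psi>(2) U(6) y])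
  then have "\<psi> y \<le> u \<delta> y" using \<delta>(1) by simp
  then show ?thesis using y[of x] by simp
qed

text \<open>An undiscounted solution \<open>w0\<close> serves as a barrier: at a maximum of
  \<open>u \<delta> - w0\<close> comparison gives \<open>u \<delta> \<le> 0\<close>, at a maximum of
  \<open>w0 - u \<delta>\<close> the opposite sign. The oscillation of \<open>w0\<close> then bounds
  \<open>u \<delta>\<close> uniformly.\<close>

lemma u_bounded:
  obtains B where "B > 0" "\<And>\<delta> x. 0 < \<delta> \<Longrightarrow> \<delta> < 1 \<Longrightarrow> \<bar>u \<delta> x\<bar> \<le> B"
proof -
  obtain w0 where w0: "visc_solution \<nu> j 0 H w0" using EX0 by (rule exE)
  note W = solutionD[OF order_refl zero_less_one w0]
  obtain B where B: "B > 0" "\<And>x. \<bar>w0 x\<bar> \<le> B" by (rule C_torus_bounded[OF W(1)]) (rule that)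
  have "\<bar>u \<delta> x\<bar> \<le> 2 * B" if \<delta>: "0 < \<delta>" "\<delta> < 1" for \<delta> x
  proof -
    note U = solutionD[OF less_imp_le[OF \<delta>(1)] \<delta>(2) u_solution[OF \<delta>]]
    obtain y where y: "\<And>z. u \<delta> z - w0 z \<le> u \<delta> y - w0 y"
      by (rule C_torus_attains_max[OF C_torus_diff[OF U(1) W(1)], of 0]) (rule that)
    have "\<delta> * u \<delta> y \<le> 0 * w0 y"
      by (rule comparison_at_max[OF Q_compact Q_nonempty L_C_K U(1) W(1) continuous_scaled[OF U(1)] continuous_scaled[OF W(1)] U(5) W(6) y])
    then have 1: "u \<delta> y \<le> 0" using \<delta>(1) by (simp add: mult_le_0_iff)
    obtain y' where y': "\<And>z. w0 z - u \<delta> z \<le> w0 y' - u \<delta> y'"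
      by (rule C_torus_attains_max[OF C_torus_diff[OF W(1) U(1)], of 0]) (rule that)
    have "0 * w0 y' \<le> \<delta> * u \<delta> y'"
      by (rule comparison_at_max[OF Q_compact Q_nonempty L_C_K W(1) U(1) continuous_scaled[OF W(1)] continuous_scaled[OF U(1)] W(5) U(6) y'])
    then have 2: "0 \<le> u \<delta> y'" using \<delta>(1) by (simp add: zero_le_mult_iff)
    show ?thesis
      using 1 2 y[of x] y'[of x] B(2)[of x] B(2)[of y] B(2)[of y'] unfolding abs_le_iff by linarith
  qed
  then show ?thesis using B(1) that[of "2 * B"] by simp
qed

abbreviation X :: "((real^'d) \<times> (real^'d)) set" where
  "X \<equiv> cube 0 \<times> Q"

abbreviation V :: "((real^'d) \<times> (real^'d) \<Rightarrow> real) set" where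
  "V \<equiv> {f. continuous_on X f}"

abbreviation ext :: "(real^'d \<Rightarrow> real^'d \<Rightarrow> real) \<Rightarrow> (real^'d) \<times> (real^'d) \<Rightarrow> real" where
  "ext \<phi> \<equiv> (\<lambda>y. \<phi> (fst y) (snd y))"

lemma function_space_V: "function_space V"
  unfolding function_space_def by (auto intro!: continuous_intros)

lemma ext_V: "\<phi> \<in> C_K Q \<Longrightarrow> ext \<phi> \<in> V"
  using C_K_continuous(1) by blast

lemma V_bounded:
  assumes "f \<in> V"
  obtains B where "\<And>y. y \<in> X \<Longrightarrow> \<bar>f y\<bar> \<le> B"
proof -
  have "compact (f ` X)"
    using assms by (intro compact_continuous_image compact_Times compact_cube Q_compact) auto
  from compact_imp_bounded[OF this] obtain B where B: "\<forall>y\<in>f ` X. norm y \<le> B" unfolding bounded_iff ..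
  have "\<bar>f y\<bar> \<le> B" if "y \<in> X" for y
    using bspec[OF B imageI[OF that]] by simp
  then show ?thesis by (rule that)
qed

text \<open>
  The sublinear functional \<open>f \<mapsto> inf {t. f + \<phi> - \<delta> \<psi> z \<le> t on K}\<close>, taken over all \<open>\<phi>\<close> and subsolutions
  \<open>\<psi>\<close> of the discounted equation for \<open>H_of Q \<phi>\<close>, is finite, and by comparison its value at \<open>-L\<close> is at
  least \<open>- \<delta> u\<^sub>\<delta>(z)\<close>.
\<close>

lemma discounted_functional:
  assumes \<delta>: "0 < \<delta>" "\<delta> < 1"
  shows "\<exists>\<Lambda>. linear_functional_on V \<Lambda> \<and> (\<forall>f t. f \<in> V \<longrightarrow> (\<forall>y\<in>X. f y \<le> t) \<longrightarrow> \<Lambda> f \<le> t) \<and>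
    \<Lambda> (ext L) \<le> \<delta> * u \<delta> z \<and>
    (\<forall>\<phi> \<psi>. \<phi> \<in> C_K Q \<longrightarrow> visc_subsolution \<nu> j \<delta> (H_of Q \<phi>) \<psi> \<longrightarrow> \<delta> * \<psi> z \<le> \<Lambda> (ext \<phi>))"
proof -
  define G where "G = {(\<phi>, \<psi>). \<phi> \<in> C_K Q \<and> visc_subsolution \<nu> j \<delta> (H_of Q \<phi>) \<psi>}"
  define P where "P f = {t. \<exists>\<phi> \<psi>. (\<phi>, \<psi>) \<in> G \<and> (\<forall>y\<in>X. f y + ext \<phi> y - \<delta> * \<psi> z \<le> t)}" for f
  have G0: "(\<lambda>x \<xi>. 0, \<lambda>x. 0) \<in> G"
    unfolding G_def using C_K_C_torus[OF C_torus_const[of 0]] zero_subsolution[OF Q_compact Q_nonempty] by simp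
  have Pt: "t \<in> P f" if "\<And>y. y \<in> X \<Longrightarrow> f y \<le> t" for f t
    unfolding P_def using G0 that by (intro CollectI exI conjI) auto
  have neP: "P f \<noteq> {}" if f: "f \<in> V" for f
  proof -
    obtain B where "\<And>y. y \<in> X \<Longrightarrow> \<bar>f y\<bar> \<le> B" by (rule V_bounded[OF f]) (rule that)
    then have "B \<in> P f" by (intro Pt) (simp add: abs_le_iff)
    then show ?thesis by (rule ex_in_conv[THEN iffD1, OF exI])
  qed
  \<comment> \<open>The subsolution is tested with a constant at its maximum \<open>y\<close>, which
    gives \<open>\<phi> y \<xi> \<ge> \<delta> * \<psi> y \<ge> \<delta> * \<psi> z\<close>. Lower
    bounds of \<open>f\<close> therefore bound \<open>P f\<close>.\<close>
  have lower: "m \<le> t" if t: "t \<in> P f" and m: "\<And>y. y \<in> X \<Longrightarrow> m \<le> f y" for f t m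
  proof -
    obtain \<phi> \<psi> where \<phi>: "\<phi> \<in> C_K Q" and \<psi>: "visc_subsolution \<nu> j \<delta> (H_of Q \<phi>) \<psi>"
      and le: "\<forall>y\<in>X. f y + ext \<phi> y - \<delta> * \<psi> z \<le> t"
      using t unfolding P_def G_def by blast
    have \<psi>C: "\<psi> \<in> C_torus" and \<psi>s: "vsub \<nu> j (\<lambda>x p. \<delta> * \<psi> x + H_of Q \<phi> x p) \<psi>"
      using \<psi> unfolding visc_subsolution_iff by auto
    obtain y where y: "y \<in> cube 0" "\<And>x. \<psi> x \<le> \<psi> y"
      by (rule C_torus_attains_max[OF \<psi>C, of 0]) (rule that)
    have "\<delta> * \<psi> y + H_of Q \<phi> y (grad (\<lambda>x. 0) y) \<le> nonlocal_op \<nu> j (\<lambda>x. 0) y"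
      by (rule vsubD[OF \<psi>s C2_torus_const(1)]) (use y(2) in simp)
    then have 1: "\<delta> * \<psi> y + H_of Q \<phi> y 0 \<le> 0"
      by (simp add: nonlocal_op_const C2_torus_const(2))
    obtain \<xi> where \<xi>: "\<xi> \<in> Q" using Q_nonempty by blast
    have "0 \<bullet> \<xi> - \<phi> y \<xi> \<le> H_of Q \<phi> y 0"
      by (rule H_of_ge[OF \<phi> Q_compact \<xi>])
    moreover have "f (y, \<xi>) + \<phi> y \<xi> - \<delta> * \<psi> z \<le> t" "m \<le> f (y, \<xi>)"
      using le m y(1) \<xi> by auto
    moreover have "\<delta> * \<psi> z \<le> \<delta> * \<psi> y"
      using y(2) \<delta>(1) by (intro mult_left_mono) auto
    ultimately show ?thesis using 1 by simp
  qed
  have bb: "bdd_below (P f)" if f: "f \<in> V" for f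
  proof -
    obtain B where B: "\<And>y. y \<in> X \<Longrightarrow> \<bar>f y\<bar> \<le> B" by (rule V_bounded[OF f]) (rule that)
    show ?thesis
    proof (rule bdd_belowI)
      fix t assume "t \<in> P f"
      then show "- B \<le> t" by (rule lower) (use B in \<open>fastforce simp: abs_le_iff\<close>)
    qed
  qed
  define p where "p f = Inf (P f)" for f
  have ple: "p f \<le> t" if "f \<in> V" "t \<in> P f" for f t
    unfolding p_def using that by (intro cInf_lower bb)
  have sub: "sublinear_on V p"
    unfolding sublinear_on_def
  proof (intro conjI ballI allI impI)
    fix f g assume f: "f \<in> V" and g: "g \<in> V"
    have "p (\<lambda>x. f x + g x) \<le> a + b" if ab: "a \<in> P f" "b \<in> P g" for a b
    proof (rule ple[OF function_spaceD(1)[OF function_space_V f g]])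
      obtain \<phi>1 \<psi>1 where 1: "\<phi>1 \<in> C_K Q" "visc_subsolution \<nu> j \<delta> (H_of Q \<phi>1) \<psi>1"
        "\<forall>y\<in>X. f y + ext \<phi>1 y - \<delta> * \<psi>1 z \<le> a"
        using ab(1) unfolding P_def G_def by blast
      obtain \<phi>2 \<psi>2 where 2: "\<phi>2 \<in> C_K Q" "visc_subsolution \<nu> j \<delta> (H_of Q \<phi>2) \<psi>2"
        "\<forall>y\<in>X. g y + ext \<phi>2 y - \<delta> * \<psi>2 z \<le> b"
        using ab(2) unfolding P_def G_def by blast
      have "(\<lambda>x \<xi>. \<phi>1 x \<xi> + \<phi>2 x \<xi>, \<lambda>x. \<psi>1 x + \<psi>2 x) \<in> G"
        unfolding G_def using C_K_add[OF 1(1) 2(1)] subsolution_add[OF Q_compact Q_nonempty 1(1) 2(1) 1(2) 2(2)] by simp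
      moreover have "\<forall>y\<in>X. (f y + g y) + ext (\<lambda>x \<xi>. \<phi>1 x \<xi> + \<phi>2 x \<xi>) y - \<delta> * (\<psi>1 z + \<psi>2 z) \<le> a + b"
      proof
        fix y assume y: "y \<in> X"
        show "(f y + g y) + ext (\<lambda>x \<xi>. \<phi>1 x \<xi> + \<phi>2 x \<xi>) y - \<delta> * (\<psi>1 z + \<psi>2 z) \<le> a + b"
          using bspec[OF 1(3) y] bspec[OF 2(3) y] by (simp add: distrib_left)
      qed
      ultimately show "a + b \<in> P (\<lambda>x. f x + g x)"
        unfolding P_def by (intro CollectI exI conjI)
    qed
    then show "p (\<lambda>x. f x + g x) \<le> p f + p g"
      unfolding p_def[of f] p_def[of g] by (intro Inf_add_ge neP f g) auto
  next
    fix f and c :: real assume f: "f \<in> V" and c: "c > 0"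
    have "p (\<lambda>x. c * f x) / c \<le> a" if a: "a \<in> P f" for a
    proof -
      obtain \<phi> \<psi> where 1: "\<phi> \<in> C_K Q" "visc_subsolution \<nu> j \<delta> (H_of Q \<phi>) \<psi>"
        "\<forall>y\<in>X. f y + ext \<phi> y - \<delta> * \<psi> z \<le> a"
        using a unfolding P_def G_def by blast
      have "(\<lambda>x \<xi>. c * \<phi> x \<xi>, \<lambda>x. c * \<psi> x) \<in> G"
        unfolding G_def using C_K_cmult[OF 1(1)] subsolution_scale[OF Q_compact Q_nonempty 1(1) c 1(2)] by simp
      moreover have "\<forall>y\<in>X. c * f y + ext (\<lambda>x \<xi>. c * \<phi> x \<xi>) y - \<delta> * (c * \<psi> z) \<le> c * a"
      proof
        fix y assume y: "y \<in> X"
        have "c * (f y + ext \<phi> y - \<delta> * \<psi> z) \<le> c * a"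
          using bspec[OF 1(3) y] c by (intro mult_left_mono) auto
        then show "c * f y + ext (\<lambda>x \<xi>. c * \<phi> x \<xi>) y - \<delta> * (c * \<psi> z) \<le> c * a"
          by (simp add: algebra_simps)
      qed
      ultimately have "c * a \<in> P (\<lambda>x. c * f x)"
        unfolding P_def by (intro CollectI exI conjI)
      from ple[OF function_spaceD(2)[OF function_space_V f] this] show ?thesis
        using c by (simp add: pos_divide_le_eq mult.commute)
    qed
    then have "p (\<lambda>x. c * f x) / c \<le> p f"
      unfolding p_def[of f] by (intro cInf_greatest neP f) auto
    then show "p (\<lambda>x. c * f x) \<le> c * p f"
      using c by (simp add: pos_divide_le_eq mult.commute)
  qed
  \<comment> \<open>The linear minorant is chosen exact at \<open>- L\<close>, the one function
    where the value of \<open>p\<close> has to be attained.\<close>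
  have mL: "(\<lambda>y. - ext L y) \<in> V"
    by (rule function_spaceD(3)[OF function_space_V ext_V[OF L_C_K]])
  obtain \<Lambda> where \<Lambda>: "linear_functional_on V \<Lambda>" "\<And>f. f \<in> V \<Longrightarrow> \<Lambda> f \<le> p f" "\<Lambda> (\<lambda>y. - ext L y) = p (\<lambda>y. - ext L y)"
    by (rule sublinear_minorant_linear[OF function_space_V sub mL]) (rule that)
  have neg: "\<Lambda> (\<lambda>y. - f y) = - \<Lambda> f" if "f \<in> V" for f
  proof -
    have "\<Lambda> (\<lambda>y. (-1) * f y) = (-1) * \<Lambda> f"
      using \<Lambda>(1) that unfolding linear_functional_on_def by blast
    then show ?thesis by simp
  qed
  have "- (\<delta> * u \<delta> z) \<le> t" if t: "t \<in> P (\<lambda>y. - ext L y)" for t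
  proof -
    obtain \<phi> \<psi> where \<phi>: "\<phi> \<in> C_K Q" and \<psi>: "visc_subsolution \<nu> j \<delta> (H_of Q \<phi>) \<psi>"
      and le: "\<forall>y\<in>X. - ext L y + ext \<phi> y - \<delta> * \<psi> z \<le> t"
      using t unfolding P_def G_def by blast
    have \<psi>C: "\<psi> \<in> C_torus" and \<psi>s: "vsub \<nu> j (\<lambda>x p. \<delta> * \<psi> x + H_of Q \<phi> x p) \<psi>"
      using \<psi> unfolding visc_subsolution_iff by auto
    \<comment> \<open>Adding \<open>c\<close> converts the bound of \<open>\<phi>\<close> by
      \<open>L + (t + \<delta> * \<psi> z)\<close> into a discounted subsolution for
      \<open>L\<close>.\<close>
    define c where "c = - t / \<delta> - \<psi> z"
    have dc: "\<delta> * c = - t - \<delta> * \<psi> z" using \<delta>(1) by (simp add: c_def right_diff_distrib)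
    have le': "\<phi> x \<xi> \<le> L x \<xi> + (t + \<delta> * \<psi> z)" if \<xi>: "\<xi> \<in> Q" for x \<xi>
    proof -
      obtain y where y: "y \<in> cube 0" "lattice_equiv x y" using lattice_equiv_cube_ex by blast
      have "(y, \<xi>) \<in> X" using y(1) \<xi> by simp
      from bspec[OF le this] show ?thesis
        using C_K_continuous(4)[OF \<phi> \<xi> y(2)] C_K_continuous(4)[OF L_C_K \<xi> y(2)] by simp
    qed
    have "vsub \<nu> j (\<lambda>x p. \<delta> * (\<psi> x + c) + H_of Q L x p) (\<lambda>x. \<psi> x + c)"
    proof (rule vsub_shift[OF \<psi>s])
      fix x p
      have "H_of Q L x p \<le> H_of Q \<phi> x p + (t + \<delta> * \<psi> z)"
      proof (rule H_of_le[OF L_C_K Q_compact Q_nonempty])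
        fix \<xi> assume \<xi>: "\<xi> \<in> Q"
        show "p \<bullet> \<xi> - L x \<xi> \<le> H_of Q \<phi> x p + (t + \<delta> * \<psi> z)"
          using H_of_ge[OF \<phi> Q_compact \<xi>, of p x] le'[OF \<xi>, of x] by linarith
      qed
      then show "\<delta> * (\<psi> x + c) + H_of Q L x p \<le> \<delta> * \<psi> x + H_of Q \<phi> x p"
        using dc by (simp add: distrib_left)
    qed
    then have "\<psi> z + c \<le> u \<delta> z"
      by (rule subsolution_le_u[OF \<delta> C_torus_add[OF \<psi>C C_torus_const]])
    then have "\<delta> * (\<psi> z + c) \<le> \<delta> * u \<delta> z"
      using \<delta>(1) by (intro mult_left_mono) auto
    then show ?thesis using dc by (simp add: distrib_left)
  qed
  then have "- (\<delta> * u \<delta> z) \<le> p (\<lambda>y. - ext L y)"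
    unfolding p_def by (intro cInf_greatest neP mL)
  then have 1: "\<Lambda> (ext L) \<le> \<delta> * u \<delta> z"
    using \<Lambda>(3) neg[OF ext_V[OF L_C_K]] by simp
  have 2: "\<delta> * \<psi> z \<le> \<Lambda> (ext \<phi>)" if \<phi>: "\<phi> \<in> C_K Q" and \<psi>: "visc_subsolution \<nu> j \<delta> (H_of Q \<phi>) \<psi>" for \<phi> \<psi>
  proof -
    \<comment> \<open>The pair of \<open>\<phi>\<close> and \<open>\<psi>\<close> itself is the
      witness, with equality.\<close>
    have "- (\<delta> * \<psi> z) \<in> P (\<lambda>y. - ext \<phi> y)"
      unfolding P_def G_def using \<phi> \<psi> by (intro CollectI exI[of _ \<phi>] exI[of _ \<psi>]) simp
    then have "p (\<lambda>y. - ext \<phi> y) \<le> - (\<delta> * \<psi> z)"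
      by (rule ple[OF function_spaceD(3)[OF function_space_V ext_V[OF \<phi>]]])
    then show ?thesis
      using \<Lambda>(2)[OF function_spaceD(3)[OF function_space_V ext_V[OF \<phi>]]] neg[OF ext_V[OF \<phi>]] by linarith
  qed
  have 3: "\<Lambda> f \<le> t" if "f \<in> V" "\<forall>y\<in>X. f y \<le> t" for f t
    using \<Lambda>(2)[OF that(1)] ple[OF that(1) Pt[OF bspec[OF that(2)]]] by linarith
  show ?thesis by (intro exI[of _ \<Lambda>] conjI allI impI \<Lambda>(1) 1 2 3)
qed

text \<open>The discount term is paid for by the cost: adding \<open>\<delta> * \<psi>\<close> to
  \<open>\<phi>\<close> lowers the Hamiltonian by the same amount. Undiscounted subsolutions thus
  become available to the discounted functionals.\<close>

lemma subsolution_discount: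
  assumes \<phi>: "\<phi> \<in> C_K Q" and \<psi>: "visc_subsolution \<nu> j 0 (H_of Q \<phi>) \<psi>"
  shows "(\<lambda>x \<xi>. \<phi> x \<xi> + \<delta> * \<psi> x) \<in> C_K Q"
    "visc_subsolution \<nu> j \<delta> (H_of Q (\<lambda>x \<xi>. \<phi> x \<xi> + \<delta> * \<psi> x)) \<psi>"
proof -
  have \<psi>C: "\<psi> \<in> C_torus" and \<psi>s: "vsub \<nu> j (\<lambda>x p. 0 * \<psi> x + H_of Q \<phi> x p) \<psi>"
    using \<psi> unfolding visc_subsolution_iff by auto
  show C: "(\<lambda>x \<xi>. \<phi> x \<xi> + \<delta> * \<psi> x) \<in> C_K Q"
    by (rule C_K_add[OF \<phi> C_K_C_torus[OF C_torus_cmult[OF \<psi>C]]])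
  have "vsub \<nu> j (\<lambda>x p. \<delta> * \<psi> x + H_of Q (\<lambda>x \<xi>. \<phi> x \<xi> + \<delta> * \<psi> x) x p) (\<lambda>x. \<psi> x + 0)"
  proof (rule vsub_shift[OF \<psi>s])
    fix x p
    have "H_of Q (\<lambda>x \<xi>. \<phi> x \<xi> + \<delta> * \<psi> x) x p \<le> H_of Q \<phi> x p - \<delta> * \<psi> x"
    proof (rule H_of_le[OF C Q_compact Q_nonempty])
      fix \<xi> assume \<xi>: "\<xi> \<in> Q"
      show "p \<bullet> \<xi> - (\<phi> x \<xi> + \<delta> * \<psi> x) \<le> H_of Q \<phi> x p - \<delta> * \<psi> x"
        using H_of_ge[OF \<phi> Q_compact \<xi>, of p x] by simp
    qed
    then show "\<delta> * \<psi> x + H_of Q (\<lambda>x \<xi>. \<phi> x \<xi> + \<delta> * \<psi> x) x p \<le> 0 * \<psi> x + H_of Q \<phi> x p"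
      by simp
  qed
  then show "visc_subsolution \<nu> j \<delta> (H_of Q (\<lambda>x \<xi>. \<phi> x \<xi> + \<delta> * \<psi> x)) \<psi>"
    unfolding visc_subsolution_iff using \<psi>C by simp
qed

lemma solution_subsolution_L: "visc_solution \<nu> j 0 H v \<Longrightarrow> visc_subsolution \<nu> j 0 (H_of Q L) v"
  unfolding visc_subsolution_iff using solutionD(1,5)[OF order_refl zero_less_one] by blast

section \<open>Mather measures and accumulation points of the discounted solutions\<close>

abbreviation M where "M \<equiv> mather_measures \<nu> j Q L"

lemma M_D:
  assumes "\<mu> \<in> M"
  shows "prob_space \<mu>" "sets \<mu> = sets (restrict_space borel (UNIV \<times> Q))" "integral_K \<mu> L = 0"
    "f \<in> G_K \<nu> j Q \<Longrightarrow> integral_K \<mu> f \<ge> 0"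
  using assms by (auto simp: mather_measures_def G_K_dual_def)

lemma M_u_le:
  assumes \<mu>: "\<mu> \<in> M" and \<delta>: "0 < \<delta>" "\<delta> < 1"
  shows "integral_K \<mu> (\<lambda>x \<xi>. u \<delta> x) \<le> 0"
proof -
  note U = solutionD[OF less_imp_le[OF \<delta>(1)] \<delta>(2) u_solution[OF \<delta>]]
  define \<phi> where "\<phi> = (\<lambda>x \<xi>. L x \<xi> + (- \<delta>) * u \<delta> x)"
  have C: "\<phi> \<in> C_K Q"
    unfolding \<phi>_def by (rule C_K_add[OF L_C_K C_K_C_torus[OF C_torus_cmult[OF U(1)]]])
  have "vsub \<nu> j (\<lambda>x p. 0 * u \<delta> x + H_of Q \<phi> x p) (\<lambda>x. u \<delta> x + 0)"
  proof (rule vsub_shift[OF U(5)])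
    fix x p
    show "0 * u \<delta> x + H_of Q \<phi> x p \<le> \<delta> * u \<delta> x + H_of Q L x p"
      unfolding mult_zero_left add_0_left
    proof (rule H_of_le[OF C Q_compact Q_nonempty])
      fix \<xi> assume \<xi>: "\<xi> \<in> Q"
      show "p \<bullet> \<xi> - \<phi> x \<xi> \<le> \<delta> * u \<delta> x + H_of Q L x p"
        using H_of_ge[OF L_C_K Q_compact \<xi>, of p x] by (simp add: \<phi>_def)
    qed
  qed
  then have "visc_subsolution \<nu> j 0 (H_of Q \<phi>) (u \<delta>)"
    unfolding visc_subsolution_iff using U(1) by simp
  then have "\<phi> \<in> G_K \<nu> j Q"
    using C unfolding G_K_def by blast
  then have "0 \<le> integral_K \<mu> \<phi>" by (rule M_D(4)[OF \<mu>])
  also have "\<dots> = integral_K \<mu> L + (- \<delta>) * integral_K \<mu> (\<lambda>x \<xi>. u \<delta> x)"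
    unfolding \<phi>_def by (rule integral_K_add[OF M_D(1,2)[OF \<mu>] L_C_K C_K_C_torus[OF U(1)] Q_compact])
  finally show ?thesis
    using \<delta>(1) M_D(3)[OF \<mu>] by (simp add: mult_le_0_iff)
qed

text \<open>Stability applies with \<open>H\<close> itself, by its continuity; the discount term
  disappears because \<open>u\<close> is bounded uniformly in \<open>\<delta>\<close>. The sign of
  the integrals survives because convergence is uniform and the total mass is one.\<close>

lemma limit_solution:
  assumes \<delta>: "\<And>n. 0 < \<delta> n" "\<And>n. \<delta> n < 1" "\<delta> \<longlonglongrightarrow> 0" and w: "uniform_limit UNIV (\<lambda>n. u (\<delta> n)) w sequentially"
  shows "visc_solution \<nu> j 0 H w" "\<mu> \<in> M \<Longrightarrow> integral_K \<mu> (\<lambda>x \<xi>. w x) \<le> 0"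
proof -
  note U = solutionD[OF less_imp_le[OF \<delta>(1)] \<delta>(2) u_solution[OF \<delta>(1,2)]]
  have pw: "(\<lambda>n. u (\<delta> n) x) \<longlonglongrightarrow> w x" for x
    by (rule tendsto_uniform_limitI[OF w]) simp
  have wc: "continuous_on UNIV w"
    by (rule uniform_limit_theorem[OF always_eventually[OF allI[OF C_torusD(2)[OF U(1)]]] w]) simp
  have wp: "w x = w y" if xy: "lattice_equiv x y" for x y
  proof -
    have "u (\<delta> n) x = u (\<delta> n) y" for n by (rule periodicD[OF C_torusD(1)[OF U(1)] xy])
    then show ?thesis using LIMSEQ_unique[OF pw[of x]] pw[of y] by simp
  qed
  have wC: "w \<in> C_torus" using wc wp by (simp add: C_torus_def periodic_def)
  obtain B where B: "B > 0" "\<And>\<delta> x. 0 < \<delta> \<Longrightarrow> \<delta> < 1 \<Longrightarrow> \<bar>u \<delta> x\<bar> \<le> B" by (rule u_bounded) (rule that)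
  have du: "(\<lambda>n. \<delta> n * u (\<delta> n) (Z n)) \<longlonglongrightarrow> 0" for Z
  proof (rule Lim_null_comparison[OF _ tendsto_mult_left_zero[OF \<delta>(3), of B]])
    show "\<forall>\<^sub>F n in sequentially. norm (\<delta> n * u (\<delta> n) (Z n)) \<le> \<delta> n * B"
      using B(2)[OF \<delta>(1,2)] \<delta>(1)[THEN less_imp_le] by (intro always_eventually allI) (simp add: abs_mult mult_left_mono)
  qed
  have Hlim: "(\<lambda>n. H (Z n) (p n)) \<longlonglongrightarrow> H x D" if "Z \<longlonglongrightarrow> x" "p \<longlonglongrightarrow> D" for Z x p D
    using cont_tendsto[OF cont_H tendsto_Pair[OF that]] by simp
  have "vsub \<nu> j (\<lambda>x p. 0 * w x + H x p) w"
  proof (rule vsub_stable[OF U(1) wC w U(3)])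
    fix Z p :: "nat \<Rightarrow> real^'d" and x D assume "Z \<longlonglongrightarrow> x" "p \<longlonglongrightarrow> D"
    from tendsto_add[OF du Hlim[OF this]]
    show "(\<lambda>n. \<delta> n * u (\<delta> n) (Z n) + H (Z n) (p n)) \<longlonglongrightarrow> 0 * w x + H x D" by simp
  qed
  moreover have "vsub \<nu> j (\<lambda>x p. - (0 * w x + H x (- p))) (\<lambda>x. - w x)"
  proof (rule vsub_stable[OF C_torus_minus[OF U(1)] C_torus_minus[OF wC] uniform_limit_uminus[OF w] U(4)])
    fix Z p :: "nat \<Rightarrow> real^'d" and x D assume a: "Z \<longlonglongrightarrow> x" "p \<longlonglongrightarrow> D"
    from tendsto_minus[OF tendsto_add[OF du Hlim[OF a(1) tendsto_minus[OF a(2)]]]]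
    show "(\<lambda>n. - (\<delta> n * u (\<delta> n) (Z n) + H (Z n) (- p n))) \<longlonglongrightarrow> - (0 * w x + H x (- D))" by simp
  qed
  ultimately show "visc_solution \<nu> j 0 H w"
    unfolding visc_solution_def visc_subsolution_iff visc_supersolution_iff using wC by blast
  show "integral_K \<mu> (\<lambda>x \<xi>. w x) \<le> 0" if \<mu>: "\<mu> \<in> M"
  proof (rule field_le_epsilon)
    fix e :: real assume "e > 0"
    from eventually_happens'[OF sequentially_bot uniform_limitD[OF w this]]
    obtain n where n: "\<forall>x\<in>UNIV. dist (u (\<delta> n) x) (w x) < e" by (rule exE)
    note c1 = C_K_C_torus[OF U(1)[of n], of Q] C_K_C_torus[OF C_torus_const[of 1], of Q]
    have "integral_K \<mu> (\<lambda>x \<xi>. w x) \<le> integral_K \<mu> (\<lambda>x \<xi>. u (\<delta> n) x + e * 1)"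
    proof (rule integral_K_mono[OF M_D(1,2)[OF \<mu>] C_K_C_torus[OF wC] C_K_add[OF c1(1) C_K_cmult[OF c1(2)]] Q_compact])
      fix x \<xi>
      have "dist (u (\<delta> n) x) (w x) < e" using n by simp
      then show "w x \<le> u (\<delta> n) x + e * 1" unfolding dist_norm real_norm_def by arith
    qed
    also have "\<dots> = integral_K \<mu> (\<lambda>x \<xi>. u (\<delta> n) x) + e * integral_K \<mu> (\<lambda>x \<xi>. 1)"
      by (rule integral_K_add[OF M_D(1,2)[OF \<mu>] c1 Q_compact])
    also have "integral_K \<mu> (\<lambda>x \<xi>. 1) = 1"
      unfolding integral_K_alt using prob_space.prob_space[OF M_D(1)[OF \<mu>]] by simp
    also have "integral_K \<mu> (\<lambda>x \<xi>. u (\<delta> n) x) + e * 1 \<le> 0 + e"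
      using M_u_le[OF \<mu> \<delta>(1,2)] by simp
    finally show "integral_K \<mu> (\<lambda>x \<xi>. w x) \<le> 0 + e" .
  qed
qed

text \<open>For general \<open>\<psi>\<close> the inequality \<open>key\<close> with
  \<open>\<delta> n\<close> tending to 0 gives nonnegativity on \<open>G_K\<close>. For
  \<open>L\<close> its right-hand side is itself at most
  \<open>\<delta> n * u (\<delta> n) z\<close>, so everything can be divided by
  \<open>\<delta> n\<close> before the limit.\<close>

lemma limit_mather_measure:
  assumes \<delta>: "\<And>n. 0 < \<delta> n" "\<And>n. \<delta> n < 1" "\<delta> \<longlonglongrightarrow> 0" and w: "(\<lambda>n. u (\<delta> n) z) \<longlonglongrightarrow> w"
    and v: "visc_solution \<nu> j 0 H v"
  obtains \<mu> where "\<mu> \<in> M" "v z - w \<le> integral_K \<mu> (\<lambda>x \<xi>. v x)"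
proof -
  from choice[OF allI[OF discounted_functional[OF \<delta>(1,2)]]] obtain \<Lambda> where \<Lambda>: "\<forall>n. linear_functional_on V (\<Lambda> n) \<and> (\<forall>f t. f \<in> V \<longrightarrow> (\<forall>y\<in>X. f y \<le> t) \<longrightarrow> \<Lambda> n f \<le> t) \<and>
    \<Lambda> n (ext L) \<le> \<delta> n * u (\<delta> n) z \<and>
    (\<forall>\<phi> \<psi>. \<phi> \<in> C_K Q \<longrightarrow> visc_subsolution \<nu> j (\<delta> n) (H_of Q \<phi>) \<psi> \<longrightarrow> \<delta> n * \<psi> z \<le> \<Lambda> n (ext \<phi>))" ..
  have lin: "linear_functional_on V (\<Lambda> n)" and up: "f \<in> V \<Longrightarrow> (\<And>y. y \<in> X \<Longrightarrow> f y \<le> t) \<Longrightarrow> \<Lambda> n f \<le> t"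
    and \<Lambda>L: "\<Lambda> n (ext L) \<le> \<delta> n * u (\<delta> n) z"
    and \<Lambda>G: "\<phi> \<in> C_K Q \<Longrightarrow> visc_subsolution \<nu> j (\<delta> n) (H_of Q \<phi>) \<psi> \<Longrightarrow> \<delta> n * \<psi> z \<le> \<Lambda> n (ext \<phi>)" for n f t \<phi> \<psi>
    using \<Lambda>[rule_format, of n] by simp_all
  have neg: "\<Lambda>' (\<lambda>y. - f y) = - \<Lambda>' f" if "linear_functional_on V \<Lambda>'" "f \<in> V" for \<Lambda>' f
  proof -
    have "\<Lambda>' (\<lambda>y. (-1) * f y) = (-1) * \<Lambda>' f"
      using that unfolding linear_functional_on_def by blast
    then show ?thesis by simp
  qed
  note Vneg = function_spaceD(3)[OF function_space_V]
  have "(\<lambda>y. 0) \<in> V" by simp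
  then have neV: "V \<noteq> {}" by (rule ex_in_conv[THEN iffD1, OF exI])
  have bdd: "\<exists>B. \<forall>n. \<bar>\<Lambda> n f\<bar> \<le> B" if f: "f \<in> V" for f
  proof -
    obtain B where B: "\<And>y. y \<in> X \<Longrightarrow> \<bar>f y\<bar> \<le> B" by (rule V_bounded[OF f]) (rule that)
    have "\<bar>\<Lambda> n f\<bar> \<le> B" for n
    proof -
      have "\<Lambda> n f \<le> B" by (rule up[OF f]) (use B in \<open>simp add: abs_le_iff\<close>)
      moreover have "\<Lambda> n (\<lambda>y. - f y) \<le> B" by (rule up[OF Vneg[OF f]]) (use B in \<open>simp add: abs_le_iff\<close>)
      ultimately show ?thesis using neg[OF lin f] by (simp add: abs_le_iff)
    qed
    then show ?thesis by blast
  qed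
  obtain \<Lambda>0 where lin0: "linear_functional_on V \<Lambda>0"
    and lim0: "\<And>f t. f \<in> V \<Longrightarrow> (\<forall>\<^sub>F n in sequentially. \<Lambda> n f \<le> t) \<Longrightarrow> \<Lambda>0 f \<le> t"
    by (rule limit_functional[OF function_space_V neV lin bdd]) (assumption, rule that)
  have up0: "\<Lambda>0 f \<le> t" if "f \<in> V" "\<And>y. y \<in> X \<Longrightarrow> f y \<le> t" for f t
    by (rule lim0[OF that(1)]) (use up[OF that] in \<open>simp add: always_eventually\<close>)
  have lim0': "\<Lambda>0 f \<le> t" if f: "f \<in> V" and s: "\<And>n. \<Lambda> n f \<le> s n" and st: "s \<longlonglongrightarrow> t" for f s t
  proof (rule field_le_epsilon)
    fix e :: real assume "e > 0"
    then have "\<forall>\<^sub>F n in sequentially. s n < t + e"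
      using order_tendstoD(2)[OF st, of "t + e"] by simp
    then have "\<forall>\<^sub>F n in sequentially. \<Lambda> n f \<le> t + e"
    proof eventually_elim
      case (elim n)
      then show ?case using s[of n] by simp
    qed
    then show "\<Lambda>0 f \<le> t + e" by (rule lim0[OF f])
  qed
  obtain \<mu> :: "('d torus \<times> (real^'d)) measure" where \<mu>: "prob_space \<mu>"
    "sets \<mu> = sets (restrict_space borel (UNIV \<times> Q))"
    "\<And>\<phi>. \<phi> \<in> C_K Q \<Longrightarrow> integral_K \<mu> \<phi> = \<Lambda>0 (ext \<phi>)"
    by (rule measure_of_functional[OF Q_compact lin0 up0]) (simp, assumption, rule that)
  have key: "\<delta> n * \<psi> z - \<delta> n * \<Lambda> n (\<lambda>y. \<psi> (fst y)) \<le> \<Lambda> n (ext \<phi>)"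
    if \<phi>: "\<phi> \<in> C_K Q" and \<psi>: "visc_subsolution \<nu> j 0 (H_of Q \<phi>) \<psi>" for \<phi> \<psi> n
  proof -
    have \<psi>C: "\<psi> \<in> C_torus" using \<psi> unfolding visc_subsolution_iff by auto
    have mem: "ext \<phi> \<in> V" "(\<lambda>y. \<psi> (fst y)) \<in> V"
      using ext_V[OF \<phi>] ext_V[OF C_K_C_torus[OF \<psi>C]] by auto
    have "\<delta> n * \<psi> z \<le> \<Lambda> n (ext (\<lambda>x \<xi>. \<phi> x \<xi> + \<delta> n * \<psi> x))"
      by (rule \<Lambda>G[OF subsolution_discount[OF \<phi> \<psi>]])
    also have "\<dots> = \<Lambda> n (ext \<phi>) + \<Lambda> n (\<lambda>y. \<delta> n * \<psi> (fst y))"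
      by (rule linear_functional_onD(1)[OF lin mem(1) function_spaceD(2)[OF function_space_V mem(2)]])
    also have "\<Lambda> n (\<lambda>y. \<delta> n * \<psi> (fst y)) = \<delta> n * \<Lambda> n (\<lambda>y. \<psi> (fst y))"
      by (rule linear_functional_onD(2)[OF lin mem(2)])
    finally show ?thesis by simp
  qed
  have G: "0 \<le> integral_K \<mu> f" if f: "f \<in> G_K \<nu> j Q" for f
  proof -
    obtain \<psi> where fC: "f \<in> C_K Q" and \<psi>: "visc_subsolution \<nu> j 0 (H_of Q f) \<psi>"
      using f unfolding G_K_def by blast
    have \<psi>C: "\<psi> \<in> C_torus" using \<psi> unfolding visc_subsolution_iff by auto
    obtain B where B: "\<And>x. \<bar>\<psi> x\<bar> \<le> B" by (rule C_torus_bounded[OF \<psi>C]) (rule that)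
    have mem: "(\<lambda>y. \<psi> (fst y)) \<in> V" using ext_V[OF C_K_C_torus[OF \<psi>C]] by auto
    have "\<Lambda> n (\<lambda>y. - ext f y) \<le> \<delta> n * (2 * B)" for n
    proof -
      have "\<Lambda> n (\<lambda>y. \<psi> (fst y)) \<le> B"
        by (rule up[OF mem]) (use B in \<open>simp add: abs_le_iff\<close>)
      then have "\<Lambda> n (\<lambda>y. \<psi> (fst y)) - \<psi> z \<le> 2 * B"
        using B[of z] by (simp add: abs_le_iff)
      then have "\<delta> n * (\<Lambda> n (\<lambda>y. \<psi> (fst y)) - \<psi> z) \<le> \<delta> n * (2 * B)"
        using \<delta>(1)[of n] by (intro mult_left_mono) auto
      then show ?thesis
        using key[OF fC \<psi>, of n] neg[OF lin ext_V[OF fC], of n] by (simp add: right_diff_distrib)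
    qed
    then have "\<Lambda>0 (\<lambda>y. - ext f y) \<le> 0"
      by (rule lim0'[OF Vneg[OF ext_V[OF fC]] _ tendsto_mult_left_zero[OF \<delta>(3)]])
    then show ?thesis
      using neg[OF lin0 ext_V[OF fC]] \<mu>(3)[OF fC] by simp
  qed
  \<comment> \<open>Membership of \<open>L\<close> gives a nonnegative integral; the bound on
    \<open>\<Lambda> n (ext L)\<close> gives the reverse inequality in the limit.\<close>
  have LG: "L \<in> G_K \<nu> j Q"
    unfolding G_K_def using L_C_K solution_subsolution_L[OF v] by blast
  have "(\<lambda>n. \<delta> n * u (\<delta> n) z) \<longlonglongrightarrow> 0 * w"
    by (intro tendsto_mult \<delta>(3) w)
  then have "(\<lambda>n. \<delta> n * u (\<delta> n) z) \<longlonglongrightarrow> 0" by simp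
  then have "\<Lambda>0 (ext L) \<le> 0"
    by (rule lim0'[OF ext_V[OF L_C_K] \<Lambda>L])
  then have "integral_K \<mu> L = 0"
    using G[OF LG] \<mu>(3)[OF L_C_K] by simp
  then have "\<mu> \<in> M"
    unfolding mather_measures_def G_K_dual_def using \<mu>(1,2) G by blast
  moreover have "v z - w \<le> integral_K \<mu> (\<lambda>x \<xi>. v x)"
  proof -
    have vC: "v \<in> C_torus" by (rule solutionD(1)[OF order_refl zero_less_one v])
    have mem: "(\<lambda>y. v (fst y)) \<in> V" using ext_V[OF C_K_C_torus[OF vC]] by auto
    have "\<Lambda> n (\<lambda>y. - v (fst y)) \<le> u (\<delta> n) z - v z" for n
    proof -
      have "\<delta> n * v z - \<delta> n * \<Lambda> n (\<lambda>y. v (fst y)) \<le> \<delta> n * u (\<delta> n) z"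
        using key[OF L_C_K solution_subsolution_L[OF v], of n] \<Lambda>L[of n] by linarith
      then have "\<delta> n * (v z - \<Lambda> n (\<lambda>y. v (fst y))) \<le> \<delta> n * u (\<delta> n) z"
        by (simp add: right_diff_distrib)
      then have "v z - \<Lambda> n (\<lambda>y. v (fst y)) \<le> u (\<delta> n) z"
        using \<delta>(1)[of n] by simp
      then show ?thesis using neg[OF lin mem, of n] by simp
    qed
    then have "\<Lambda>0 (\<lambda>y. - v (fst y)) \<le> w - v z"
      by (rule lim0'[OF Vneg[OF mem] _ tendsto_diff[OF w tendsto_const]])
    then show ?thesis
      using neg[OF lin0 mem] \<mu>(3)[OF C_K_C_torus[OF vC]] by simp
  qed
  ultimately show ?thesis by (rule that)
qed

abbreviation S where "S \<equiv> S_minus \<nu> j H M"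

lemma limit_maximal:
  assumes \<delta>: "\<And>n. 0 < \<delta> n" "\<And>n. \<delta> n < 1" "\<delta> \<longlonglongrightarrow> 0" and w: "uniform_limit UNIV (\<lambda>n. u (\<delta> n)) w sequentially"
  shows "w \<in> S" "\<And>v x. v \<in> S \<Longrightarrow> v x \<le> w x" "\<exists>\<mu>\<in>M. integral_K \<mu> (\<lambda>x \<xi>. w x) = 0"
proof -
  note sol = limit_solution[OF \<delta> w]
  have pw: "(\<lambda>n. u (\<delta> n) x) \<longlonglongrightarrow> w x" for x
    by (rule tendsto_uniform_limitI[OF w]) simp
  show "w \<in> S" unfolding S_minus_def using sol by blast
  show "v x \<le> w x" if v: "v \<in> S" for v x
  proof -
    have vs: "visc_solution \<nu> j 0 H v" using v unfolding S_minus_def by blast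
    obtain \<mu> where "\<mu> \<in> M" "v x - w x \<le> integral_K \<mu> (\<lambda>x \<xi>. v x)"
      by (rule limit_mather_measure[OF \<delta> pw vs]) (rule that)
    moreover have "integral_K \<mu> (\<lambda>x \<xi>. v x) \<le> 0"
      using v \<open>\<mu> \<in> M\<close> unfolding S_minus_def by blast
    ultimately show ?thesis by linarith
  qed
  \<comment> \<open>With \<open>v = w\<close> the left-hand side is zero, so the integral of
    \<open>w\<close> is nonnegative; it is also at most zero for every measure in \<open>M\<close>.
    The base point is arbitrary.\<close>
  obtain \<mu> where \<mu>: "\<mu> \<in> M" "w 0 - w 0 \<le> integral_K \<mu> (\<lambda>x \<xi>. w x)"
    by (rule limit_mather_measure[OF \<delta> pw sol(1)]) (rule that)
  have "integral_K \<mu> (\<lambda>x \<xi>. w x) = 0"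
    using \<mu>(2) sol(2)[OF \<mu>(1)] by simp
  then show "\<exists>\<mu>\<in>M. integral_K \<mu> (\<lambda>x \<xi>. w x) = 0" using \<mu>(1) by (rule bexI)
qed

text \<open>The common Lipschitz constant \<open>\<kappa>\<close> and the uniform bound give
  Arzela-Ascoli on one cube; choosing representatives there carries uniform convergence to the whole
  space.\<close>

lemma subsequence_converges:
  assumes \<delta>: "\<And>n. 0 < \<delta> n" "\<And>n. \<delta> n < 1"
  obtains w r where "strict_mono (r :: nat \<Rightarrow> nat)" "uniform_limit UNIV (\<lambda>n. u (\<delta> (r n))) w sequentially"
proof -
  note U = solutionD[OF less_imp_le[OF \<delta>(1)] \<delta>(2) u_solution[OF \<delta>(1,2)]]
  obtain B where B: "B > 0" "\<And>\<delta> x. 0 < \<delta> \<Longrightarrow> \<delta> < 1 \<Longrightarrow> \<bar>u \<delta> x\<bar> \<le> B" by (rule u_bounded) (rule that)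
  obtain g r where gr: "continuous_on (cube (0::real^'d)) g" "strict_mono (r :: nat \<Rightarrow> nat)"
    "\<And>e. 0 < e \<Longrightarrow> \<exists>N. \<forall>n x. n \<ge> N \<and> x \<in> cube 0 \<longrightarrow> norm (u (\<delta> (r n)) x - g x) < e"
  proof (rule Arzela_Ascoli[of "cube (0::real^'d)" "\<lambda>n. u (\<delta> n)" B])
    show "compact (cube (0::real^'d))" by (rule compact_cube)
    show "norm (u (\<delta> n) x) \<le> B" for n x
      using B(2)[OF \<delta>(1,2)] by simp
    show "\<exists>d>0. \<forall>n y. y \<in> cube 0 \<and> norm (x - y) < d \<longrightarrow> norm (u (\<delta> n) x - u (\<delta> n) y) < e" if "0 < e" for x :: "real^'d" and e
    proof (intro exI[of _ "e / \<kappa>"] conjI allI impI)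
      show "0 < e / \<kappa>" using that kappa by simp
      fix n y assume "y \<in> cube 0 \<and> norm (x - y) < e / \<kappa>"
      then have "\<kappa> * norm (x - y) < e"
        using kappa by (simp add: pos_less_divide_eq mult.commute)
      then show "norm (u (\<delta> n) x - u (\<delta> n) y) < e"
        using U(2)[of n x y] by simp
    qed
  qed (rule that)
  define c where "c x = (SOME y. y \<in> cube 0 \<and> lattice_equiv x y)" for x :: "real^'d"
  have c: "c x \<in> cube 0" "lattice_equiv x (c x)" for x
  proof -
    have "\<exists>y. y \<in> cube 0 \<and> lattice_equiv x y" using lattice_equiv_cube_ex[of 0 x] by blast
    from someI_ex[OF this] show "c x \<in> cube 0" "lattice_equiv x (c x)" unfolding c_def by auto
  qed
  have "uniform_limit UNIV (\<lambda>n. u (\<delta> (r n))) (\<lambda>x. g (c x)) sequentially"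
    unfolding uniform_limit_sequentially_iff
  proof (intro allI impI)
    fix e :: real assume "e > 0"
    from gr(3)[OF this] obtain N where N: "\<forall>n x. n \<ge> N \<and> x \<in> cube 0 \<longrightarrow> norm (u (\<delta> (r n)) x - g x) < e" ..
    have "dist (u (\<delta> (r n)) x) (g (c x)) < e" if "n \<ge> N" for n x
      using N[rule_format, of n "c x"] that c(1) periodicD[OF C_torusD(1)[OF U(1)] c(2), of "r n" x]
      by (simp add: dist_norm)
    then show "\<exists>N. \<forall>n\<ge>N. \<forall>x\<in>UNIV. dist (u (\<delta> (r n)) x) (g (c x)) < e" by blast
  qed
  then show ?thesis by (rule that[OF gr(2)])
qed

text \<open>The limit is determined by \<open>S\<close> alone and so is the same for all sequences;
  since each has a convergent subsequence, the whole family converges.\<close>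

theorem vanishing_discount_limit:
  fixes u0 :: "real^'d \<Rightarrow> real"
  assumes u0: "u0 = (\<lambda>x. SUP v\<in>S. v x)"
  shows "\<forall>x. bdd_above ((\<lambda>v. v x) ` S)" "uniform_limit UNIV u u0 (at_right 0)" "u0 \<in> S"
    "\<exists>\<mu>\<in>M. integral_K \<mu> (\<lambda>x \<xi>. u0 x) = 0" "\<forall>\<mu>\<in>M. integral_K \<mu> (\<lambda>x \<xi>. u0 x) \<le> 0"
proof -
  have limit: "w = u0 \<and> (\<forall>x. bdd_above ((\<lambda>v. v x) ` S)) \<and> w \<in> S \<and> (\<exists>\<mu>\<in>M. integral_K \<mu> (\<lambda>x \<xi>. w x) = 0)"
    if \<delta>: "\<And>n. 0 < \<delta> n" "\<And>n. \<delta> n < 1" "\<delta> \<longlonglongrightarrow> 0" and w: "uniform_limit UNIV (\<lambda>n. u (\<delta> n)) w sequentially" for \<delta> w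
  proof -
    note m = limit_maximal[OF \<delta> w]
    have "bdd_above ((\<lambda>v. v x) ` S)" for x
      by (rule bdd_aboveI2[of _ _ "w x"]) (rule m(2))
    moreover have "(SUP v\<in>S. v x) = w x" for x
      by (rule cSup_eq_maximum) (use m(1,2) in auto)
    ultimately show ?thesis
      using m(1,3) unfolding u0 by (auto intro: ext)
  qed
  have sub: "\<exists>r. strict_mono (r :: nat \<Rightarrow> nat) \<and> uniform_limit UNIV (\<lambda>n. u (\<delta> (r n))) u0 sequentially \<and>
    (\<forall>x. bdd_above ((\<lambda>v. v x) ` S)) \<and> u0 \<in> S \<and> (\<exists>\<mu>\<in>M. integral_K \<mu> (\<lambda>x \<xi>. u0 x) = 0)"
    if \<delta>: "\<And>n. 0 < \<delta> n" "\<And>n. \<delta> n < 1" "\<delta> \<longlonglongrightarrow> 0" for \<delta>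
  proof -
    obtain w r where r: "strict_mono (r :: nat \<Rightarrow> nat)" "uniform_limit UNIV (\<lambda>n. u (\<delta> (r n))) w sequentially"
      by (rule subsequence_converges[OF \<delta>(1,2)]) (rule that)
    have "(\<lambda>n. \<delta> (r n)) \<longlonglongrightarrow> 0"
      using LIMSEQ_subseq_LIMSEQ[OF \<delta>(3) r(1)] by (simp add: o_def)
    from limit[OF \<delta>(1,2) this r(2)] show ?thesis using r by blast
  qed
  \<comment> \<open>Two successors keep the discounts strictly below 1.\<close>
  have d0: "0 < 1 / real (Suc (Suc n))" "1 / real (Suc (Suc n)) < 1" for n
    by simp_all
  have d1: "(\<lambda>n. 1 / real (Suc (Suc n))) \<longlonglongrightarrow> 0"
    by (rule LIMSEQ_Suc[OF LIMSEQ_Suc[OF lim_1_over_n]])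
  from sub[OF d0 d1] have main: "(\<forall>x. bdd_above ((\<lambda>v. v x) ` S)) \<and> u0 \<in> S \<and> (\<exists>\<mu>\<in>M. integral_K \<mu> (\<lambda>x \<xi>. u0 x) = 0)"
    by (elim exE conjE) (intro conjI)
  then show "\<forall>x. bdd_above ((\<lambda>v. v x) ` S)" "u0 \<in> S" "\<exists>\<mu>\<in>M. integral_K \<mu> (\<lambda>x \<xi>. u0 x) = 0" by auto
  then show "\<forall>\<mu>\<in>M. integral_K \<mu> (\<lambda>x \<xi>. u0 x) \<le> 0" unfolding S_minus_def by blast
  show "uniform_limit UNIV u u0 (at_right 0)"
  proof (rule uniform_limitI, rule ccontr)
    fix e :: real assume e: "e > 0"
    assume "\<not> (\<forall>\<^sub>F \<delta> in at_right 0. \<forall>x\<in>UNIV. dist (u \<delta> x) (u0 x) < e)"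
    then have "\<exists>\<delta>. 0 < \<delta> \<and> \<delta> < 1 / real (Suc (Suc n)) \<and> \<not> (\<forall>x\<in>UNIV. dist (u \<delta> x) (u0 x) < e)" for n
      unfolding eventually_at_right_field using d0(1)[of n] by blast
    from choice[OF allI[OF this]] obtain \<delta> where
      \<delta>: "\<forall>n. 0 < \<delta> n \<and> \<delta> n < 1 / real (Suc (Suc n)) \<and> \<not> (\<forall>x\<in>UNIV. dist (u (\<delta> n) x) (u0 x) < e)" ..
    have \<delta>1: "0 < \<delta> n" "\<delta> n < 1" for n
      using \<delta>[rule_format, of n] d0(2)[of n] by linarith+
    have \<delta>2: "\<delta> \<longlonglongrightarrow> 0"
      by (rule squeeze_null[OF _ _ d1]) (use \<delta> in \<open>auto intro: less_imp_le\<close>)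
    from sub[OF \<delta>1 \<delta>2] obtain r where "uniform_limit UNIV (\<lambda>n. u (\<delta> (r n))) u0 sequentially" by blast
    from eventually_happens'[OF sequentially_bot uniform_limitD[OF this e]]
    obtain n where "\<forall>x\<in>UNIV. dist (u (\<delta> (r n)) x) (u0 x) < e" by (rule exE)
    then show False using \<delta> by blast
  qed
qed

end

text \<open>Boundedness is part of the claim because a real supremum has its usual meaning only for
  bounded nonempty sets; nonemptiness is contained in \<open>u0 \<in> S\<close>. The last two
  conjuncts together say that the maximum is attained and equals 0.\<close>

theorem theorem4p9:
  fixes \<nu> :: "(real^'d) measure"
    and j :: "real^'d \<Rightarrow> real^'d \<Rightarrow> real^'d"
    and H :: "real^'d \<Rightarrow> real^'d \<Rightarrow> real"
    and \<kappa> :: real and Q :: "(real^'d) set" and k :: nat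
    and u :: "real \<Rightarrow> real^'d \<Rightarrow> real"
    and M :: "('d torus \<times> (real^'d)) measure set"
    and S :: "(real^'d \<Rightarrow> real) set"
    and u0 :: "real^'d \<Rightarrow> real"
  assumes standing: "standing_assumptions \<nu> j"
    and H_periodic: "periodic H"
    and H_continuous: "continuous_on UNIV (\<lambda>(x, p). H x p)"
    and H_convex: "\<And>x. convex_on UNIV (H x)"
    and EX: "\<And>\<delta>. 0 \<le> \<delta> \<Longrightarrow> \<delta> < 1 \<Longrightarrow> \<exists>v. visc_solution \<nu> j \<delta> H v"
    and kappa: "\<kappa> > 0"
    and LB: "\<And>\<delta> v. 0 \<le> \<delta> \<Longrightarrow> \<delta> < 1 \<Longrightarrow> visc_solution \<nu> j \<delta> H v \<Longrightarrow> gradient_bound \<kappa> v"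
    and Q_compact: "compact Q"
    and Q_subdiff: "\<And>x p. p \<in> cball 0 \<kappa> \<Longrightarrow> subdiff (H x) p \<subseteq> Q"
    and k_large: "\<And>x p. p \<in> cball 0 \<kappa> \<Longrightarrow> H_tilde H k x p = H x p"
    and u_solution: "\<And>\<delta>. 0 < \<delta> \<Longrightarrow> \<delta> < 1 \<Longrightarrow> visc_solution \<nu> j \<delta> H (u \<delta>)"
    and M_eq: "M = mather_measures \<nu> j Q (lagrangian H k)"
    and S_eq: "S = S_minus \<nu> j H M"
    and u0_eq: "u0 = (\<lambda>x. SUP v\<in>S. v x)"
  shows "(\<forall>x. bdd_above ((\<lambda>v. v x) ` S)) \<and>
    uniform_limit UNIV u u0 (at_right 0) \<and>
    u0 \<in> S \<and>
    (\<exists>\<mu>\<in>M. integral_K \<mu> (\<lambda>x \<xi>. u0 x) = 0) \<and>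
    (\<forall>\<mu>\<in>M. integral_K \<mu> (\<lambda>x \<xi>. u0 x) \<le> 0)"
proof -
  interpret vanishing_discount \<nu> j H \<kappa> Q k u
    by unfold_locales
      (use standing H_periodic H_continuous H_convex EX[of 0] kappa LB Q_compact Q_subdiff k_large u_solution in auto)
  show ?thesis
    unfolding S_eq M_eq u0_eq by (intro conjI vanishing_discount_limit[OF refl])
qed

end
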